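(* For each prime $p$ let $N=N(p)$ satisfy $N=p^{o(1)}$ as $p\to\infty$. Then $$S_p=S_p(N)+O\!\left(N^{-252/463+o(1)}\log p\right)$$ as $p\to\infty$.
   Context: For a prime $p$ and an integer $u$ with $\gcd(u,p)=1$, the Fermat quotient $q_p(u)$ is the unique integer with $q_p(u)\equiv \frac{u^{p-1}-1}{p} \pmod p$ and $0\le q_p(u)\le p-1$; also $q_p(u)=0$ if $u\equiv 0\pmod p$. For $N\ge1$, $\mathcal{Q}_p(N)=\{n\le N: n\text{ a positive integer},\ q_p(n)=0\}$. $\Lambda$ is the von Mangoldt function: $\Lambda(n)=\log \ell$ if $n$ is a power of a prime $\ell$, and $\Lambda(n)=0$ otherwise. Define $S_p(N)=\sum_{n\in\mathcal{Q}_p(N)}\frac{\Lambda(n)}{n}$ and the Ihara sum $S_p=S_p(p)=\sum_{n\in\mathcal{Q}_p(p)}\frac{\Lambda(n)}{n}$. *)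

theory Defs
  imports
    "HOL-Analysis.Analysis"
    "HOL-Library.Landau_Symbols"
    "HOL-Number_Theory.Number_Theory"
begin

(* The division in fermat_quotient is exact when p is prime, by Fermat's little theorem. *)
definition fermat_quotient :: "nat \<Rightarrow> int \<Rightarrow> int" where
  "fermat_quotient p u =
     (if coprime u (int p)
      then (THE q. [q = (u ^ (p - 1) - 1) div int p] (mod int p) \<and> 0 \<le> q \<and> q \<le> int p - 1)
      else 0)"

lemma fermat_quotient_exact:
  assumes "prime p" "coprime u (int p)"
  shows "int p dvd u ^ (p - 1) - 1"
proof -
  have p: "int p > 0"
    using assms(1) prime_gt_0_nat by simp
  define a where "a = nat (u mod int p)"
  have a: "int a = u mod int p"
    using p by (simp add: a_def)
  have "\<not> int p dvd u"
    using assms by (metis coprime_common_divisor dvd_refl not_prime_unit prime_nat_int_transfer)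
  then have "\<not> int p dvd int a"
    by (simp add: a dvd_eq_mod_eq_0)
  then have "[a ^ (p - 1) = 1] (mod p)"
    using assms(1) by (intro fermat_theorem) (simp_all add: int_dvd_int_iff)
  then have "[int a ^ (p - 1) = 1] (mod int p)"
    by (metis cong_int_iff of_nat_1 of_nat_power)
  then have "[u ^ (p - 1) = 1] (mod int p)"
    by (simp add: a cong_def power_mod)
  then show ?thesis
    by (simp add: cong_iff_dvd_diff)
qed

lemma fermat_quotient_eq_mod:
  assumes "prime p" "coprime u (int p)"
  shows "fermat_quotient p u = ((u ^ (p - 1) - 1) div int p) mod int p"
proof -
  have p: "int p > 0"
    using assms(1) prime_gt_0_nat by simp
  have "(THE q. [q = (u ^ (p - 1) - 1) div int p] (mod int p) \<and> 0 \<le> q \<and> q \<le> int p - 1)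
      = ((u ^ (p - 1) - 1) div int p) mod int p"
  proof (rule the_equality)
    fix q assume "[q = (u ^ (p - 1) - 1) div int p] (mod int p) \<and> 0 \<le> q \<and> q \<le> int p - 1"
    then show "q = ((u ^ (p - 1) - 1) div int p) mod int p"
      by (auto simp: cong_def)
  qed (use p in \<open>auto simp: cong_def zle_diff1_eq\<close>)
  then show ?thesis
    using assms(2) by (simp add: fermat_quotient_def)
qed

definition vanishing_fermat_quotients :: "nat \<Rightarrow> real \<Rightarrow> nat set" where
  "vanishing_fermat_quotients p N =
     {n. 0 < n \<and> real n \<le> N \<and> fermat_quotient p (int n) = 0}"

definition ihara_partial_sum :: "nat \<Rightarrow> real \<Rightarrow> real" where
  "ihara_partial_sum p N = (\<Sum>n\<in>vanishing_fermat_quotients p N. mangoldt n / real n)"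

definition ihara_sum :: "nat \<Rightarrow> real" where
  "ihara_sum p = ihara_partial_sum p (real p)"

definition primes_at_top :: "nat filter" where
  "primes_at_top = inf at_top (principal {p. prime p})"

end

theory Submission
  imports Defs "HOL-Computational_Algebra.Computational_Algebra" "HOL-Real_Asymp.Real_Asymp"
begin

text \<open>
  Let \<open>G\<close> be the group of \<open>(p - 1)\<close>-th roots of unity modulo \<open>p^2\<close>; an integer prime to \<open>p\<close> has
  vanishing Fermat quotient iff its residue lies in \<open>G\<close>. The prime powers with this property in a
  dyadic interval \<open>(X/2, X]\<close> are pairwise coprime, so if there are \<open>A\<close> of them, the products of
  \<open>j\<close> of them give \<open>A choose j\<close> elements of \<open>G\<close> in \<open>[1, X^j]\<close>. With \<open>X^j\<close> close to \<open>p^(11/6)\<close>,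
  a bound for the number of elements of \<open>G\<close> in such an interval yields
  \<open>A = O(X^\<beta> log p / log X)\<close> with \<open>\<beta> = 211/463\<close>, and a dyadic summation finishes.

  The count in the interval is controlled by the exponential sums over \<open>a G\<close> for \<open>1 \<le> a < Q\<close> with
  \<open>Q\<close> about \<open>p^(1/6)\<close>. Their fourth moment over all \<open>a\<close> is governed by the additive energy of \<open>G\<close>,
  which is \<open>O(p^(5/2))\<close> by Stepanov's method (Heath-Brown and Konyagin). To profit from the average,
  the cosets \<open>a G\<close> must be almost distinct: coprime pairs \<open>a, b \<le> Y\<close> in a common coset are counted by
  multiplying \<open>k\<close> such fractions \<open>a / b\<close>, since distinct reduced fractions of height less than \<open>p\<close> are
  distinct modulo \<open>p^2\<close>. If \<open>A\<close> were large, fractions formed from products of the prime powers above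
  would be available as additional factors; they fill the gap between \<open>Y^k\<close> and \<open>p\<close>, and the resulting
  exponent has some room to spare, so that no \<open>o(1)\<close> is needed in the final bound.
\<close>

section \<open>Polynomials modulo a prime\<close>

text \<open>The parameters are forced by a balance. With about \<open>Q\<close> pairs in common
  cosets and energy p^(5/2), the exponential sums over 1 \<le> a < Q total about Q^(3/4) p^(7/8),
  which meets the contribution p of the zero frequency exactly at Q = p^(1/6). An interval of length
  H = p^2 / (6 Q), about p^(11/6), then holds about p^(5/6) elements of G at most, and this alone
  suggests the exponent (5/6) / (11/6) = 5/11. The number 211/463 is slightly larger; the margin
  pays for the divisor bound, for the rounding of powers of X \<le> p^(1/1000), for a factor
  p^(1/250) in the coset count, and for all constants and logarithms. The obstacle is the coset
  count: the powers of Y approach p only up to a factor Y, which for some Y \<le> p^(1/6) is too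
  lossy. A family denser than X^(211/463), assumed for contradiction, supplies enough extra
  fractions to make this gap cost only 41/463 of itself. Dyadic blocks beyond p^(1/1000) are treated
  trivially. They save a fixed power of p, and N = p^(o(1)) makes that saving enough.\<close>

definition dvd_modp :: "nat \<Rightarrow> int poly \<Rightarrow> int poly \<Rightarrow> bool" where
  "dvd_modp p R P \<longleftrightarrow> (\<exists>Q. [:int p:] dvd P - R * Q)"

lemma dvd_modpI: "[:int p:] dvd P - R * Q \<Longrightarrow> dvd_modp p R P"
  by (auto simp: dvd_modp_def)

lemma dvd_diff_swap: "a dvd b - c \<Longrightarrow> a dvd c - b" for a b c :: "'a :: comm_ring_1"
  using dvd_minus_iff[of a "b - c"] by simp

lemma poly_dvd_of_const_dvd: "[:c:] dvd P \<Longrightarrow> c dvd poly P (u :: int)"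
  by (elim dvdE) simp

lemma linear_dvd_modp:
  assumes "int p dvd poly P u"
  shows "dvd_modp p [:-u, 1:] P"
proof (rule dvd_modpI)
  have "P - [:-u, 1:] * synthetic_div P u = [:poly P u:]"
    using synthetic_div_correct'[of u P] by (simp add: algebra_simps)
  then show "[:int p:] dvd P - [:-u, 1:] * synthetic_div P u"
    using assms by (simp add: const_poly_dvd_iff coeff_pCons split: nat.split)
qed

lemma linear_not_const_dvd: "prime p \<Longrightarrow> \<not> [:int p:] dvd [:-u, 1:]"
  using prime_gt_1_nat[of p] by (auto simp: const_poly_dvd_iff intro!: exI[of _ 1])

lemma prime_const_poly: "prime p \<Longrightarrow> prime_elem [:int p:]"
  by (simp add: prime_elem_const_poly_iff)

lemma const_dvd_linear_mult_iff:
  assumes "prime p"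
  shows "[:int p:] dvd [:-u, 1:] * P \<longleftrightarrow> [:int p:] dvd P"
  using assms linear_not_const_dvd prime_const_poly prime_elem_dvd_mult_iff by blast

lemma const_dvd_linear_power_mult_iff:
  assumes "prime p"
  shows "[:int p:] dvd [:-u, 1:] ^ n * P \<longleftrightarrow> [:int p:] dvd P"
  by (induction n) (simp_all only: power.simps mult_1_left mult.assoc const_dvd_linear_mult_iff[OF assms])

lemma dvd_modp_cong:
  assumes "dvd_modp p R P" "[:int p:] dvd P' - P"
  shows "dvd_modp p R P'"
proof -
  from assms(1) obtain Q where Q: "[:int p:] dvd P - R * Q" by (auto simp: dvd_modp_def)
  have "P' - R * Q = (P' - P) + (P - R * Q)" by simp
  then show ?thesis using Q assms(2) by (metis dvd_modpI dvd_add)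
qed

lemma dvd_modp_add: "dvd_modp p R P \<Longrightarrow> dvd_modp p R P' \<Longrightarrow> dvd_modp p R (P + P')"
proof -
  assume "dvd_modp p R P" "dvd_modp p R P'"
  then obtain Q Q' where *: "[:int p:] dvd P - R * Q" "[:int p:] dvd P' - R * Q'"
    by (auto simp: dvd_modp_def)
  have "(P + P') - R * (Q + Q') = (P - R * Q) + (P' - R * Q')" by (simp add: algebra_simps)
  then show ?thesis using * by (metis dvd_modpI dvd_add)
qed

lemma dvd_modp_mult: "dvd_modp p R P \<Longrightarrow> dvd_modp p R (S * P)"
proof -
  assume "dvd_modp p R P"
  then obtain Q where *: "[:int p:] dvd P - R * Q" by (auto simp: dvd_modp_def)
  have "S * P - R * (S * Q) = S * (P - R * Q)" by (simp add: algebra_simps)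
  then show ?thesis using * by (metis dvd_modpI dvd_mult)
qed

lemma dvd_modp_mult_left: "dvd_modp p (R * R') P \<Longrightarrow> dvd_modp p R P"
  unfolding dvd_modp_def by (metis mult.assoc)

lemma dvd_modp_self: "dvd_modp p R (R * S)"
  by (rule dvd_modpI[of _ _ _ S]) simp

lemma dvd_modp_root:
  assumes "dvd_modp p ([:-u, 1:] ^ n) P" "n > 0"
  shows "int p dvd poly P u"
proof -
  from assms(1) obtain Q where Q: "[:int p:] dvd P - [:-u, 1:] ^ n * Q" by (auto simp: dvd_modp_def)
  then have "int p dvd poly (P - [:-u, 1:] ^ n * Q) u" by (rule poly_dvd_of_const_dvd)
  moreover have "poly ([:-u, 1:] ^ n * Q) u = 0" using assms(2) by (simp add: power_0_left)
  ultimately show ?thesis by (simp only: poly_diff diff_zero)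
qed

lemma dvd_modp_linear_cancel:
  assumes "prime p" "dvd_modp p ([:-u, 1:] * R) ([:-u, 1:] * P)"
  shows "dvd_modp p R P"
proof -
  from assms(2) obtain Q where Q: "[:int p:] dvd [:-u, 1:] * P - [:-u, 1:] * R * Q"
    by (auto simp: dvd_modp_def)
  have "[:-u, 1:] * P - [:-u, 1:] * R * Q = [:-u, 1:] * (P - R * Q)" by (simp only: right_diff_distrib mult.assoc)
  then show ?thesis using Q const_dvd_linear_mult_iff[OF assms(1)] dvd_modpI by metis
qed

text \<open>Evaluation at v gives p | (v - u) P(v), so v is a root of P modulo p; one factor X - v
  is cancelled and the induction continues with the quotient. Working with integer lifts avoids a
  field type that depends on p.\<close>

lemma dvd_modp_power_linear_coprime:
  assumes "prime p" "\<not> int p dvd v - u"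
  shows "dvd_modp p ([:-v, 1:] ^ n) ([:-u, 1:] * P) \<Longrightarrow> dvd_modp p ([:-v, 1:] ^ n) P"
proof (induction n arbitrary: P)
  case 0
  show ?case by (rule dvd_modpI[of _ _ _ P]) simp
next
  case (Suc n)
  have "int p dvd poly ([:-u, 1:] * P) v" using dvd_modp_root[OF Suc.prems] by simp
  then have "int p dvd (v - u) * poly P v" by (simp add: algebra_simps)
  then have "int p dvd poly P v" using assms by (simp add: prime_dvd_mult_iff)
  then obtain R where R: "[:int p:] dvd P - [:-v, 1:] * R"
    using linear_dvd_modp unfolding dvd_modp_def by blast
  have "[:int p:] dvd [:-u, 1:] * (P - [:-v, 1:] * R)" using R by (rule dvd_mult)
  then have "[:int p:] dvd [:-u, 1:] * P - [:-v, 1:] * ([:-u, 1:] * R)"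
    by (simp only: right_diff_distrib mult.left_commute[of "[:-u, 1:]"])
  from dvd_modp_cong[OF Suc.prems dvd_diff_swap[OF this]]
  have "dvd_modp p ([:-v, 1:] ^ n) ([:-u, 1:] * R)"
    unfolding power_Suc by (rule dvd_modp_linear_cancel[OF assms(1)])
  then have "dvd_modp p ([:-v, 1:] ^ n) R" by (rule Suc.IH)
  then obtain S where S: "[:int p:] dvd R - [:-v, 1:] ^ n * S" by (auto simp: dvd_modp_def)
  have "P - [:-v, 1:] ^ Suc n * S = (P - [:-v, 1:] * R) + [:-v, 1:] * (R - [:-v, 1:] ^ n * S)"
    by (simp add: algebra_simps)
  then show ?case using R S by (metis dvd_modpI dvd_add dvd_mult)
qed

text \<open>The count of roots with multiplicity over F_p, for integer lifts. Synthetic division at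
  a root u gives P = (X - u) Q + c with p | c, so modulo p only the factor X - u is removed, while
  the integer degree drops by exactly one.\<close>

lemma sum_multiplicities_le_degree:
  assumes "prime p" "finite T" "\<And>u v. u \<in> T \<Longrightarrow> v \<in> T \<Longrightarrow> u \<noteq> v \<Longrightarrow> \<not> int p dvd v - u"
    and "\<not> [:int p:] dvd P" "\<And>u. u \<in> T \<Longrightarrow> dvd_modp p ([:-u, 1:] ^ m u) P"
  shows "sum m T \<le> degree P"
  using assms(4,5)
proof (induction "degree P" arbitrary: P m rule: less_induct)
  case less
  show ?case
  proof (cases "\<exists>u\<in>T. m u > 0")
    case False
    then show ?thesis by simp
  next
    case True
    then obtain u where u: "u \<in> T" "m u > 0" by blast
    define Q where "Q = synthetic_div P u"
    define c where "c = poly P u"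
    have P: "P = [:-u, 1:] * Q + [:c:]" using synthetic_div_correct'[of u P] by (simp add: Q_def c_def)
    have c: "int p dvd c" using dvd_modp_root less.prems(2) u unfolding c_def by blast
    have cp: "[:int p:] dvd [:c:]" using c by (simp add: const_poly_dvd_iff coeff_pCons split: nat.split)
    have d0: "degree P \<noteq> 0"
    proof
      assume "degree P = 0"
      then obtain a where "P = [:a:]" using degree_eq_zeroE by blast
      then show False using c less.prems(1) by (auto simp: c_def const_poly_dvd_iff coeff_pCons gr0_conv_Suc split: nat.splits)
    qed
    have dQ: "degree Q = degree P - 1" by (simp add: Q_def degree_synthetic_div)
    have nQ: "\<not> [:int p:] dvd Q"
    proof
      assume "[:int p:] dvd Q"
      then have "[:int p:] dvd [:-u, 1:] * Q + [:c:]" using cp by (intro dvd_add dvd_mult)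
      then show False using less.prems(1) P by simp
    qed
    have eq: "[:int p:] dvd [:-u, 1:] * Q - P"
    proof -
      have "[:-u, 1:] * Q - P = - [:c:]" using P by (metis diff_add_cancel minus_diff_eq add_diff_cancel_left')
      then show ?thesis using cp by simp
    qed
    define m' where "m' = m(u := m u - 1)"
    have "sum m' T \<le> degree Q"
    proof (rule less.hyps)
      show "degree Q < degree P" using d0 dQ by simp
      show "\<not> [:int p:] dvd Q" by (rule nQ)
      fix v assume v: "v \<in> T"
      from dvd_modp_cong[OF less.prems(2)[OF v] eq]
      have *: "dvd_modp p ([:-v, 1:] ^ m v) ([:-u, 1:] * Q)" .
      show "dvd_modp p ([:-v, 1:] ^ m' v) Q"
      proof (cases "v = u")
        case True
        have "[:-u, 1:] ^ m u = [:-u, 1:] * [:-u, 1:] ^ (m u - 1)"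
          using u(2) by (metis power_minus_mult mult.commute)
        then show ?thesis using * True dvd_modp_linear_cancel[OF assms(1)] by (metis fun_upd_same m'_def)
      next
        case False
        then show ?thesis
          using dvd_modp_power_linear_coprime[OF assms(1) assms(3)[OF u(1) v] *] by (simp add: m'_def)
      qed
    qed
    moreover have "sum m T = Suc (sum m' T)"
      using u assms(2) by (simp add: m'_def sum.remove[of T u])
    ultimately show ?thesis using d0 dQ by simp
  qed
qed

text \<open>The derivation X (X - 1) d/dX. Its factor clears the denominators of the derivative of a
  logarithm: modulo p it sends \<open>fq_poly p\<close> to X - X^p, so iterated derivatives of
  polynomials in X, X^p and \<open>fq_poly p\<close> remain of this kind with controlled
  degree.\<close>

definition theta :: "int poly \<Rightarrow> int poly" where
  "theta P = [:0, -1, 1:] * pderiv P"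

lemma theta_add: "theta (P + Q) = theta P + theta Q"
  by (simp add: theta_def pderiv_add algebra_simps)

lemma theta_diff: "theta (P - Q) = theta P - theta Q"
  by (simp add: theta_def pderiv_diff algebra_simps)

lemma theta_smult: "theta (Polynomial.smult c P) = Polynomial.smult c (theta P)"
  by (simp add: theta_def pderiv_smult)

lemma theta_mult: "theta (P * Q) = theta P * Q + P * theta Q"
  by (simp add: theta_def pderiv_mult algebra_simps)

lemma theta_X: "theta [:0, 1:] = [:0, -1, 1:]"
  by (simp add: theta_def pderiv_pCons)

lemma theta_power: "theta (P ^ n) = Polynomial.smult (of_nat n) (P ^ (n - 1) * theta P)"
  by (simp only: theta_def pderiv_power mult_smult_left mult_smult_right mult.left_commute)

lemma theta_dvd:
  assumes "[:int p:] dvd P" shows "[:int p:] dvd theta P"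
proof -
  from assms obtain R where "P = [:int p:] * R" by (elim dvdE)
  then have "theta P = [:int p:] * theta R" by (simp add: theta_smult)
  then show ?thesis by (rule dvdI)
qed

text \<open>If P = (X - u)^D R modulo p, then the lowest term of \<open>theta P\<close> at u is D u
  (u - 1) R(u) (X - u)^(D - 1), and u (u - 1) is a unit. So each further vanishing iterate raises
  the order by one, as long as the factor D of the step is prime to p.\<close>

lemma linear_power_dvd_modp_of_theta:
  assumes "prime p" "\<not> int p dvd u" "\<not> int p dvd u - 1"
  shows "D \<le> p \<Longrightarrow> (\<And>n. n < D \<Longrightarrow> int p dvd poly ((theta ^^ n) P) u) \<Longrightarrow> dvd_modp p ([:-u, 1:] ^ D) P"
proof (induction D arbitrary: P)
  case 0
  show ?case by (rule dvd_modpI[of _ _ _ P]) simp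
next
  case (Suc D)
  show ?case
  proof (cases "D = 0")
    case True
    then show ?thesis using linear_dvd_modp Suc.prems(2)[of 0] by simp
  next
    case False
    let ?L = "[:-u, 1:] :: int poly"
    have "dvd_modp p (?L ^ D) P" using Suc by simp
    then obtain R where R: "[:int p:] dvd P - ?L ^ D * R" by (auto simp: dvd_modp_def)
    have "int p dvd poly ((theta ^^ n) (theta P)) u" if "n < D" for n
      using Suc.prems(2)[of "Suc n"] that by (simp add: funpow_swap1)
    then have "dvd_modp p (?L ^ D) (theta P)" using Suc.IH Suc.prems(1) by simp
    then have "dvd_modp p (?L ^ D) (theta (?L ^ D * R))"
    proof (rule dvd_modp_cong)
      show "[:int p:] dvd theta (?L ^ D * R) - theta P"
        using dvd_diff_swap[OF theta_dvd[OF R, unfolded theta_diff]] .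
    qed
    then obtain S where S: "[:int p:] dvd theta (?L ^ D * R) - ?L ^ D * S" by (auto simp: dvd_modp_def)
    obtain k where k: "D = Suc k" using False by (cases D) auto
    have tL: "theta ?L = [:0, -1, 1:]" by (simp add: theta_def pderiv_pCons)
    have "theta (?L ^ D * R) - ?L ^ D * S
        = ?L ^ k * (Polynomial.smult (of_nat D) ([:0, -1, 1:] * R) + ?L * (theta R - S))"
      unfolding theta_mult theta_power tL using False
      by (simp only: k diff_Suc_1 power_Suc distrib_left right_diff_distrib mult_smult_left mult_smult_right)
         (simp only: ac_simps add_diff_eq)
    then have "[:int p:] dvd Polynomial.smult (of_nat D) ([:0, -1, 1:] * R) + ?L * (theta R - S)"
      using S const_dvd_linear_power_mult_iff[OF assms(1)] by metis
    from poly_dvd_of_const_dvd[OF this, of u]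
    have "int p dvd int D * (u * (u - 1) * poly R u)" by (simp add: algebra_simps)
    moreover have "\<not> int p dvd int D" using Suc.prems(1) False by (simp add: int_dvd_int_iff nat_dvd_not_less)
    ultimately have "int p dvd poly R u" using assms by (simp add: prime_dvd_mult_iff)
    then obtain R' where R': "[:int p:] dvd R - ?L * R'"
      using linear_dvd_modp unfolding dvd_modp_def by blast
    have "P - ?L ^ Suc D * R' = (P - ?L ^ D * R) + ?L ^ D * (R - ?L * R')" by (simp add: algebra_simps)
    then show ?thesis using R R' by (metis dvd_modpI dvd_add dvd_mult)
  qed
qed

section \<open>The truncated logarithm polynomial\<close>

text \<open>
  Modulo \<open>p\<close> this is, up to sign, \<open>X + X^2/2 + \<dots> + X^(p-1)/(p-1)\<close>, the truncation of \<open>-log(1 - X)\<close>.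
  The division is exact for odd primes.
\<close>

definition fq_poly :: "nat \<Rightarrow> int poly" where
  "fq_poly p = ([:0, 1:] ^ p - [:-1, 1:] ^ p - 1) div [:int p:]"

lemma fq_poly_dvd:
  assumes "prime p" "odd p"
  shows "[:int p:] dvd [:0, 1:] ^ p - [:-1, 1:] ^ p - 1"
proof -
  have "[:-1, 1:] ^ p = ([:0, 1:] + (-1)) ^ p" for p :: nat
    by (simp add: one_pCons)
  then have "([:-1, 1:] :: int poly) ^ p = (\<Sum>k\<le>p. of_nat (p choose k) * [:0, 1:] ^ k * (-1) ^ (p - k))"
    by (simp only: binomial_ring)
  also have "{..p} = insert 0 (insert p {0<..<p})" using prime_gt_0_nat[OF assms(1)] by auto
  also have "(\<Sum>k\<in>insert 0 (insert p {0<..<p}). of_nat (p choose k) * ([:0, 1:] :: int poly) ^ k * (-1) ^ (p - k))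
     = -1 + [:0, 1:] ^ p + (\<Sum>k\<in>{0<..<p}. of_nat (p choose k) * [:0, 1:] ^ k * (-1) ^ (p - k))"
    using prime_gt_0_nat[OF assms(1)] assms(2) by simp
  finally have "[:0, 1:] ^ p - [:-1, 1:] ^ p - 1
      = - (\<Sum>k\<in>{0<..<p}. of_nat (p choose k) * ([:0, 1:] :: int poly) ^ k * (-1) ^ (p - k))"
    by simp
  moreover have "[:int p:] dvd (\<Sum>k\<in>{0<..<p}. of_nat (p choose k) * [:0, 1:] ^ k * (-1) ^ (p - k))"
  proof (intro dvd_sum dvd_mult2)
    fix k assume k: "k \<in> {0<..<p}"
    then have "p dvd (p choose k)" using assms(1) by (intro dvd_choose_prime) auto
    then obtain m where "p choose k = p * m" by (rule dvdE)
    then have "of_nat (p choose k) = of_nat p * (of_nat m :: int poly)" by (simp only: of_nat_mult)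
    moreover have "of_nat p = [:int p:]" using of_nat_poly[where ?'a = int] by simp
    ultimately show "[:int p:] dvd of_nat (p choose k)" by (metis dvdI)
  qed
  ultimately show ?thesis by (simp only: dvd_minus_iff)
qed

lemma fq_poly_eq:
  assumes "prime p" "odd p"
  shows "[:int p:] * fq_poly p = [:0, 1:] ^ p - [:-1, 1:] ^ p - 1"
  unfolding fq_poly_def using fq_poly_dvd[OF assms] by (rule dvd_mult_div_cancel)

lemma poly_fq_poly:
  assumes "prime p" "odd p"
  shows "int p * poly (fq_poly p) u = u ^ p - (u - 1) ^ p - 1"
proof -
  have "poly ([:int p:] * fq_poly p) u = u ^ p - (u - 1) ^ p - 1"
    unfolding fq_poly_eq[OF assms] by simp
  then show ?thesis by simp
qed

lemma degree_fq_poly: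
  assumes "prime p" "odd p"
  shows "degree (fq_poly p) \<le> p"
proof -
  have p: "int p \<noteq> 0" using prime_gt_0_nat[OF assms(1)] by simp
  have "degree ([:int p:] * fq_poly p) \<le> p"
    unfolding fq_poly_eq[OF assms]
    by (intro degree_diff_le) (simp_all add: degree_power_eq)
  then show ?thesis using p by simp
qed

lemma pderiv_fq_poly:
  assumes "prime p" "odd p"
  shows "pderiv (fq_poly p) = [:0, 1:] ^ (p - 1) - [:-1, 1:] ^ (p - 1)"
proof -
  have p: "int p \<noteq> 0" using prime_gt_0_nat[OF assms(1)] by simp
  have "pderiv ([:int p:] * fq_poly p) = [:int p:] * ([:0, 1:] ^ (p - 1) - [:-1, 1:] ^ (p - 1))"
    unfolding fq_poly_eq[OF assms] pderiv_diff pderiv_power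
    by (simp add: pderiv_pCons smult_diff_right)
  then have "[:int p:] * pderiv (fq_poly p) = [:int p:] * ([:0, 1:] ^ (p - 1) - [:-1, 1:] ^ (p - 1))"
    by (simp add: pderiv_smult)
  then show ?thesis using p by (simp only: mult_cancel_left) simp
qed

text \<open>The differential equation of the logarithm with its exact error: modulo p and X^(p-1) it
  reads (X - 1) F' = 1. Multiplied by X it shows how \<open>theta\<close> acts on F.\<close>

lemma linear_times_pderiv_fq_poly:
  assumes "prime p" "odd p"
  shows "[:-1, 1:] * pderiv (fq_poly p) = 1 - [:0, 1:] ^ (p - 1) + [:int p:] * fq_poly p"
proof -
  obtain n where n: "p = Suc n" using prime_gt_0_nat[OF assms(1)] gr0_conv_Suc by blast
  define L :: "int poly" where "L = [:-1, 1:]"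
  define X :: "int poly" where "X = [:0, 1:]"
  have "L = X - 1" by (simp add: L_def X_def one_pCons)
  then have "L * (X ^ n - L ^ n) = 1 - X ^ n + (X ^ Suc n - L ^ Suc n - 1)"
    by (simp add: right_diff_distrib left_diff_distrib)
  then show ?thesis
    unfolding pderiv_fq_poly[OF assms] fq_poly_eq[OF assms] by (simp only: n diff_Suc_1 L_def X_def)
qed

lemma theta_fq_poly:
  assumes "prime p" "odd p"
  shows "theta (fq_poly p) = [:0, 1:] - [:0, 1:] ^ p + [:int p:] * ([:0, 1:] * fq_poly p)"
proof -
  obtain n where n: "p = Suc n" using prime_gt_0_nat[OF assms(1)] gr0_conv_Suc by blast
  have "theta (fq_poly p) = [:0, 1:] * ([:-1, 1:] * pderiv (fq_poly p))"
    by (simp add: theta_def)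
  also have "\<dots> = [:0, 1:] * (1 - [:0, 1:] ^ (p - 1) + [:int p:] * fq_poly p)"
    by (simp only: linear_times_pderiv_fq_poly[OF assms])
  also have "\<dots> = [:0, 1:] - [:0, 1:] ^ p + [:int p:] * ([:0, 1:] * fq_poly p)"
    by (simp only: n diff_Suc_1 power_Suc distrib_left right_diff_distrib mult.left_commute mult_1_right)
  finally show ?thesis .
qed

text \<open>Powers of X - 1 are used instead of powers of X because (X - 1) d/dX acts on (X - 1)^a
  as multiplication by a.\<close>

definition log_form :: "nat \<Rightarrow> nat \<Rightarrow> (nat \<Rightarrow> int poly) \<Rightarrow> int poly" where
  "log_form p A G = (\<Sum>a<A. [:-1, 1:] ^ a * pcompose (G a) (fq_poly p))"

lemma pderiv_sum: "pderiv (sum f I) = (\<Sum>i\<in>I. pderiv (f i :: int poly))"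
  by (induction I rule: infinite_finite_induct) (simp_all add: pderiv_add)

text \<open>The product rule, kept exact over the integers. The defect (X - 1) F' - 1 equals p F -
  X^(p-1), so the second summand disappears modulo p and X^(p-1).\<close>

lemma log_form_step:
  fixes a\<^sub>0 :: int
  shows "[:-1, 1:] * pderiv (log_form p A G) - [:a\<^sub>0:] * log_form p A G
    = log_form p A (\<lambda>a. Polynomial.smult (int a - a\<^sub>0) (G a) + pderiv (G a))
      + ([:-1, 1:] * pderiv (fq_poly p) - 1) * log_form p A (\<lambda>a. pderiv (G a))"
proof -
  define F where "F = fq_poly p"
  define L :: "int poly" where "L = [:-1, 1:]"
  have pdL: "pderiv L = 1" by (simp add: L_def pderiv_pCons)
  have "L * pderiv (L ^ a * pcompose (G a) F) - [:a\<^sub>0:] * (L ^ a * pcompose (G a) F)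
     = L ^ a * pcompose (Polynomial.smult (int a - a\<^sub>0) (G a) + pderiv (G a)) F
       + (L * pderiv F - 1) * (L ^ a * pcompose (pderiv (G a)) F)" for a
  proof -
    have La: "L * pderiv (L ^ a) = [:int a:] * L ^ a"
      by (cases a) (simp_all add: pderiv_power_Suc pdL del: power_Suc, simp)
    have *: "pcompose (Polynomial.smult (int a - a\<^sub>0) (G a) + pderiv (G a)) F
       = ([:int a:] - [:a\<^sub>0:]) * pcompose (G a) F + pcompose (pderiv (G a)) F"
      by (simp add: pcompose_add pcompose_smult)
    have "L * pderiv (L ^ a * pcompose (G a) F)
        = (L * pderiv (L ^ a)) * pcompose (G a) F + L ^ a * pcompose (pderiv (G a)) F * (L * pderiv F)"
      unfolding pderiv_mult pderiv_pcompose by (simp only: distrib_left ac_simps)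
    then show ?thesis unfolding La *
      by (simp only: distrib_left distrib_right left_diff_distrib right_diff_distrib mult_1_left) (simp add: algebra_simps)
  qed
  then have "(\<Sum>a<A. L * pderiv (L ^ a * pcompose (G a) F) - [:a\<^sub>0:] * (L ^ a * pcompose (G a) F))
     = (\<Sum>a<A. L ^ a * pcompose (Polynomial.smult (int a - a\<^sub>0) (G a) + pderiv (G a)) F
       + (L * pderiv F - 1) * (L ^ a * pcompose (pderiv (G a)) F))"
    by simp
  then show ?thesis
    unfolding log_form_def F_def[symmetric] L_def[symmetric]
    by (simp only: sum.distrib sum_subtractf sum_distrib_left pderiv_sum)
qed

lemma dvd_modp_X_pderiv:
  assumes "dvd_modp p ([:0, 1:] ^ Suc m) P"
  shows "dvd_modp p ([:0, 1:] ^ m) (pderiv P)"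
proof -
  define X :: "int poly" where "X = [:0, 1:]"
  have pdX: "pderiv X = 1" by (simp add: X_def pderiv_pCons)
  from assms obtain Q R where "P - X ^ Suc m * Q = [:int p:] * R"
    unfolding X_def dvd_modp_def by (auto elim: dvdE)
  then have "P = X ^ Suc m * Q + [:int p:] * R" by (simp add: algebra_simps)
  then have "pderiv P = X ^ m * ([:of_nat (Suc m):] * Q + X * pderiv Q) + [:int p:] * pderiv R"
    by (simp add: pderiv_add pderiv_mult pderiv_power pderiv_smult pdX algebra_simps del: power_Suc)
       (simp add: algebra_simps)
  then have "pderiv P - X ^ m * ([:of_nat (Suc m):] * Q + X * pderiv Q) = [:int p:] * pderiv R" by simp
  then show ?thesis unfolding X_def by (metis dvd_modpI dvdI)
qed

text \<open>
  Modulo \<open>p\<close> and \<open>X^(p-1)\<close> the operator \<open>(X - 1) d/dX - a\<^sub>0\<close> acts on \<open>(X - 1)^a G(F)\<close> as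
  \<open>(a - a\<^sub>0) G + G'\<close>. It lowers the order of vanishing at 0 by at most one and, when \<open>a\<^sub>0\<close> is chosen
  with \<open>G a\<^sub>0 \<noteq> 0\<close>, the total weight \<open>\<Sum> d\<close> by one.
\<close>

lemma log_form_nonvanishing:
  assumes "prime p" "odd p" "A \<le> p"
  shows "(\<Sum>a<A. d a) = \<mu> \<Longrightarrow> \<mu> \<le> p \<Longrightarrow> (\<And>a b. a < A \<Longrightarrow> d a \<le> b \<Longrightarrow> int p dvd Polynomial.coeff (G a) b) \<Longrightarrow>
    \<exists>a<A. \<exists>b. \<not> int p dvd Polynomial.coeff (G a) b \<Longrightarrow> \<not> dvd_modp p ([:0, 1:] ^ \<mu>) (log_form p A G)"
proof (induction \<mu> arbitrary: d G)
  case 0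
  then show ?case by (metis finite_lessThan lessThan_iff sum_eq_0_iff le0)
next
  case (Suc \<mu>)
  define F where "F = fq_poly p"
  define X :: "int poly" where "X = [:0, 1:]"
  define L :: "int poly" where "L = [:-1, 1:]"
  show ?case
  proof
    assume X\<mu>: "dvd_modp p ([:0, 1:] ^ Suc \<mu>) (log_form p A G)"
    then have X\<mu>': "dvd_modp p ([:0, 1:] ^ \<mu>) (log_form p A G)"
      by (metis dvd_modp_mult_left power_Suc2)
    obtain a\<^sub>0 b\<^sub>0 where a\<^sub>0: "a\<^sub>0 < A" and b\<^sub>0: "\<not> int p dvd Polynomial.coeff (G a\<^sub>0) b\<^sub>0" using Suc.prems(4) by blast
    have "b\<^sub>0 < d a\<^sub>0" using Suc.prems(3)[OF a\<^sub>0] b\<^sub>0 not_le by blast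
    then obtain n where n: "d a\<^sub>0 = Suc n" by (cases "d a\<^sub>0") auto
    define d' where "d' = d(a\<^sub>0 := n)"
    have sd': "(\<Sum>a<A. d' a) = \<mu>"
      using Suc.prems(1) a\<^sub>0 n by (simp add: d'_def sum.remove[of "{..<A}" a\<^sub>0])
    have "d a\<^sub>0 \<le> (\<Sum>a<A. d a)" using a\<^sub>0 by (intro member_le_sum) auto
    then have np: "Suc n \<le> p" using n Suc.prems(1,2) by simp
    show False
    \<comment> \<open>\<open>n\<close> is the largest degree permitted for
      \<open>G a\<^sub>0\<close>. If that coefficient vanishes modulo p, lowering \<open>d\<close>
      at \<open>a\<^sub>0\<close> is enough; otherwise the operator with eigenvalue
      \<open>a\<^sub>0\<close> removes it.\<close>
    proof (cases "int p dvd Polynomial.coeff (G a\<^sub>0) n")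
      case True
      have "\<not> dvd_modp p ([:0, 1:] ^ \<mu>) (log_form p A G)"
      proof (rule Suc.IH[OF sd'])
        fix a b assume "a < A" "d' a \<le> b"
        then show "int p dvd Polynomial.coeff (G a) b"
          using Suc.prems(3)[of a b] True n by (cases "b = n") (auto simp: d'_def split: if_splits)
      qed (use Suc.prems in auto)
      then show False using X\<mu>' by blast
    next
      case top: False
      define G' where "G' = (\<lambda>a. Polynomial.smult (int a - int a\<^sub>0) (G a) + pderiv (G a))"
      have cG': "Polynomial.coeff (G' a) b = (int a - int a\<^sub>0) * Polynomial.coeff (G a) b + int (Suc b) * Polynomial.coeff (G a) (Suc b)" for a b
        by (simp add: G'_def coeff_pderiv)
      have G'd: "int p dvd Polynomial.coeff (G' a) b" if "a < A" "d' a \<le> b" for a b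
        using that Suc.prems(3)[of a b] Suc.prems(3)[of a "Suc b"] n
        unfolding cG' by (auto simp: d'_def split: if_splits)
      have step: "dvd_modp p ([:0, 1:] ^ \<mu>) (log_form p A G')"
      proof -
        have 1: "dvd_modp p (X ^ \<mu>) (L * pderiv (log_form p A G) + [:-int a\<^sub>0:] * log_form p A G)"
          unfolding X_def by (intro dvd_modp_add dvd_modp_mult dvd_modp_X_pderiv X\<mu> X\<mu>')
        define k where "k = p - 1 - \<mu>"
        have k: "p - 1 = \<mu> + k" using Suc.prems(2) by (simp add: k_def)
        have "dvd_modp p (X ^ \<mu>) (X ^ \<mu> * (X ^ k * log_form p A (\<lambda>a. pderiv (G a))))"
          by (rule dvd_modp_self)
        then have 2: "dvd_modp p (X ^ \<mu>) (X ^ (p - 1) * log_form p A (\<lambda>a. pderiv (G a)))"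
          unfolding k by (simp only: power_add mult.assoc)
        have eq: "L * pderiv (log_form p A G) + [:-int a\<^sub>0:] * log_form p A G
            = log_form p A G' + (L * pderiv F - 1) * log_form p A (\<lambda>a. pderiv (G a))"
          using log_form_step[of p A G "int a\<^sub>0"] by (simp add: L_def F_def G'_def)
        have LF: "L * pderiv F - 1 = - (X ^ (p - 1)) + [:int p:] * F"
          using linear_times_pderiv_fq_poly[OF assms(1,2)] unfolding L_def F_def X_def by (simp only: algebra_simps)
        show ?thesis unfolding X_def[symmetric]
        proof (rule dvd_modp_cong[OF dvd_modp_add[OF 1 2]])
          have "log_form p A G' - ((L * pderiv (log_form p A G) + [:-int a\<^sub>0:] * log_form p A G)
              + X ^ (p - 1) * log_form p A (\<lambda>a. pderiv (G a))) = [:int p:] * (- (F * log_form p A (\<lambda>a. pderiv (G a))))"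
            unfolding eq LF by (simp add: algebra_simps)
          then show "[:int p:] dvd log_form p A G' - ((L * pderiv (log_form p A G) + [:-int a\<^sub>0:] * log_form p A G)
              + X ^ (p - 1) * log_form p A (\<lambda>a. pderiv (G a)))" by (metis dvdI)
        qed
      qed
      have triv: "\<forall>a<A. \<forall>b. int p dvd Polynomial.coeff (G' a) b"
      proof (rule ccontr)
        assume "\<not> ?thesis"
        then have "\<not> dvd_modp p ([:0, 1:] ^ \<mu>) (log_form p A G')"
          using Suc.IH[OF sd' _ G'd] Suc.prems(2) by simp
        then show False using step by blast
      qed
      \<comment> \<open>For n > 0 the coefficient of degree n - 1 in \<open>G' a\<^sub>0\<close> is
        n times the top coefficient of \<open>G a\<^sub>0\<close>, and n < p makes this nonzero
        modulo p.\<close>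
      have n0: "n = 0"
      proof (rule ccontr)
        assume "n \<noteq> 0"
        then obtain m where m: "n = Suc m" by (cases n) auto
        have "int p dvd Polynomial.coeff (G' a\<^sub>0) m" using triv a\<^sub>0 by blast
        then have "int p dvd int n * Polynomial.coeff (G a\<^sub>0) n" by (simp add: cG' m)
        then have "int p dvd int n" using top assms(1) by (simp add: prime_dvd_mult_iff)
        then show False using np \<open>n \<noteq> 0\<close> by (simp add: int_dvd_int_iff nat_dvd_not_less)
      qed
      \<comment> \<open>For a other than \<open>a\<^sub>0\<close> the equation (a -
        \<open>a\<^sub>0\<close>) G + G' = 0 modulo p has only the solution 0, by descent from the
        top coefficient. What is left of the form is a nonzero constant times a power of X - 1,
        which does not vanish at 0.\<close>
      have others: "int p dvd Polynomial.coeff (G a) 0" if "a < A" "a \<noteq> a\<^sub>0" for a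
      proof -
        have "int p dvd Polynomial.coeff (G a) b" for b
        proof (induction "d a - b" arbitrary: b)
          case 0
          then show ?case using Suc.prems(3) that by simp
        next
          case (Suc k)
          have "int p dvd Polynomial.coeff (G a) (Suc b)" using Suc by simp
          moreover have "int p dvd (int a - int a\<^sub>0) * Polynomial.coeff (G a) b + int (Suc b) * Polynomial.coeff (G a) (Suc b)"
            using triv that(1) cG' by metis
          ultimately have "int p dvd (int a - int a\<^sub>0) * Polynomial.coeff (G a) b"
            by (simp add: dvd_add_left_iff del: of_nat_Suc)
          moreover have "\<not> int p dvd int a - int a\<^sub>0"
          proof
            assume "int p dvd int a - int a\<^sub>0"
            moreover have "\<bar>int a - int a\<^sub>0\<bar> < int p" using that a\<^sub>0 assms(3) by linarith
            ultimately show False using that(2) zdvd_imp_le[of "int p" "\<bar>int a - int a\<^sub>0\<bar>"] by auto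
          qed
          ultimately show ?case using assms(1) by (simp add: prime_dvd_mult_iff)
        qed
        then show ?thesis .
      qed
      have "int p * poly F 0 = 0"
        using poly_fq_poly[OF assms(1,2), of 0] assms(2) prime_gt_0_nat[OF assms(1)]
        by (simp add: F_def zero_power)
      then have F0: "poly F 0 = 0" using prime_gt_0_nat[OF assms(1)] by simp
      have "dvd_modp p ([:- 0, 1:] ^ Suc \<mu>) (log_form p A G)" using X\<mu> by (simp only: minus_zero)
      from dvd_modp_root[OF this] have "int p dvd poly (log_form p A G) 0" by simp
      also have "poly (log_form p A G) 0 = (\<Sum>a<A. (-1) ^ a * Polynomial.coeff (G a) 0)"
        unfolding log_form_def poly_sum poly_mult poly_power poly_pcompose F_def[symmetric] F0
        by (simp only: poly_pCons poly_0_coeff_0) simp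
      also have "\<dots> = (-1) ^ a\<^sub>0 * Polynomial.coeff (G a\<^sub>0) 0 + (\<Sum>a\<in>{..<A} - {a\<^sub>0}. (-1) ^ a * Polynomial.coeff (G a) 0)"
        using a\<^sub>0 by (intro sum.remove) auto
      finally have "int p dvd (-1) ^ a\<^sub>0 * Polynomial.coeff (G a\<^sub>0) 0"
        using others by (subst (asm) dvd_add_left_iff) (auto intro!: dvd_sum dvd_mult)
      then have "int p dvd Polynomial.coeff (G a\<^sub>0) 0" by (cases "even a\<^sub>0") auto
      then show False using top n0 by simp
    qed
  qed
qed

section \<open>Stepanov's auxiliary polynomial\<close>

text \<open>
  Modulo \<open>p\<close>, \<open>weight_le p d\<close> is the span of the \<open>X^i F^b X^(pl)\<close> with \<open>i + l \<le> d\<close> and \<open>b\<close> arbitrary.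
  Since \<open>u^p = u\<close> modulo \<open>p\<close>, such a polynomial agrees with one of degree at most \<open>d\<close> at all points
  \<open>u\<close> where \<open>F\<close> takes a prescribed value.
\<close>

inductive weight_le :: "nat \<Rightarrow> nat \<Rightarrow> int poly \<Rightarrow> bool" for p where
  base: "weight_le p 0 (fq_poly p ^ b)"
| add: "weight_le p d P \<Longrightarrow> weight_le p d Q \<Longrightarrow> weight_le p d (P + Q)"
| smult: "weight_le p d P \<Longrightarrow> weight_le p d (Polynomial.smult c P)"
| mult_X: "weight_le p d P \<Longrightarrow> weight_le p (Suc d) ([:0, 1:] * P)"
| mult_Xp: "weight_le p d P \<Longrightarrow> weight_le p (Suc d) ([:0, 1:] ^ p * P)"
| Suc: "weight_le p d P \<Longrightarrow> weight_le p (Suc d) P"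
| cong: "weight_le p d P \<Longrightarrow> [:int p:] dvd Q - P \<Longrightarrow> weight_le p d Q"

lemma weight_le_diff:
  assumes "weight_le p d P" "weight_le p d Q"
  shows "weight_le p d (P - Q)"
  using weight_le.add[OF assms(1) weight_le.smult[OF assms(2), of "-1"]] by simp

lemma weight_le_mult_linear_power:
  assumes "weight_le p d P"
  shows "weight_le p (d + a) ([:-1, 1:] ^ a * P)"
proof (induction a)
  case 0
  then show ?case using assms by simp
next
  case (Suc a)
  have "[:-1, 1:] ^ Suc a * P = [:0, 1:] * ([:-1, 1:] ^ a * P) - [:-1, 1:] ^ a * P"
  proof -
    have "[:-1, 1:] = [:0, 1:] - (1 :: int poly)" by (simp add: one_pCons)
    then show ?thesis by (metis (no_types) power_Suc left_diff_distrib mult.assoc mult_1_left)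
  qed
  then show ?case using weight_le_diff[OF weight_le.mult_X[OF Suc.IH] weight_le.Suc[OF Suc.IH]]
    by (simp only: add_Suc_right)
qed

lemma weight_le_mult_Xp_power:
  assumes "weight_le p d P"
  shows "weight_le p (d + c) ([:0, 1:] ^ (p * c) * P)"
proof (induction c)
  case 0
  then show ?case using assms by simp
next
  case (Suc c)
  show ?case using weight_le.mult_Xp[OF Suc.IH] by (simp only: add_Suc_right mult_Suc_right power_add mult.assoc)
qed

text \<open>Modulo p, F^b goes to b F^(b-1) (X - X^p), X goes to X^2 - X, and X^p goes to 0. Each
  image costs at most one more factor X or X^p, hence one unit of weight.\<close>

lemma weight_le_theta:
  assumes "prime p" "odd p" "weight_le p d P"
  shows "weight_le p (Suc d) (theta P)"
  using assms(3)
proof (induction rule: weight_le.induct)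
  case (base b)
  have 1: "weight_le p 1 ([:0, 1:] * fq_poly p ^ (b - 1) - [:0, 1:] ^ p * fq_poly p ^ (b - 1))"
    using weight_le_diff[OF weight_le.mult_X[OF weight_le.base] weight_le.mult_Xp[OF weight_le.base]] by simp
  then have 2: "weight_le p 1 (Polynomial.smult (of_nat b) ([:0, 1:] * fq_poly p ^ (b - 1) - [:0, 1:] ^ p * fq_poly p ^ (b - 1)))"
    by (rule weight_le.smult)
  have "theta (fq_poly p ^ b) - Polynomial.smult (of_nat b) ([:0, 1:] * fq_poly p ^ (b - 1) - [:0, 1:] ^ p * fq_poly p ^ (b - 1))
     = [:int p:] * (Polynomial.smult (of_nat b) (fq_poly p ^ (b - 1) * ([:0, 1:] * fq_poly p)))"
  proof -
    define F where "F = fq_poly p"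
    define X :: "int poly" where "X = [:0, 1:]"
    have "theta (F ^ b) = Polynomial.smult (of_nat b) (F ^ (b - 1) * (X - X ^ p + [:int p:] * (X * F)))"
      using theta_power[of F b] theta_fq_poly[OF assms(1,2)] by (simp only: F_def X_def)
    then show ?thesis unfolding F_def[symmetric] X_def[symmetric]
      by (simp add: algebra_simps smult_add_right smult_diff_right)
  qed
  then show ?case using weight_le.cong[OF 2] by (metis dvdI One_nat_def)
next
  case (add d P Q)
  then show ?case by (simp only: theta_add weight_le.add)
next
  case (smult d P c)
  then show ?case by (simp only: theta_smult weight_le.smult)
next
  case (mult_X d P)
  have eq: "theta ([:0, 1:] * P) = ([:0, 1:] * ([:0, 1:] * P) - [:0, 1:] * P) + [:0, 1:] * theta P"
  proof -
    have "[:0, -1, 1:] = [:0, 1:] * [:0, 1:] - ([:0, 1:] :: int poly)" by simp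
    then show ?thesis unfolding theta_mult theta_X by (simp only: left_diff_distrib mult.assoc)
  qed
  show ?case unfolding eq
    by (intro weight_le.add weight_le_diff weight_le.mult_X mult_X.IH weight_le.Suc[OF weight_le.mult_X] mult_X.hyps)
next
  case (mult_Xp d P)
  have eq: "theta ([:0, 1:] ^ p * P) - [:0, 1:] ^ p * theta P
      = [:int p:] * ([:0, 1:] ^ (p - 1) * theta [:0, 1:] * P)"
    unfolding theta_mult theta_power by simp
  show ?case using weight_le.cong[OF weight_le.mult_Xp[OF mult_Xp.IH]] eq by (metis dvdI)
next
  case (Suc d P)
  show ?case by (rule weight_le.Suc[OF Suc.IH])
next
  case (cong d P Q)
  then show ?case using weight_le.cong[OF cong.IH] theta_dvd theta_diff by metis
qed

lemma weight_le_funpow_theta: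
  assumes "prime p" "odd p" "weight_le p d P"
  shows "weight_le p (d + n) ((theta ^^ n) P)"
  by (induction n) (use assms(3) weight_le_theta[OF assms(1,2)] in auto)

section \<open>Values on a fibre, and linear algebra modulo p\<close>

lemma prime_dvd_power_diff_self:
  assumes "prime p"
  shows "int p dvd u ^ p - u"
proof (cases "int p dvd u")
  case True
  then show ?thesis using prime_gt_0_nat[OF assms] dvd_power_le[OF True, of 1 p] by (intro dvd_diff) auto
next
  case False
  then have "coprime u (int p)" using assms by (metis coprime_commute prime_imp_coprime prime_nat_int_transfer)
  from fermat_quotient_exact[OF assms this] have "int p dvd u * (u ^ (p - 1) - 1)" by simp
  moreover have "u * (u ^ (p - 1) - 1) = u ^ p - u"
    using prime_gt_0_nat[OF assms] by (simp add: algebra_simps power_eq_if)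
  ultimately show ?thesis by simp
qed

lemma weight_le_eval:
  assumes "prime p" "weight_le p d P"
  shows "\<exists>q. degree q \<le> d \<and> (\<forall>u. int p dvd poly (fq_poly p) u - s \<longrightarrow> int p dvd poly P u - poly q u)"
  using assms(2)
proof (induction rule: weight_le.induct)
  case (base b)
  have "int p dvd poly (fq_poly p ^ b) u - poly [:s ^ b:] u" if "int p dvd poly (fq_poly p) u - s" for u
  proof -
    have "[poly (fq_poly p) u = s] (mod int p)" using that by (simp add: cong_iff_dvd_diff)
    then have "[poly (fq_poly p) u ^ b = s ^ b] (mod int p)" by (rule cong_pow)
    then show ?thesis by (simp add: cong_iff_dvd_diff)
  qed
  then show ?case by (intro exI[of _ "[:s ^ b:]"]) auto
next
  case (add d P Q)
  then obtain q r where *: "degree q \<le> d" "degree r \<le> d"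
    "\<And>u. int p dvd poly (fq_poly p) u - s \<Longrightarrow> int p dvd poly P u - poly q u"
    "\<And>u. int p dvd poly (fq_poly p) u - s \<Longrightarrow> int p dvd poly Q u - poly r u" by blast
  have "int p dvd poly (P + Q) u - poly (q + r) u" if "int p dvd poly (fq_poly p) u - s" for u
    using dvd_add[OF *(3,4)[OF that]] by (simp add: algebra_simps)
  then show ?case using *(1,2) by (intro exI[of _ "q + r"]) (simp add: degree_add_le)
next
  case (smult d P c)
  then obtain q where *: "degree q \<le> d"
    "\<And>u. int p dvd poly (fq_poly p) u - s \<Longrightarrow> int p dvd poly P u - poly q u" by blast
  have "int p dvd poly (Polynomial.smult c P) u - poly (Polynomial.smult c q) u" if "int p dvd poly (fq_poly p) u - s" for u
    using dvd_mult[OF *(2)[OF that], of c] by (simp add: algebra_simps)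
  then show ?case using *(1) by (intro exI[of _ "Polynomial.smult c q"]) (simp add: le_trans[OF degree_smult_le])
next
  case (mult_X d P)
  then obtain q where *: "degree q \<le> d"
    "\<And>u. int p dvd poly (fq_poly p) u - s \<Longrightarrow> int p dvd poly P u - poly q u" by blast
  have "int p dvd poly ([:0, 1:] * P) u - poly (pCons 0 q) u" if "int p dvd poly (fq_poly p) u - s" for u
    using dvd_mult[OF *(2)[OF that], of u] by (simp add: algebra_simps)
  then show ?case using *(1) by (intro exI[of _ "pCons 0 q"]) (simp add: degree_pCons_eq_if)
next
  case (mult_Xp d P)
  then obtain q where *: "degree q \<le> d"
    "\<And>u. int p dvd poly (fq_poly p) u - s \<Longrightarrow> int p dvd poly P u - poly q u" by blast
  have "int p dvd poly ([:0, 1:] ^ p * P) u - poly (pCons 0 q) u" if "int p dvd poly (fq_poly p) u - s" for u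
  proof -
    have "poly ([:0, 1:] ^ p * P) u - poly (pCons 0 q) u = (u ^ p - u) * poly P u + u * (poly P u - poly q u)"
      by (simp add: algebra_simps)
    then show ?thesis using *(2)[OF that] prime_dvd_power_diff_self[OF assms(1), of u]
      by (metis dvd_add dvd_mult dvd_mult2)
  qed
  then show ?case using *(1) by (intro exI[of _ "pCons 0 q"]) (simp add: degree_pCons_eq_if)
next
  case (Suc d P)
  then show ?case by (metis le_Suc_eq)
next
  case (cong d P Q)
  then obtain q where *: "degree q \<le> d"
    "\<And>u. int p dvd poly (fq_poly p) u - s \<Longrightarrow> int p dvd poly P u - poly q u" by blast
  have "int p dvd poly Q u - poly q u" if "int p dvd poly (fq_poly p) u - s" for u
    using dvd_add[OF *(2)[OF that] poly_dvd_of_const_dvd[OF cong.hyps(2), of u]] by simp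
  then show ?case using *(1) by blast
qed

text \<open>Pigeonhole: there are p^(card I) assignments of residues but only p^(card K) possible
  images; the difference of two assignments with the same image is the solution.\<close>

lemma modular_siegel:
  fixes M :: "'k \<Rightarrow> 'i \<Rightarrow> int"
  assumes "p > 1" "finite I" "finite K" "card K < card I"
  shows "\<exists>x. (\<exists>i\<in>I. \<not> int p dvd x i) \<and> (\<forall>k\<in>K. int p dvd (\<Sum>i\<in>I. x i * M k i))"
proof -
  let ?R = "{0..<int p}"
  define f where "f = (\<lambda>y. \<lambda>k\<in>K. (\<Sum>i\<in>I. y i * M k i) mod int p)"
  have "f \<in> (I \<rightarrow>\<^sub>E ?R) \<rightarrow> (K \<rightarrow>\<^sub>E ?R)" using assms(1) by (auto simp: f_def)
  moreover have "card (K \<rightarrow>\<^sub>E ?R) < card (I \<rightarrow>\<^sub>E ?R)"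
    using assms by (simp add: card_PiE)
  ultimately have "\<not> inj_on f (I \<rightarrow>\<^sub>E ?R)"
    using assms card_inj_on_le[of f "I \<rightarrow>\<^sub>E ?R" "K \<rightarrow>\<^sub>E ?R"] by (auto simp: finite_PiE image_subset_iff_funcset)
  then obtain y z where yz: "y \<in> I \<rightarrow>\<^sub>E ?R" "z \<in> I \<rightarrow>\<^sub>E ?R" "y \<noteq> z" "f y = f z" by (auto simp: inj_on_def)
  show ?thesis
  proof (intro exI[of _ "\<lambda>i. y i - z i"] conjI ballI)
    obtain i where i: "i \<in> I" "y i \<noteq> z i" using yz(1-3) by (metis PiE_ext)
    have "y i \<in> ?R" "z i \<in> ?R" using yz i by auto
    then have "\<bar>y i - z i\<bar> < int p" by auto
    then have "\<not> int p dvd y i - z i" using i(2) zdvd_imp_le[of "int p" "\<bar>y i - z i\<bar>"] by auto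
    then show "\<exists>i\<in>I. \<not> int p dvd y i - z i" using i(1) by blast
  next
    fix k assume "k \<in> K"
    then have "(\<Sum>i\<in>I. y i * M k i) mod int p = (\<Sum>i\<in>I. z i * M k i) mod int p"
      using fun_cong[OF yz(4), of k] by (simp add: f_def)
    then have "int p dvd (\<Sum>i\<in>I. y i * M k i) - (\<Sum>i\<in>I. z i * M k i)" by (simp add: mod_eq_dvd_iff)
    then show "int p dvd (\<Sum>i\<in>I. (y i - z i) * M k i)" by (simp add: left_diff_distrib sum_subtractf)
  qed
qed

lemma pcompose_monom: "pcompose (Polynomial.monom c n) P = Polynomial.smult c (P ^ n)"
  by (induction n) (simp_all add: monom_0 monom_Suc pcompose_pCons)

text \<open>Stepanov's monomials. Their degree is about p (b + c), but where F takes a prescribed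
  value they agree modulo p with polynomials of degree at most a + c. This discrepancy is the source
  of the saving.\<close>

definition aux_monom :: "nat \<Rightarrow> nat \<times> nat \<times> nat \<Rightarrow> int poly" where
  "aux_monom p = (\<lambda>(a, b, c). [:0, 1:] ^ (p * c) * ([:-1, 1:] ^ a * fq_poly p ^ b))"

text \<open>Let c be least with a nonzero coefficient. Removing X^(p c) leaves a
  \<open>log_form\<close> plus a multiple of X^p. If the whole were 0 modulo p, that form would be
  divisible by X^p, hence by X^(A B), against its nonvanishing; this is where A B \<le> p
  enters.\<close>

lemma aux_combination_nonzero:
  assumes "prime p" "odd p" "A * B \<le> p" "0 < B"
    and "i \<in> {..<A} \<times> {..<B} \<times> {..<C}" "\<not> int p dvd x i"
  shows "\<not> [:int p:] dvd (\<Sum>i\<in>{..<A} \<times> {..<B} \<times> {..<C}. Polynomial.smult (x i) (aux_monom p i))"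
proof
  define X :: "int poly" where "X = [:0, 1:]"
  define nz where "nz = (\<lambda>c. \<exists>a<A. \<exists>b<B. \<not> int p dvd x (a, b, c))"
  define G where "G = (\<lambda>c a. \<Sum>b<B. Polynomial.monom (x (a, b, c)) b)"
  have coeff_G: "Polynomial.coeff (G c a) b = (if b < B then x (a, b, c) else 0)" for c a b
    by (simp add: G_def coeff_sum)
  have pG: "pcompose (G c a) (fq_poly p) = (\<Sum>b<B. Polynomial.smult (x (a, b, c)) (fq_poly p ^ b))" for c a
    by (simp add: G_def pcompose_sum pcompose_monom)
  have Psi: "(\<Sum>i\<in>{..<A} \<times> {..<B} \<times> {..<C}. Polynomial.smult (x i) (aux_monom p i))
      = (\<Sum>c<C. X ^ (p * c) * log_form p A (G c))"
  proof -
    have "(\<Sum>i\<in>{..<A} \<times> {..<B} \<times> {..<C}. Polynomial.smult (x i) (aux_monom p i))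
       = (\<Sum>a<A. \<Sum>b<B. \<Sum>c<C. Polynomial.smult (x (a, b, c)) (aux_monom p (a, b, c)))"
      by (simp add: sum.cartesian_product case_prod_beta)
    also have "\<dots> = (\<Sum>a<A. \<Sum>c<C. \<Sum>b<B. Polynomial.smult (x (a, b, c)) (aux_monom p (a, b, c)))"
      by (intro sum.cong refl sum.swap)
    also have "\<dots> = (\<Sum>c<C. \<Sum>a<A. \<Sum>b<B. Polynomial.smult (x (a, b, c)) (aux_monom p (a, b, c)))"
      by (rule sum.swap)
    also have "\<dots> = (\<Sum>c<C. X ^ (p * c) * log_form p A (G c))"
      by (simp add: log_form_def pG aux_monom_def sum_distrib_left X_def mult.assoc)
    finally show ?thesis .
  qed
  assume "[:int p:] dvd (\<Sum>i\<in>{..<A} \<times> {..<B} \<times> {..<C}. Polynomial.smult (x i) (aux_monom p i))"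
  then have dvd: "[:int p:] dvd (\<Sum>c<C. X ^ (p * c) * log_form p A (G c))" unfolding Psi .
  obtain a b c where abc: "i = (a, b, c)" "a < A" "b < B" "c < C" using assms(5) by auto
  then have nzc: "nz c" using assms(6) by (auto simp: nz_def)
  define c\<^sub>0 where "c\<^sub>0 = (LEAST c. nz c)"
  have nz0: "nz c\<^sub>0" unfolding c\<^sub>0_def using nzc by (rule LeastI)
  have "c\<^sub>0 \<le> c" unfolding c\<^sub>0_def using nzc by (rule Least_le)
  then have c0C: "c\<^sub>0 < C" using abc by simp
  have small: "[:int p:] dvd X ^ (p * c) * log_form p A (G c)" if "c < c\<^sub>0" for c
  proof -
    have "\<not> nz c" using that unfolding c\<^sub>0_def by (rule not_less_Least)
    then have "int p dvd x (a, b, c)" if "a < A" "b < B" for a b using that by (auto simp: nz_def)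
    then have G: "[:int p:] dvd Polynomial.smult (x (a, b, c)) (fq_poly p ^ b)" if "a < A" "b < B" for a b
      using that by (simp add: const_poly_dvd_iff)
    show ?thesis unfolding log_form_def pG by (intro dvd_mult dvd_sum) (use G in auto)
  qed
  define R where "R = (\<Sum>c\<in>{Suc c\<^sub>0..<C}. X ^ (p * (c - Suc c\<^sub>0)) * log_form p A (G c))"
  have "(\<Sum>c<C. X ^ (p * c) * log_form p A (G c))
      = (\<Sum>c<c\<^sub>0. X ^ (p * c) * log_form p A (G c)) + X ^ (p * c\<^sub>0) * log_form p A (G c\<^sub>0)
        + (\<Sum>c\<in>{Suc c\<^sub>0..<C}. X ^ (p * c) * log_form p A (G c))"
  proof -
    have "{..<C} = {..<Suc c\<^sub>0} \<union> {Suc c\<^sub>0..<C}" using c0C by auto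
    then have "(\<Sum>c<C. X ^ (p * c) * log_form p A (G c))
      = (\<Sum>c<Suc c\<^sub>0. X ^ (p * c) * log_form p A (G c)) + (\<Sum>c\<in>{Suc c\<^sub>0..<C}. X ^ (p * c) * log_form p A (G c))"
      by (metis (no_types, lifting) finite_lessThan finite_atLeastLessThan sum.union_disjoint ivl_disj_int_one(2) ivl_disj_int(2))
    then show ?thesis by simp
  qed
  moreover have "(\<Sum>c\<in>{Suc c\<^sub>0..<C}. X ^ (p * c) * log_form p A (G c)) = X ^ (p * c\<^sub>0) * (X ^ p * R)"
    unfolding R_def sum_distrib_left
  proof (rule sum.cong)
    fix c assume "c \<in> {Suc c\<^sub>0..<C}"
    then have "c = c\<^sub>0 + 1 + (c - Suc c\<^sub>0)" by simp
    then have "p * c = p * c\<^sub>0 + p + p * (c - Suc c\<^sub>0)" by (metis add_mult_distrib2 mult.right_neutral)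
    then show "X ^ (p * c) * log_form p A (G c) = X ^ (p * c\<^sub>0) * (X ^ p * (X ^ (p * (c - Suc c\<^sub>0)) * log_form p A (G c)))"
      by (simp only: power_add mult.assoc)
  qed simp
  ultimately have eq: "(\<Sum>c<C. X ^ (p * c) * log_form p A (G c)) = (\<Sum>c<c\<^sub>0. X ^ (p * c) * log_form p A (G c))
      + X ^ (p * c\<^sub>0) * (log_form p A (G c\<^sub>0) + X ^ p * R)"
    by (simp only: distrib_left add.assoc)
  have "[:int p:] dvd (\<Sum>c<c\<^sub>0. X ^ (p * c) * log_form p A (G c))" using small by (intro dvd_sum) auto
  then have "[:int p:] dvd X ^ (p * c\<^sub>0) * (log_form p A (G c\<^sub>0) + X ^ p * R)"
    using dvd unfolding eq by (simp only: dvd_add_right_iff)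
  then have "[:int p:] dvd [:-0, 1:] ^ (p * c\<^sub>0) * (log_form p A (G c\<^sub>0) + X ^ p * R)" by (simp only: X_def minus_zero)
  then have "[:int p:] dvd log_form p A (G c\<^sub>0) + X ^ p * R"
    by (simp only: const_dvd_linear_power_mult_iff[OF assms(1)])
  then have "[:int p:] dvd log_form p A (G c\<^sub>0) - X ^ p * (- R)" by simp
  then have "dvd_modp p (X ^ p) (log_form p A (G c\<^sub>0))" by (rule dvd_modpI)
  moreover have "X ^ p = X ^ (A * B) * X ^ (p - A * B)" using assms(3) by (simp flip: power_add)
  ultimately have "dvd_modp p ([:0, 1:] ^ (A * B)) (log_form p A (G c\<^sub>0))"
    unfolding X_def by (metis dvd_modp_mult_left)
  moreover have "\<not> dvd_modp p ([:0, 1:] ^ (A * B)) (log_form p A (G c\<^sub>0))"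
  proof (rule log_form_nonvanishing[OF assms(1,2), where d = "\<lambda>_. B"])
    show "A \<le> p" using assms(3,4) by (metis le_trans mult_le_mono2 mult.right_neutral Suc_leI One_nat_def)
    show "\<exists>a<A. \<exists>b. \<not> int p dvd Polynomial.coeff (G c\<^sub>0 a) b"
      using nz0 unfolding nz_def coeff_G by (metis)
  qed (use assms(3) in \<open>auto simp: coeff_G\<close>)
  ultimately show False by blast
qed

section \<open>Fibres of the truncated logarithm\<close>

lemma theta_sum: "theta (sum f I) = (\<Sum>i\<in>I. theta (f i))"
  by (simp add: theta_def pderiv_sum sum_distrib_left)

lemma funpow_theta_sum_smult:
  "(theta ^^ n) (\<Sum>i\<in>I. Polynomial.smult (x i) (P i)) = (\<Sum>i\<in>I. Polynomial.smult (x i) ((theta ^^ n) (P i)))"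
  by (induction n) (simp_all add: theta_sum theta_smult)

text \<open>There are A B C unknown coefficients. Over a prescribed value s of F, the n-th
  \<open>theta\<close> iterate reduces to a polynomial of degree below A + C + D, so its vanishing
  for all n < D and s in S takes card S * D * (A + C + D) linear conditions modulo p. A nontrivial
  solution has degree at most p (B + C) and a zero of order D at each counted point. The points 0
  and 1 are left out because \<open>theta\<close> degenerates there.\<close>

lemma stepanov_bound:
  assumes p: "prime p" "odd p" and B: "0 < B" and AB: "A * B \<le> p" and D: "D \<le> p" and S: "finite S"
    and params: "card S * (D * (A + C + D)) < A * B * C"
  shows "D * card {u \<in> {2..<int p}. \<exists>s\<in>S. int p dvd poly (fq_poly p) u - s} \<le> p * (B + C)"
proof -
  define T where "T = {u \<in> {2..<int p}. \<exists>s\<in>S. int p dvd poly (fq_poly p) u - s}"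
  define I where "I = {..<A} \<times> {..<B} \<times> {..<C}"
  define K where "K = {..<D} \<times> S \<times> {..<A + C + D}"
  have finI: "finite I" by (simp add: I_def)
  have w: "weight_le p (fst i + snd (snd i) + n) ((theta ^^ n) (aux_monom p i))" for i n
  proof -
    obtain a b c where i: "i = (a, b, c)" by (cases i)
    show ?thesis
      using weight_le_funpow_theta[OF p weight_le_mult_Xp_power[OF weight_le_mult_linear_power[OF weight_le.base]]]
      by (simp add: i aux_monom_def)
  qed
  have "\<forall>i n s. \<exists>q. degree q \<le> fst i + snd (snd i) + n \<and>
      (\<forall>u. int p dvd poly (fq_poly p) u - s \<longrightarrow> int p dvd poly ((theta ^^ n) (aux_monom p i)) u - poly q u)"
    using weight_le_eval[OF p(1) w] by blast
  then obtain q where q: "\<And>i n s. degree (q i n s) \<le> fst i + snd (snd i) + n"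
    "\<And>i n s u. int p dvd poly (fq_poly p) u - s \<Longrightarrow> int p dvd poly ((theta ^^ n) (aux_monom p i)) u - poly (q i n s) u"
    by metis
  define M where "M = (\<lambda>(n, s, j) i. Polynomial.coeff (q i n s) j)"
  have "card K < card I" using params by (simp add: K_def I_def card_cartesian_product mult.commute mult.left_commute)
  then obtain x where x: "\<exists>i\<in>I. \<not> int p dvd x i" "\<And>k. k \<in> K \<Longrightarrow> int p dvd (\<Sum>i\<in>I. x i * M k i)"
    using modular_siegel[of p I K M] prime_gt_1_nat[OF p(1)] finI S unfolding K_def by auto
  define P where "P = (\<Sum>i\<in>I. Polynomial.smult (x i) (aux_monom p i))"
  have nzP: "\<not> [:int p:] dvd P"
    using aux_combination_nonzero[OF p AB B] x(1) unfolding P_def I_def by blast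
  have vanish: "int p dvd poly ((theta ^^ n) P) u" if u: "u \<in> T" and n: "n < D" for u n
  proof -
    obtain s where s: "s \<in> S" "int p dvd poly (fq_poly p) u - s" using u by (auto simp: T_def)
    have "int p dvd Polynomial.coeff (\<Sum>i\<in>I. Polynomial.smult (x i) (q i n s)) j" for j
    proof (cases "j < A + C + D")
      case True
      then show ?thesis using x(2)[of "(n, s, j)"] n s(1) by (simp add: K_def M_def coeff_sum)
    next
      case False
      have "Polynomial.coeff (q i n s) j = 0" if "i \<in> I" for i
      proof (rule coeff_eq_0)
        have "fst i < A" "snd (snd i) < C" using that by (auto simp: I_def)
        then show "degree (q i n s) < j" using q(1)[of i n s] False n by linarith
      qed
      then show ?thesis by (simp add: coeff_sum)
    qed
    then have "[:int p:] dvd (\<Sum>i\<in>I. Polynomial.smult (x i) (q i n s))" by (simp add: const_poly_dvd_iff)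
    then have 1: "int p dvd (\<Sum>i\<in>I. x i * poly (q i n s) u)"
      using poly_dvd_of_const_dvd[of "int p" _ u] by (fastforce simp: poly_sum)
    have "poly ((theta ^^ n) P) u - (\<Sum>i\<in>I. x i * poly (q i n s) u)
       = (\<Sum>i\<in>I. x i * (poly ((theta ^^ n) (aux_monom p i)) u - poly (q i n s) u))"
      by (simp add: P_def funpow_theta_sum_smult poly_sum sum_subtractf right_diff_distrib)
    moreover have "int p dvd \<dots>" using q(2)[OF s(2)] by (intro dvd_sum dvd_mult) auto
    ultimately have "int p dvd poly ((theta ^^ n) P) u - (\<Sum>i\<in>I. x i * poly (q i n s) u)" by simp
    from dvd_add[OF this 1] show ?thesis by simp
  qed
  have finT: "finite T" unfolding T_def by (rule finite_subset[of _ "{2..<int p}"]) auto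
  have inc: "\<not> int p dvd v - u" if "u \<in> {0..<int p}" "v \<in> {0..<int p}" "u \<noteq> v" for u v
    using that zdvd_imp_le[of "int p" "\<bar>v - u\<bar>"] by auto
  have "(\<Sum>u\<in>T. D) \<le> degree P"
  proof (rule sum_multiplicities_le_degree[OF p(1) finT _ nzP])
    fix u assume u: "u \<in> T"
    then have "\<not> int p dvd u" "\<not> int p dvd u - 1" by (auto simp: T_def dest: zdvd_imp_le)
    then show "dvd_modp p ([:-u, 1:] ^ D) P"
      using linear_power_dvd_modp_of_theta[OF p(1)] D vanish[OF u] by blast
  next
    fix u v assume "u \<in> T" "v \<in> T" "u \<noteq> v"
    then show "\<not> int p dvd v - u" by (intro inc) (auto simp: T_def)
  qed
  also have "degree P \<le> p * (B + C)"
    unfolding P_def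
  proof (rule degree_sum_le[OF finI])
    fix i assume "i \<in> I"
    then obtain a b c where i: "i = (a, b, c)" "a < A" "b < B" "c < C" by (auto simp: I_def)
    have "degree (aux_monom p i) \<le> p * c + (a + p * b)"
    proof -
      have "degree ([:0, 1:] ^ (p * c) :: int poly) \<le> p * c" by (simp add: degree_power_eq)
      moreover have "degree ([:-1, 1:] ^ a :: int poly) \<le> a" by (simp add: degree_power_eq)
      moreover have "degree (fq_poly p ^ b) \<le> p * b"
        using degree_power_le[of "fq_poly p" b] degree_fq_poly[OF p] by (meson le_trans mult_le_mono1)
      ultimately show ?thesis unfolding i aux_monom_def prod.case
        using degree_mult_le[of "[:0, 1:] ^ (p * c)" "[:-1, 1:] ^ a * fq_poly p ^ b"]
          degree_mult_le[of "[:-1, 1:] ^ a" "fq_poly p ^ b"] by linarith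
    qed
    also have "\<dots> \<le> p * (B + C)"
    proof -
      have "a \<le> p" using i(2) AB B by (metis le_trans less_imp_le mult_le_mono2 mult.right_neutral Suc_leI One_nat_def)
      moreover have "p * b + p \<le> p * B" using i(3) by (metis Suc_leI mult_Suc_right add.commute mult_le_mono2)
      moreover have "p * c \<le> p * C" using i(4) by simp
      ultimately show ?thesis unfolding distrib_left by linarith
    qed
    finally show "degree (Polynomial.smult (x i) (aux_monom p i)) \<le> p * (B + C)"
      using degree_smult_le le_trans by blast
  qed
  finally show ?thesis by (simp add: T_def mult.commute)
qed

text \<open>With J = card S and z = (p J)^(1/3), the choice is B = C near z, A near p / z and D near
  p / (8 z). Since B and D are at most A, the parameter condition follows from 3 J D < B^2, and 8 J
  D \<le> z^2 by definition of z. The outcome p (B + C) / D is at most 64 z^2; the cubed form avoids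
  roots. The assumption 512 J^2 \<le> p amounts to 8 z^2 \<le> p, which makes p / (8 z) at least
  z.\<close>

lemma fibre_union_bound:
  assumes p: "prime p" "odd p" and S: "finite S" "S \<noteq> {}" and J: "512 * card S ^ 2 \<le> p"
  shows "real (card {u \<in> {2..<int p}. \<exists>s\<in>S. int p dvd poly (fq_poly p) u - s}) ^ 3
      \<le> 64 ^ 3 * real p ^ 2 * real (card S) ^ 2"
proof -
  define T where "T = {u \<in> {2..<int p}. \<exists>s\<in>S. int p dvd poly (fq_poly p) u - s}"
  define J where "J = real (card S)"
  define P where "P = real p"
  define z where "z = root 3 (P * J)"
  have J1: "J \<ge> 1" using S card_gt_0_iff[of S] by (simp add: J_def)
  have P0: "P > 0" using prime_gt_0_nat[OF p(1)] by (simp add: P_def)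
  have JP: "512 * J ^ 2 \<le> P" using assms(5) unfolding J_def P_def by (metis of_nat_le_iff of_nat_mult of_nat_numeral of_nat_power)
  have z3: "z ^ 3 = P * J" using J1 P0 by (simp add: z_def)
  have P1: "P \<ge> 1" using prime_gt_0_nat[OF p(1)] by (simp add: P_def)
  have z1: "z \<ge> 1" unfolding z_def using J1 P1 by (simp add: mult_ge1_I real_root_ge_1_iff)
  have z2: "8 * z ^ 2 \<le> P"
  proof -
    have "(8 * z ^ 2) ^ 3 = 512 * (z ^ 3) ^ 2" by (simp add: power_mult_distrib flip: power_mult)
    also have "\<dots> = P ^ 2 * (512 * J ^ 2)" unfolding z3 by (simp add: power_mult_distrib)
    also have "\<dots> \<le> P ^ 2 * P" using JP by (intro mult_left_mono) auto
    also have "\<dots> = P ^ 3" by (simp add: power2_eq_square power3_eq_cube)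
    finally have "(8 * z ^ 2) ^ Suc 2 \<le> P ^ Suc 2" by simp
    then show ?thesis by (rule power_le_imp_le_base) (use P0 in simp)
  qed
  define B where "B = nat \<lceil>z\<rceil>"
  have B: "z \<le> real B" "real B \<le> 2 * z"
    using z1 by (auto simp: B_def) linarith+
  define A where "A = p div B"
  have B0: "B > 0" using B(1) z1 by (cases B) auto
  have AB: "A * B \<le> p" by (simp add: A_def)
  have "real p < real B * (real A + 1)"
  proof -
    have "p < B * (A + 1)" using dividend_less_times_div[OF B0, of p] by (simp add: A_def)
    then show ?thesis by (metis of_nat_1 of_nat_add of_nat_less_iff of_nat_mult)
  qed
  then have "P < 2 * z * (real A + 1)" using B(2) unfolding P_def
    by (meson less_le_trans mult_right_mono of_nat_0_le_iff add_nonneg_nonneg zero_le_one)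
  then have A1: "P / (2 * z) < real A + 1" using z1 by (simp add: field_simps)
  have Pz: "P / (8 * z) \<ge> z" using z2 z1 by (simp add: field_simps power2_eq_square)
  have A: "P / (4 * z) \<le> real A"
  proof -
    have "P / (2 * z) = 4 * (P / (8 * z))" "P / (4 * z) = 2 * (P / (8 * z))" by simp_all
    then show ?thesis using A1 Pz z1 by linarith
  qed
  define D where "D = nat \<lfloor>P / (8 * z)\<rfloor>"
  have D: "real D \<le> P / (8 * z)" "P / (16 * z) \<le> real D"
  proof -
    define w where "w = P / (8 * z)"
    have w: "w \<ge> 1" "P / (16 * z) = w / 2" unfolding w_def using Pz z1 by (linarith, simp)
    have "\<lfloor>w\<rfloor> \<ge> 1" using w by simp
    then have "real D = real_of_int \<lfloor>w\<rfloor>" "real_of_int \<lfloor>w\<rfloor> \<ge> 1" by (simp_all add: D_def w_def)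
    then show "P / (16 * z) \<le> real D" "real D \<le> P / (8 * z)"
      unfolding w(2) w_def[symmetric] by linarith+
  qed
  have DA: "D \<le> A"
  proof -
    have "P / (8 * z) \<le> P / (4 * z)" using z1 P0 by (simp add: frac_le)
    then show ?thesis using D(1) A by linarith
  qed
  have BA: "B \<le> A"
  proof -
    have "2 * z \<le> 2 * (P / (8 * z))" using Pz by simp
    also have "\<dots> = P / (4 * z)" by simp
    finally show ?thesis using B(2) A by linarith
  qed
  have A0: "A > 0" using BA B0 by simp
  have Dp: "D \<le> p" using DA AB B0 by (metis le_trans mult_le_mono2 mult.right_neutral Suc_leI One_nat_def)
  have "J * real D * 8 \<le> z ^ 2"
  proof -
    have "J * real D * 8 \<le> J * (P / (8 * z)) * 8" using D(1) J1 by (intro mult_right_mono mult_left_mono) auto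
    also have "\<dots> = (P * J) / z" using z1 by (simp add: field_simps)
    also have "\<dots> = z ^ 2" unfolding z3[symmetric] using z1 by (simp add: power3_eq_cube power2_eq_square)
    finally show ?thesis .
  qed
  also have "z ^ 2 \<le> real B ^ 2" using B(1) z1 by (intro power_mono) auto
  finally have "real (card S * D * 8) \<le> real (B ^ 2)" by (simp add: J_def)
  then have JDB: "card S * D * 8 \<le> B ^ 2" by linarith
  have "card S * (D * (A + B + D)) < A * B * B"
  proof -
    have "card S * (D * (A + B + D)) \<le> card S * (D * (3 * A))" using BA DA by (intro mult_le_mono2) simp
    also have "\<dots> = (card S * D) * 3 * A" by simp
    also have "\<dots> < B ^ 2 * A"
    proof (rule mult_strict_right_mono)
      have "B ^ 2 > 0" using B0 by simp
      then show "card S * D * 3 < B ^ 2" using JDB by linarith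
    qed (use A0 in simp)
    finally show ?thesis by (simp add: power2_eq_square mult.commute mult.left_commute)
  qed
  from stepanov_bound[OF p B0 AB Dp S(1) this]
  have "real (D * card T) \<le> real (p * (B + B))" unfolding T_def using of_nat_le_iff by blast
  then have "real D * real (card T) \<le> P * (4 * z)"
  proof -
    have "P * (2 * real B) \<le> P * (4 * z)" using B(2) P0 by (intro mult_left_mono) auto
    then show ?thesis using \<open>real (D * card T) \<le> real (p * (B + B))\<close> by (simp add: P_def algebra_simps)
  qed
  moreover have "P / (16 * z) * real (card T) \<le> real D * real (card T)" using D(2) by (intro mult_right_mono) auto
  ultimately have "P / (16 * z) * real (card T) \<le> P * (4 * z)" by linarith
  then have "real (card T) \<le> 64 * z ^ 2" using P0 z1 by (simp add: field_simps power2_eq_square)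
  then have "real (card T) ^ 3 \<le> (64 * z ^ 2) ^ 3" by (intro power_mono) auto
  also have "\<dots> = 64 ^ 3 * (z ^ 3) ^ 2" by (simp add: power_mult_distrib flip: power_mult)
  also have "\<dots> = 64 ^ 3 * P ^ 2 * J ^ 2" unfolding z3 by (simp add: power_mult_distrib)
  finally show ?thesis by (simp add: T_def P_def J_def)
qed

section \<open>Level sets and second moment of the fibre sizes\<close>

definition fibre :: "nat \<Rightarrow> int \<Rightarrow> int set" where
  "fibre p s = {u \<in> {2..<int p}. int p dvd poly (fq_poly p) u - s}"

lemma finite_fibre [simp]: "finite (fibre p s)"
  by (rule finite_subset[of _ "{2..<int p}"]) (auto simp: fibre_def)

lemma fibre_disjoint:
  assumes "s \<in> {0..<int p}" "t \<in> {0..<int p}" "s \<noteq> t"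
  shows "fibre p s \<inter> fibre p t = {}"
proof -
  have "s = t" if "int p dvd x - s" "int p dvd x - t" for x
  proof -
    have "int p dvd s - t" using dvd_diff[OF that(2,1)] by simp
    then show ?thesis using assms(1,2) zdvd_imp_le[of "int p" "\<bar>s - t\<bar>"] by (cases "s = t") auto
  qed
  then show ?thesis using assms(3) by (auto simp: fibre_def)
qed

lemma card_fibre_Union:
  assumes "S \<subseteq> {0..<int p}"
  shows "card {u \<in> {2..<int p}. \<exists>s\<in>S. int p dvd poly (fq_poly p) u - s} = (\<Sum>s\<in>S. card (fibre p s))"
proof -
  have "finite S" using assms finite_subset by blast
  have "{u \<in> {2..<int p}. \<exists>s\<in>S. int p dvd poly (fq_poly p) u - s} = (\<Union>s\<in>S. fibre p s)"
    by (auto simp: fibre_def)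
  moreover have "card (\<Union>s\<in>S. fibre p s) = (\<Sum>s\<in>S. card (fibre p s))"
  proof (rule card_UN_disjoint[OF \<open>finite S\<close>])
    show "\<forall>s\<in>S. \<forall>t\<in>S. s \<noteq> t \<longrightarrow> fibre p s \<inter> fibre p t = {}"
      using assms fibre_disjoint by (meson subsetD)
  qed simp
  ultimately show ?thesis by simp
qed

text \<open>For a set S of such values, disjointness of the fibres gives at least card S * t points,
  and the union bound yields card S^3 t^3 \<le> 64^3 p^2 card S^2. It applies only while 512 card
  S^2 \<le> p; a larger level set would contain a subset of size about sqrt (p / 512), and for that
  subset t \<ge> 256 sqrt p contradicts the bound.\<close>

lemma level_set_bound:
  assumes p: "prime p" "odd p" "512 \<le> p" and t: "256 * sqrt (real p) \<le> real t"
  shows "real (card {s \<in> {0..<int p}. t \<le> card (fibre p s)}) * real t ^ 3 \<le> 64 ^ 3 * real p ^ 2"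
proof -
  define L where "L = {s \<in> {0..<int p}. t \<le> card (fibre p s)}"
  define r where "r = sqrt (real p / 512)"
  have main: "real (card S) * real t ^ 3 \<le> 64 ^ 3 * real p ^ 2"
    if S: "S \<subseteq> L" "S \<noteq> {}" "512 * card S ^ 2 \<le> p" for S
  proof -
    have fS: "finite S" using S(1) by (rule finite_subset) (rule finite_subset[of _ "{0..<int p}"], auto simp: L_def)
    have "of_nat (card S) * t \<le> (\<Sum>s\<in>S. card (fibre p s))"
      by (rule sum_bounded_below) (use S(1) in \<open>auto simp: L_def\<close>)
    then have "card S * t \<le> (\<Sum>s\<in>S. card (fibre p s))" by simp
    also have "\<dots> = card {u \<in> {2..<int p}. \<exists>s\<in>S. int p dvd poly (fq_poly p) u - s}"
      using S(1) by (intro card_fibre_Union[symmetric]) (auto simp: L_def)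
    finally have "real (card S * t) ^ 3 \<le> 64 ^ 3 * real p ^ 2 * real (card S) ^ 2"
      using fibre_union_bound[OF p(1,2) fS S(2,3)]
      by (intro order_trans[OF power_mono[of "real (card S * t)"]]) (simp_all only: of_nat_le_iff of_nat_0_le_iff)
    then have "real (card S) ^ 2 * (real (card S) * real t ^ 3) \<le> real (card S) ^ 2 * (64 ^ 3 * real p ^ 2)"
      by (simp add: power_mult_distrib power2_eq_square power3_eq_cube mult.commute mult.left_commute)
    moreover have "real (card S) ^ 2 > 0" using fS S(2) by simp
    ultimately show ?thesis by (simp only: mult_le_cancel_left_pos)
  qed
  have r1: "r \<ge> 1" using p(3) by (simp add: r_def)
  define J where "J = nat \<lfloor>r\<rfloor>"
  have J: "real J \<le> r" "r / 2 \<le> real J" "J > 0"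
  proof -
    have "\<lfloor>r\<rfloor> \<ge> 1" using r1 by simp
    then have "real J = real_of_int \<lfloor>r\<rfloor>" "real_of_int \<lfloor>r\<rfloor> \<ge> 1" by (simp_all add: J_def)
    then show "real J \<le> r" "r / 2 \<le> real J" "J > 0" by linarith+
  qed
  have JP: "512 * J ^ 2 \<le> p"
  proof -
    have "real J ^ 2 \<le> r ^ 2" using J by (intro power_mono) auto
    also have "r ^ 2 = real p / 512" by (simp add: r_def)
    finally have "real (512 * J ^ 2) \<le> real p" by simp
    then show ?thesis by linarith
  qed
  have "card L < J"
  proof (rule ccontr)
    assume "\<not> card L < J"
    then obtain S where S: "S \<subseteq> L" "card S = J" by (meson not_le obtain_subset_with_card_n linorder_not_less)
    then have "real J * real t ^ 3 \<le> 64 ^ 3 * real p ^ 2" using main[of S] J(3) JP by force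
    moreover have "real J * real t ^ 3 \<ge> (r / 2) * (256 * sqrt (real p)) ^ 3"
      using J t r1 by (intro mult_mono power_mono) auto
    \<comment> \<open>23^2 = 529 exceeds 512. The halving from rounding then gives 256^3 / 46 >
      64^3, which is what the threshold 256 is chosen for.\<close>
    moreover have "r \<ge> sqrt (real p) / 23"
    proof -
      have "sqrt (real p) / 23 = sqrt (real p / 529)" by (simp add: real_sqrt_divide)
      also have "\<dots> \<le> r" unfolding r_def by (intro real_sqrt_le_mono divide_left_mono) auto
      finally show ?thesis .
    qed
    then have "(r / 2) * (256 * sqrt (real p)) ^ 3 \<ge> (sqrt (real p) / 46) * (256 * sqrt (real p)) ^ 3"
      by (intro mult_right_mono) auto
    moreover have "(sqrt (real p) / 46) * (256 * sqrt (real p)) ^ 3 = 256 ^ 3 / 46 * real p ^ 2"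
    proof -
      have "sqrt (real p) * sqrt (real p) ^ 3 = (sqrt (real p) ^ 2) ^ 2"
        unfolding power_mult[symmetric] power_Suc[symmetric] by simp
      also have "\<dots> = real p ^ 2" by simp
      finally have "sqrt (real p) * sqrt (real p) ^ 3 = real p ^ 2" .
      then show ?thesis by (simp add: power_mult_distrib del: power_Suc)
    qed
    moreover have "256 ^ 3 / 46 * real p ^ 2 > 64 ^ 3 * real p ^ 2"
      using p(3) by (intro mult_strict_right_mono) auto
    ultimately show False by linarith
  qed
  then have "512 * card L ^ 2 \<le> p"
    using JP by (meson le_trans less_imp_le mult_le_mono2 power_mono le0)
  then show ?thesis unfolding L_def[symmetric] using main[of L] by (cases "L = {}") auto
qed

lemma sum_inverse_square_bound:
  assumes "m > 0"
  shows "(\<Sum>t\<in>{m<..n}. 1 / real t ^ 2) \<le> 1 / real m"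
proof (cases "m \<le> n")
  case True
  then have "(\<Sum>t\<in>{m<..n}. 1 / real t ^ 2) \<le> 1 / real m - 1 / real n"
  proof (induction n rule: dec_induct)
    case (step n)
    have "{m<..Suc n} = insert (Suc n) {m<..n}" using step.hyps by auto
    moreover have "1 / real (Suc n) ^ 2 \<le> 1 / real n - 1 / real (Suc n)"
    proof -
      have n0: "real n > 0" using step.hyps assms by simp
      then have "1 / real n - 1 / real (Suc n) = 1 / (real n * real (Suc n))" by (simp add: field_simps)
      also have "\<dots> \<ge> 1 / real (Suc n) ^ 2" using n0 unfolding power2_eq_square by (intro frac_le mult_right_mono mult_pos_pos) auto
      finally show ?thesis .
    qed
    ultimately show ?case using step.IH by simp
  qed simp
  then show ?thesis by (smt (verit) of_nat_0_le_iff zero_le_divide_1_iff)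
qed simp

text \<open>Layer-cake summation of r^2 with the layers up to m replaced by m r, since the level set
  bound is available only above a threshold.\<close>

lemma square_le_layer_sum:
  fixes r m n :: nat
  assumes "r \<le> n"
  shows "r ^ 2 \<le> m * r + (\<Sum>t\<in>{m<..n}. if t \<le> r then 2 * t else 0)"
proof (cases "r \<le> m")
  case True
  then show ?thesis by (simp add: power2_eq_square trans_le_add1)
next
  case False
  then have mr: "m \<le> r" by simp
  have "r ^ 2 \<le> m ^ 2 + (\<Sum>t\<in>{m<..r}. 2 * t)"
    using mr
  proof (induction r rule: dec_induct)
    case (step k)
    have "{m<..Suc k} = insert (Suc k) {m<..k}" using step.hyps by auto
    then show ?case using step.IH by (simp add: power2_eq_square)
  qed simp
  also have "(\<Sum>t\<in>{m<..r}. 2 * t) = (\<Sum>t\<in>{m<..n}. if t \<le> r then 2 * t else 0)"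
    using assms by (intro sum.mono_neutral_cong_left) auto
  also have "m ^ 2 \<le> m * r" using mr by (simp add: power2_eq_square)
  finally show ?thesis by simp
qed

text \<open>Below the threshold m, about 256 sqrt p, the total size of all fibres gives m p. Above
  it the decay p^2 / t^3 of the level sets gives a sum of order p^2 / m. Both are of order p^(3/2),
  with constants 257 and 2 * 64^3 / 256 = 2048.\<close>

lemma fibre_second_moment:
  assumes p: "prime p" "odd p" "512 \<le> p"
  shows "(\<Sum>s\<in>{0..<int p}. real (card (fibre p s)) ^ 2) \<le> 2400 * real p * sqrt (real p)"
proof -
  define m where "m = nat \<lceil>256 * sqrt (real p)\<rceil>"
  define q where "q = sqrt (real p)"
  have q1: "q \<ge> 1" "real p = q ^ 2" using p(3) by (auto simp: q_def)
  have m: "256 * q \<le> real m" "real m \<le> 257 * q"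
    using q1 unfolding m_def q_def[symmetric] by linarith+
  define r where "r = (\<lambda>s. card (fibre p s))"
  have rp: "r s \<le> p" for s
    using card_mono[of "{0..<int p}" "fibre p s"] by (auto simp: r_def fibre_def subset_iff)
  have sr: "(\<Sum>s\<in>{0..<int p}. r s) \<le> p"
    unfolding r_def card_fibre_Union[OF order_refl, symmetric]
    using card_mono[of "{0..<int p}" "{u \<in> {2..<int p}. \<exists>s\<in>{0..<int p}. int p dvd poly (fq_poly p) u - s}"]
    by (auto simp: subset_iff)
  have "(\<Sum>s\<in>{0..<int p}. r s ^ 2) \<le> (\<Sum>s\<in>{0..<int p}. m * r s + (\<Sum>t\<in>{m<..p}. if t \<le> r s then 2 * t else 0))"
    by (intro sum_mono square_le_layer_sum rp)
  also have "\<dots> = m * (\<Sum>s\<in>{0..<int p}. r s) + (\<Sum>s\<in>{0..<int p}. \<Sum>t\<in>{m<..p}. if t \<le> r s then 2 * t else 0)"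
    by (simp add: sum.distrib sum_distrib_left)
  also have "(\<Sum>s\<in>{0..<int p}. \<Sum>t\<in>{m<..p}. if t \<le> r s then 2 * t else 0)
      = (\<Sum>t\<in>{m<..p}. \<Sum>s\<in>{0..<int p}. if t \<le> r s then 2 * t else 0)" by (rule sum.swap)
  also have "\<dots> = (\<Sum>t\<in>{m<..p}. 2 * t * card {s \<in> {0..<int p}. t \<le> r s})"
    by (simp add: sum.If_cases Int_def mult.commute)
  finally have "real (\<Sum>s\<in>{0..<int p}. r s ^ 2)
      \<le> real (m * p + (\<Sum>t\<in>{m<..p}. 2 * t * card {s \<in> {0..<int p}. t \<le> r s}))"
    using sr by (smt (verit) add_le_mono1 le_trans mult_le_mono2 of_nat_le_iff)
  also have "\<dots> = real m * real p + (\<Sum>t\<in>{m<..p}. 2 * real t * real (card {s \<in> {0..<int p}. t \<le> r s}))"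
    by simp
  also have "(\<Sum>t\<in>{m<..p}. 2 * real t * real (card {s \<in> {0..<int p}. t \<le> r s}))
      \<le> (\<Sum>t\<in>{m<..p}. 2 * 64 ^ 3 * real p ^ 2 * (1 / real t ^ 2))"
  proof (rule sum_mono)
    fix t assume t: "t \<in> {m<..p}"
    then have "256 * sqrt (real p) \<le> real t" using m(1) unfolding q_def by (smt (verit) greaterThanAtMost_iff of_nat_less_iff)
    from level_set_bound[OF p this]
    have "real (card {s \<in> {0..<int p}. t \<le> r s}) * real t ^ 3 \<le> 64 ^ 3 * real p ^ 2" by (simp add: r_def)
    moreover have "real t > 0" using t by simp
    ultimately show "2 * real t * real (card {s \<in> {0..<int p}. t \<le> r s}) \<le> 2 * 64 ^ 3 * real p ^ 2 * (1 / real t ^ 2)"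
      by (simp add: field_simps power2_eq_square power3_eq_cube)
  qed
  also have "\<dots> \<le> 2 * 64 ^ 3 * real p ^ 2 * (1 / real m)"
    unfolding sum_distrib_left[symmetric] using m q1 by (intro mult_left_mono sum_inverse_square_bound) auto
  also have "\<dots> \<le> 2 * 64 ^ 3 * real p ^ 2 * (1 / (256 * q))"
    using m q1 by (intro mult_left_mono divide_left_mono mult_pos_pos) auto
  also have "\<dots> = 2048 * real p * q" using q1 by (simp add: power2_eq_square)
  also have "real m * real p + 2048 * real p * q \<le> 257 * q * real p + 2048 * real p * q"
    using m by (intro add_right_mono mult_right_mono) auto
  also have "\<dots> \<le> 2400 * real p * q" using q1 by (simp add: algebra_simps)
  finally show ?thesis by (simp add: r_def q_def)
qed

section \<open>Additive energy of the roots of unity modulo the square of a prime\<close>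

definition unit_roots :: "nat \<Rightarrow> int set" where
  "unit_roots p = {g \<in> {0..<int p ^ 2}. [g ^ (p - 1) = 1] (mod int p ^ 2)}"

lemma finite_unit_roots [simp]: "finite (unit_roots p)"
  by (rule finite_subset[of _ "{0..<int p ^ 2}"]) (auto simp: unit_roots_def)

lemma cong_modulus_power2D: "[a = b] (mod int p ^ 2) \<Longrightarrow> [a = b] (mod int p)"
  by (rule cong_dvd_modulus[of _ _ "int p ^ 2"]) simp_all

text \<open>u^p - v^p is u - v times a sum of p terms, each congruent to v^(p-1), so p divides both
  factors.\<close>

lemma cong_pow_prime:
  assumes "[u = v] (mod int p)"
  shows "[u ^ p = v ^ p] (mod int p ^ 2)"
proof -
  have "[(\<Sum>i<p. v ^ (p - Suc i) * u ^ i) = (\<Sum>i<p. v ^ (p - Suc i) * v ^ i)] (mod int p)"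
    by (intro cong_sum cong_mult cong_pow assms) auto
  also have "(\<Sum>i<p. v ^ (p - Suc i) * v ^ i) = (\<Sum>i<p. v ^ (p - 1))"
    by (intro sum.cong) (simp_all flip: power_add)
  also have "\<dots> = int p * v ^ (p - 1)" by simp
  finally have "int p dvd (\<Sum>i<p. v ^ (p - Suc i) * u ^ i)" by (simp add: cong_def mod_eq_0_iff_dvd)
  moreover have "int p dvd u - v" using assms by (simp add: cong_iff_dvd_diff)
  ultimately have "int p * int p dvd u ^ p - v ^ p"
    unfolding power_diff_sumr2 by (intro mult_dvd_mono)
  then show ?thesis by (simp add: cong_iff_dvd_diff power2_eq_square)
qed

lemma pow_unit_cong:
  assumes "prime p" "[u ^ (p - 1) = 1] (mod int p ^ 2)"
  shows "[u ^ p = u] (mod int p ^ 2)"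
proof -
  have "[u ^ (p - 1) * u = 1 * u] (mod int p ^ 2)" by (intro cong_mult assms(2) cong_refl)
  then show ?thesis using prime_gt_0_nat[OF assms(1)] by (simp add: power_eq_if mult.commute)
qed

lemma unit_not_dvd:
  assumes "prime p" "[u ^ (p - 1) = 1] (mod int p ^ 2)"
  shows "\<not> int p dvd u"
proof
  assume "int p dvd u"
  moreover have "p - 1 > 0" using prime_gt_1_nat[OF assms(1)] by simp
  ultimately have "int p dvd u ^ (p - 1)" by (meson dvd_power dvd_trans dvd_power_same)
  moreover have "int p dvd u ^ (p - 1) - 1"
    using cong_modulus_power2D[OF assms(2)] by (simp add: cong_iff_dvd_diff)
  ultimately have "int p dvd 1" by (metis dvd_diff diff_diff_eq2 add_diff_cancel_left')
  then show False using prime_gt_1_nat[OF assms(1)] by simp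
qed

lemma not_dvd_coprime_square:
  assumes "prime p" "\<not> int p dvd u"
  shows "coprime u (int p ^ 2)"
  using assms by (metis coprime_commute coprime_power_right_iff prime_imp_coprime prime_nat_int_transfer)

text \<open>Elements of G equal their p-th powers, and p-th powers modulo p^2 depend only on the
  residue modulo p. Hence G can be parametrized by residues modulo p throughout.\<close>

lemma unit_cong_unique:
  assumes "prime p" "[u ^ (p - 1) = 1] (mod int p ^ 2)" "[v ^ (p - 1) = 1] (mod int p ^ 2)" "[u = v] (mod int p)"
  shows "[u = v] (mod int p ^ 2)"
  using cong_pow_prime[OF assms(4)] pow_unit_cong[OF assms(1,2)] pow_unit_cong[OF assms(1,3)]
  by (metis cong_sym cong_trans)

lemma unit_rootsD:
  "g \<in> unit_roots p \<Longrightarrow> [g ^ (p - 1) = 1] (mod int p ^ 2)" "g \<in> unit_roots p \<Longrightarrow> 0 \<le> g"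
  "g \<in> unit_roots p \<Longrightarrow> g < int p ^ 2"
  by (auto simp: unit_roots_def)

lemma unit_roots_cong_square_unique:
  assumes "g \<in> unit_roots p" "h \<in> unit_roots p" "[g = h] (mod int p ^ 2)"
  shows "g = h"
  using assms by (auto simp: unit_roots_def cong_def)

lemma unit_roots_cong_unique:
  assumes "prime p" "g \<in> unit_roots p" "h \<in> unit_roots p" "[g = h] (mod int p)"
  shows "g = h"
  using unit_roots_cong_square_unique[OF assms(2,3)] unit_cong_unique[OF assms(1)] unit_rootsD assms by blast

lemma mod_in_unit_roots:
  assumes "prime p" "[u ^ (p - 1) = 1] (mod int p ^ 2)"
  shows "u mod int p ^ 2 \<in> unit_roots p"
proof -
  have "[(u mod int p ^ 2) ^ (p - 1) = 1] (mod int p ^ 2)"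
    using assms(2) by (simp add: cong_def power_mod)
  then show ?thesis using prime_gt_0_nat[OF assms(1)] by (auto simp: unit_roots_def)
qed

text \<open>Reduction modulo p and the Teichmueller-type map sending a to a^p are injections in both
  directions between G and the nonzero residues.\<close>

lemma card_unit_roots:
  assumes "prime p"
  shows "card (unit_roots p) = p - 1"
proof (rule antisym)
  have p0: "int p > 0" using prime_gt_0_nat[OF assms] by simp
  have c: "card {1..<int p} = p - 1" by simp
  have "inj_on (\<lambda>g. g mod int p) (unit_roots p)"
    by (rule inj_onI) (rule unit_roots_cong_unique[OF assms], auto simp: cong_def)
  moreover have "(\<lambda>g. g mod int p) ` unit_roots p \<subseteq> {1..<int p}"
  proof (safe)
    fix g assume "g \<in> unit_roots p"
    then have "g mod int p \<noteq> 0" using unit_not_dvd[OF assms unit_rootsD(1)] by (metis dvd_eq_mod_eq_0)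
    then show "g mod int p \<in> {1..<int p}" using p0
      by (metis atLeastLessThan_iff int_one_le_iff_zero_less order_le_less pos_mod_bound pos_mod_sign)
  qed
  ultimately have "card (unit_roots p) \<le> card {1..<int p}" by (intro card_inj_on_le) auto
  then show "card (unit_roots p) \<le> p - 1" unfolding c .
  have "inj_on (\<lambda>a. a ^ p mod int p ^ 2) {1..<int p}"
  proof (rule inj_onI)
    fix a b assume ab: "a \<in> {1..<int p}" "b \<in> {1..<int p}" "a ^ p mod int p ^ 2 = b ^ p mod int p ^ 2"
    then have "[a ^ p = b ^ p] (mod int p)" by (intro cong_modulus_power2D) (simp add: cong_def)
    moreover have "[a ^ p = a] (mod int p)" "[b ^ p = b] (mod int p)"
      using prime_dvd_power_diff_self[OF assms] by (simp_all add: cong_iff_dvd_diff)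
    ultimately have "[a = b] (mod int p)" by (metis cong_sym cong_trans)
    then show "a = b" using ab by (simp add: cong_def)
  qed
  moreover have "(\<lambda>a. a ^ p mod int p ^ 2) ` {1..<int p} \<subseteq> unit_roots p"
  proof (safe)
    fix a assume a: "a \<in> {1..<int p}"
    then have "\<not> int p dvd a" by (auto dest: zdvd_imp_le)
    then have "coprime a (int p)" using assms by (metis coprime_commute prime_imp_coprime prime_nat_int_transfer)
    from fermat_quotient_exact[OF assms this] have "[a ^ (p - 1) = 1] (mod int p)" by (simp add: cong_iff_dvd_diff)
    from cong_pow_prime[OF this] have "[(a ^ p) ^ (p - 1) = 1] (mod int p ^ 2)" by (simp add: mult.commute flip: power_mult)
    then show "a ^ p mod int p ^ 2 \<in> unit_roots p" by (rule mod_in_unit_roots[OF assms])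
  qed
  ultimately have "card {1..<int p} \<le> card (unit_roots p)" by (intro card_inj_on_le) auto
  then show "p - 1 \<le> card (unit_roots p)" unfolding c .
qed

lemma unit_pow_mult:
  assumes "[u ^ n = 1] (mod m)" "[v ^ n = 1] (mod m)"
  shows "[(u * v) ^ n = (1 :: int)] (mod m)"
  using cong_mult[OF assms] by (simp add: power_mult_distrib)

lemma bij_betw_unit_roots_mult:
  assumes "prime p" "g \<in> unit_roots p"
  shows "bij_betw (\<lambda>h. g * h mod int p ^ 2) (unit_roots p) (unit_roots p)"
proof -
  have inj: "inj_on (\<lambda>h. g * h mod int p ^ 2) (unit_roots p)"
  proof (rule inj_onI)
    fix h k assume hk: "h \<in> unit_roots p" "k \<in> unit_roots p" "g * h mod int p ^ 2 = g * k mod int p ^ 2"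
    have "coprime g (int p ^ 2)" by (intro not_dvd_coprime_square unit_not_dvd assms unit_rootsD)
    moreover have "[g * h = g * k] (mod int p ^ 2)" using hk by (simp add: cong_def)
    ultimately have "[h = k] (mod int p ^ 2)" using cong_mult_lcancel by blast
    then show "h = k" using hk unit_roots_cong_square_unique by blast
  qed
  moreover have "(\<lambda>h. g * h mod int p ^ 2) ` unit_roots p \<subseteq> unit_roots p"
    by (intro image_subsetI mod_in_unit_roots[OF assms(1)] unit_pow_mult unit_rootsD(1) assms(2))
  ultimately show ?thesis by (simp add: bij_betw_def endo_inj_surj)
qed

definition energy_quads :: "nat \<Rightarrow> ((int \<times> int) \<times> (int \<times> int)) set" where
  "energy_quads p = {((a, b), (c, d)). a \<in> unit_roots p \<and> b \<in> unit_roots p \<and> c \<in> unit_roots p \<and> d \<in> unit_roots p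
     \<and> [a + b = c + d] (mod int p ^ 2)}"

lemma finite_energy_quads [simp]: "finite (energy_quads p)"
  by (rule finite_subset[of _ "(unit_roots p \<times> unit_roots p) \<times> (unit_roots p \<times> unit_roots p)"])
     (auto simp: energy_quads_def)

text \<open>
  Elements of \<open>G\<close> are \<open>p\<close>-th powers of their residues modulo \<open>p\<close>, so that
  \<open>a - c = h^p (u^p - (u - 1)^p) = h^p (1 + p F(u))\<close> modulo \<open>p^2\<close>, and likewise for \<open>d - b\<close> and \<open>v\<close>.
\<close>

lemma fq_poly_cong_of_sum_eq:
  assumes p: "prime p" "odd p"
    and units: "a \<in> unit_roots p" "b \<in> unit_roots p" "c \<in> unit_roots p" "d \<in> unit_roots p"
    and sum: "[a + b = c + d] (mod int p ^ 2)"
    and h: "\<not> int p dvd h" "[a - c = h] (mod int p)"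
    and u: "[u * h = a] (mod int p)" and v: "[v * h = d] (mod int p)"
  shows "int p dvd poly (fq_poly p) u - poly (fq_poly p) v"
proof -
  have p0: "int p \<noteq> 0" using prime_gt_0_nat[OF p(1)] by simp
  have up: "[x ^ p = g] (mod int p ^ 2)" if "g \<in> unit_roots p" "[x = g] (mod int p)" for x g
    using cong_trans[OF cong_pow_prime[OF that(2)] pow_unit_cong[OF p(1) unit_rootsD(1)[OF that(1)]]] .
  have 1: "[(u * h) ^ p = a] (mod int p ^ 2)" using up units u by blast
  have 2: "[((u - 1) * h) ^ p = c] (mod int p ^ 2)"
  proof (rule up[OF units(3)])
    have "[u * h - h = a - (a - c)] (mod int p)" by (intro cong_diff u cong_sym[OF h(2)])
    then show "[(u - 1) * h = c] (mod int p)" by (simp add: algebra_simps)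
  qed
  have 3: "[(v * h) ^ p = d] (mod int p ^ 2)" using up units v by blast
  have 4: "[((v - 1) * h) ^ p = b] (mod int p ^ 2)"
  proof (rule up[OF units(2)])
    have "[v * h - h = d - (a - c)] (mod int p)" by (intro cong_diff v cong_sym[OF h(2)])
    moreover have "[d - (a - c) = b] (mod int p)"
    proof -
      have "int p dvd (a + b) - (c + d)" using cong_modulus_power2D[OF sum] by (simp add: cong_iff_dvd_diff)
      moreover have "(a + b) - (c + d) = b - (d - (a - c))" by simp
      ultimately show ?thesis by (metis cong_iff_dvd_diff cong_sym)
    qed
    ultimately have "[v * h - h = b] (mod int p)" by (rule cong_trans)
    then show "[(v - 1) * h = b] (mod int p)" by (simp add: algebra_simps)
  qed
  have "[(u * h) ^ p - ((u - 1) * h) ^ p = a - c] (mod int p ^ 2)" by (intro cong_diff 1 2)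
  moreover have "[(v * h) ^ p - ((v - 1) * h) ^ p = d - b] (mod int p ^ 2)" by (intro cong_diff 3 4)
  moreover have "[a - c = d - b] (mod int p ^ 2)"
  proof -
    have "(a + b) - (c + d) = (a - c) - (d - b)" by simp
    then show ?thesis using sum by (metis cong_iff_dvd_diff)
  qed
  ultimately have "[(u * h) ^ p - ((u - 1) * h) ^ p = (v * h) ^ p - ((v - 1) * h) ^ p] (mod int p ^ 2)"
    by (metis cong_sym cong_trans)
  then have "[h ^ p * (u ^ p - (u - 1) ^ p) = h ^ p * (v ^ p - (v - 1) ^ p)] (mod int p ^ 2)"
    by (simp only: power_mult_distrib right_diff_distrib mult.commute[of _ "h ^ p"])
  moreover have "coprime (h ^ p) (int p ^ 2)" using not_dvd_coprime_square[OF p(1) h(1)] by simp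
  ultimately have "[u ^ p - (u - 1) ^ p = v ^ p - (v - 1) ^ p] (mod int p ^ 2)" using cong_mult_lcancel by blast
  moreover have "(u ^ p - (u - 1) ^ p) - (v ^ p - (v - 1) ^ p) = (u ^ p - (u - 1) ^ p - 1) - (v ^ p - (v - 1) ^ p - 1)"
    by simp
  ultimately have "int p ^ 2 dvd (u ^ p - (u - 1) ^ p - 1) - (v ^ p - (v - 1) ^ p - 1)"
    unfolding cong_iff_dvd_diff by metis
  then have "int p * int p dvd int p * (poly (fq_poly p) u - poly (fq_poly p) v)"
    unfolding poly_fq_poly[OF p, symmetric] by (simp add: power2_eq_square right_diff_distrib)
  then show ?thesis using p0 by (simp only: dvd_mult_cancel_left) simp
qed

text \<open>Quadruples with a = c are determined by (a, b). For the others put h = a - c = d - b, u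
  = a / h and v = d / h modulo p; then F(u) = F(v), so (u, v) lies in the square of a fibre. As
  elements of G are determined modulo p, the triple (h, u, v) recovers a, d and c, and the
  congruence recovers b.\<close>

lemma energy_le_fibre_moment:
  assumes p: "prime p" "odd p"
  shows "card (energy_quads p) \<le> p ^ 2 + p * (\<Sum>s\<in>{0..<int p}. card (fibre p s) ^ 2)"
proof -
  define E0 where "E0 = {((a, b), (c, d)) \<in> energy_quads p. a = c}"
  define E1 where "E1 = {((a, b), (c, d)) \<in> energy_quads p. a \<noteq> c}"
  have p0: "int p > 0" using prime_gt_0_nat[OF p(1)] by simp
  have fin: "finite E0" "finite E1"
    by (auto intro!: finite_subset[OF _ finite_energy_quads[of p]] simp: E0_def E1_def)
  have "energy_quads p = E0 \<union> E1" by (auto simp: E0_def E1_def)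
  then have "card (energy_quads p) \<le> card E0 + card E1" by (simp add: card_Un_le)
  moreover have "card E0 \<le> p ^ 2"
  proof -
    have "inj_on fst E0"
    proof (rule inj_onI)
      fix x y assume xy: "x \<in> E0" "y \<in> E0" "fst x = fst y"
      obtain a b d where x: "x = ((a, b), (a, d))" using xy(1) by (auto simp: E0_def)
      obtain d' where y: "y = ((a, b), (a, d'))" using xy x by (auto simp: E0_def)
      have "[a + b = a + d] (mod int p ^ 2)" "[a + b = a + d'] (mod int p ^ 2)" "d \<in> unit_roots p" "d' \<in> unit_roots p"
        using xy(1,2) unfolding x y by (auto simp: E0_def energy_quads_def)
      then have "[d = d'] (mod int p ^ 2)" by (metis cong_add_lcancel cong_sym cong_trans)
      then show "x = y" using unit_roots_cong_square_unique \<open>d \<in> _\<close> \<open>d' \<in> _\<close> x y by blast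
    qed
    moreover have "fst ` E0 \<subseteq> unit_roots p \<times> unit_roots p" by (auto simp: E0_def energy_quads_def)
    ultimately have "card E0 \<le> card (unit_roots p \<times> unit_roots p)" by (intro card_inj_on_le) auto
    also have "\<dots> \<le> p * p" unfolding card_cartesian_product card_unit_roots[OF p(1)] by (intro mult_le_mono) auto
    finally show ?thesis by (simp add: power2_eq_square)
  qed
  moreover have "card E1 \<le> p * (\<Sum>s\<in>{0..<int p}. card (fibre p s) ^ 2)"
  proof -
    have "\<exists>i. [h * i = 1] (mod int p)" if "\<not> int p dvd h" for h
      using that p(1) by (metis cong_solve_coprime_int coprime_commute prime_imp_coprime prime_nat_int_transfer)
    then obtain i where i: "\<And>h. \<not> int p dvd h \<Longrightarrow> [h * i h = 1] (mod int p)" by metis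
    define \<Phi> :: "(int \<times> int) \<times> (int \<times> int) \<Rightarrow> int \<times> int \<times> int"
      where "\<Phi> = (\<lambda>((a, b), (c, d)). let h = (a - c) mod int p in (h, (a * i h mod int p, d * i h mod int p)))"
    define W where "W = (\<Union>s\<in>{0..<int p}. fibre p s \<times> fibre p s)"
    have key: "\<not> int p dvd h \<and> [a - c = h] (mod int p) \<and> [u * h = a] (mod int p) \<and> [v * h = d] (mod int p)
        \<and> h \<in> {0..<int p} \<and> (u, v) \<in> W"
      if q: "((a, b), (c, d)) \<in> E1" and \<Phi>: "\<Phi> ((a, b), (c, d)) = (h, (u, v))" for a b c d h u v
    proof -
      have units: "a \<in> unit_roots p" "b \<in> unit_roots p" "c \<in> unit_roots p" "d \<in> unit_roots p"
        and sum: "[a + b = c + d] (mod int p ^ 2)" and ac: "a \<noteq> c"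
        using q by (auto simp: E1_def energy_quads_def)
      have h: "h = (a - c) mod int p" and uv: "u = a * i h mod int p" "v = d * i h mod int p"
        using \<Phi> by (auto simp: \<Phi>_def Let_def)
      have hac: "[a - c = h] (mod int p)" by (simp add: h cong_def)
      have nh: "\<not> int p dvd h"
      proof
        assume "int p dvd h"
        then have "int p dvd a - c" unfolding h by (simp add: dvd_mod_iff)
        then have "a = c" using unit_roots_cong_unique[OF p(1) units(1,3)] by (simp add: cong_iff_dvd_diff)
        then show False using ac by simp
      qed
      have cancel: "[x * i h mod int p * h = x] (mod int p)" for x
      proof -
        have "[x * i h mod int p * h = x * (h * i h)] (mod int p)" unfolding cong_def mod_mult_left_eq by (simp only: ac_simps)
        also have "[x * (h * i h) = x * 1] (mod int p)" by (intro cong_mult cong_refl i nh)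
        finally show ?thesis by simp
      qed
      have uh: "[u * h = a] (mod int p)" and vh: "[v * h = d] (mod int p)" using cancel uv by auto
      \<comment> \<open>The quotients 0 and 1 are ruled out because they would make p divide one of
        the four elements of G; this matches the exclusion of 0 and 1 from the fibres.\<close>
      have range: "x \<in> {2..<int p}" if x: "x \<in> {0..<int p}" "[x * h = g] (mod int p)"
        "g \<in> unit_roots p" "g' \<in> unit_roots p" "[g - g' = h] (mod int p)" for x g g'
      proof -
        have "x \<noteq> 0"
        proof
          assume "x = 0"
          then have "int p dvd g" using x(2) by (simp add: cong_iff_dvd_diff)
          then show False using unit_not_dvd[OF p(1) unit_rootsD(1)[OF x(3)]] by simp
        qed
        moreover have "x \<noteq> 1"
        proof
          assume "x = 1"
          then have "[g = g - g'] (mod int p)" using x(2,5) by (metis cong_sym cong_trans mult_1)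
          then have "int p dvd g'" by (simp add: cong_iff_dvd_diff)
          then show False using unit_not_dvd[OF p(1) unit_rootsD(1)[OF x(4)]] by simp
        qed
        ultimately show ?thesis using x(1) by simp
      qed
      have u: "u \<in> {2..<int p}" using range[OF _ uh units(1,3) hac] p0 by (simp add: uv)
      have "[d - b = h] (mod int p)"
      proof -
        have "(a + b) - (c + d) = (a - c) - (d - b)" by simp
        then have "[a - c = d - b] (mod int p)" using cong_modulus_power2D[OF sum] by (metis cong_iff_dvd_diff)
        then show ?thesis using hac by (metis cong_sym cong_trans)
      qed
      then have v: "v \<in> {2..<int p}" using range[OF _ vh units(4,2)] p0 by (simp add: uv)
      have F: "int p dvd poly (fq_poly p) u - poly (fq_poly p) v"
        by (rule fq_poly_cong_of_sum_eq[OF p units sum nh hac uh vh])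
      define s where "s = poly (fq_poly p) v mod int p"
      have s: "s \<in> {0..<int p}" using p0 by (simp add: s_def)
      have Fv: "int p dvd poly (fq_poly p) v - s" by (simp add: s_def)
      then have Fu: "int p dvd poly (fq_poly p) u - s" using dvd_add[OF F Fv] by simp
      have "(u, v) \<in> W" using u v s Fu Fv unfolding W_def fibre_def by blast
      then show ?thesis using nh hac uh vh p0 by (simp add: h)
    qed
    have "inj_on \<Phi> E1"
    proof (rule inj_onI)
      fix x y assume xy: "x \<in> E1" "y \<in> E1" "\<Phi> x = \<Phi> y"
      obtain a b c d where x: "x = ((a, b), (c, d))" by (metis prod.collapse)
      obtain a' b' c' d' where y: "y = ((a', b'), (c', d'))" by (metis prod.collapse)
      obtain h u v where \<Phi>: "\<Phi> x = (h, (u, v))" by (metis prod.collapse)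
      note kx = key[OF xy(1)[unfolded x] \<Phi>[unfolded x]]
      note ky = key[OF xy(2)[unfolded y] \<Phi>[unfolded xy(3) y]]
      have ux: "a \<in> unit_roots p" "b \<in> unit_roots p" "c \<in> unit_roots p" "d \<in> unit_roots p" "[a + b = c + d] (mod int p ^ 2)"
        using xy(1) unfolding x by (auto simp: E1_def energy_quads_def)
      have uy: "a' \<in> unit_roots p" "b' \<in> unit_roots p" "c' \<in> unit_roots p" "d' \<in> unit_roots p" "[a' + b' = c' + d'] (mod int p ^ 2)"
        using xy(2) unfolding y by (auto simp: E1_def energy_quads_def)
      have "[a = a'] (mod int p)" using kx ky by (metis cong_sym cong_trans)
      then have a: "a = a'" using unit_roots_cong_unique[OF p(1)] ux uy by blast
      have "[d = d'] (mod int p)" using kx ky by (metis cong_sym cong_trans)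
      then have d: "d = d'" using unit_roots_cong_unique[OF p(1)] ux uy by blast
      have "[a - c = a - c'] (mod int p)" using kx ky a by (metis cong_sym cong_trans)
      from cong_diff[OF cong_refl[of a] this] have "[c = c'] (mod int p)" by simp
      then have c: "c = c'" using unit_roots_cong_unique[OF p(1)] ux uy by blast
      have "[a + b = a + b'] (mod int p ^ 2)" using ux(5) uy(5) a c d by (metis cong_sym cong_trans)
      then have "[b = b'] (mod int p ^ 2)" by (simp add: cong_add_lcancel)
      then have "b = b'" using unit_roots_cong_square_unique ux uy by blast
      then show "x = y" using a c d x y by simp
    qed
    moreover have finW: "finite W" by (auto simp: W_def)
    moreover have "\<Phi> ` E1 \<subseteq> {0..<int p} \<times> W"
    proof
      fix y assume "y \<in> \<Phi> ` E1"
      then obtain a b c d where q: "((a, b), (c, d)) \<in> E1" "y = \<Phi> ((a, b), (c, d))" by (metis imageE prod.collapse)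
      obtain h u v where hy: "y = (h, (u, v))" by (metis prod.collapse)
      show "y \<in> {0..<int p} \<times> W" using key[OF q(1), of h u v] q(2) hy by (metis SigmaI)
    qed
    ultimately have "card E1 \<le> card ({0..<int p} \<times> W)" by (intro card_inj_on_le) auto
    also have "\<dots> = p * card W" by (simp add: card_cartesian_product)
    also have "card W \<le> (\<Sum>s\<in>{0..<int p}. card (fibre p s \<times> fibre p s))" unfolding W_def by (rule card_UN_le) simp
    also have "\<dots> = (\<Sum>s\<in>{0..<int p}. card (fibre p s) ^ 2)" by (simp add: card_cartesian_product power2_eq_square)
    finally show ?thesis by simp
  qed
  ultimately show ?thesis by linarith
qed

lemma energy_bound:
  assumes p: "prime p" "odd p" "512 \<le> p"
  shows "real (card (energy_quads p)) \<le> 2401 * real p ^ 2 * sqrt (real p)"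
proof -
  have "real (card (energy_quads p)) \<le> real (p ^ 2 + p * (\<Sum>s\<in>{0..<int p}. card (fibre p s) ^ 2))"
    using energy_le_fibre_moment[OF p(1,2)] of_nat_le_iff by blast
  also have "\<dots> = real p ^ 2 + real p * (\<Sum>s\<in>{0..<int p}. real (card (fibre p s)) ^ 2)" by simp
  also have "\<dots> \<le> real p ^ 2 * sqrt (real p) + real p * (2400 * real p * sqrt (real p))"
  proof (intro add_mono mult_left_mono fibre_second_moment p)
    show "real p ^ 2 \<le> real p ^ 2 * sqrt (real p)"
      using p(3) mult_left_mono[of 1 "sqrt (real p)" "real p ^ 2"] by simp
  qed simp
  also have "\<dots> = 2401 * real p ^ 2 * sqrt (real p)" by (simp add: power2_eq_square algebra_simps)
  finally show ?thesis .
qed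

section \<open>Exponential sums\<close>

definition add_char :: "nat \<Rightarrow> int \<Rightarrow> complex" where
  "add_char p t = cis (2 * pi * (real_of_int t / real p ^ 2))"

lemma add_char_add: "add_char p (s + t) = add_char p s * add_char p t"
  by (simp add: add_char_def cis_mult add_divide_distrib distrib_left)

lemma add_char_0 [simp]: "add_char p 0 = 1"
  by (simp add: add_char_def)

lemma cnj_add_char: "cnj (add_char p t) = add_char p (- t)"
  by (simp add: add_char_def cis_cnj)

lemma add_char_power: "add_char p t ^ n = add_char p (int n * t)"
  by (induction n) (simp_all add: add_char_add distrib_right)

lemma add_char_eq_1_iff:
  assumes "p > 0"
  shows "add_char p t = 1 \<longleftrightarrow> int p ^ 2 dvd t"
proof -
  have "add_char p t = 1 \<longleftrightarrow> (\<exists>n::int. 2 * pi * (real_of_int t / real p ^ 2) = 2 * n * pi)"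
    by (simp add: add_char_def cis_conv_exp exp_eq_1)
  also have "\<dots> \<longleftrightarrow> (\<exists>n::int. real_of_int t = real_of_int (int p ^ 2 * n))"
    using assms by (simp add: field_simps)
  also have "\<dots> \<longleftrightarrow> int p ^ 2 dvd t" by (auto simp only: of_int_eq_iff dvd_def)
  finally show ?thesis .
qed

lemma add_char_cong:
  assumes "p > 0" "[s = t] (mod int p ^ 2)"
  shows "add_char p s = add_char p t"
proof -
  have "add_char p (s - t) = 1" using assms by (simp add: add_char_eq_1_iff cong_iff_dvd_diff)
  then show ?thesis using add_char_add[of p "s - t" t] by simp
qed

lemma sum_add_char:
  assumes "p > 0"
  shows "(\<Sum>b<p ^ 2. add_char p (int b * t)) = (if int p ^ 2 dvd t then of_nat (p ^ 2) else 0)"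
proof (cases "int p ^ 2 dvd t")
  case True
  then have "add_char p (int b * t) = 1" for b by (simp add: add_char_eq_1_iff[OF assms])
  then show ?thesis using True by simp
next
  case False
  then have "add_char p t \<noteq> 1" by (simp add: add_char_eq_1_iff[OF assms])
  moreover have "add_char p t ^ (p ^ 2) = 1"
    by (simp add: add_char_power add_char_eq_1_iff[OF assms])
  ultimately have "(\<Sum>b<p ^ 2. add_char p t ^ b) = 0" by (simp add: geometric_sum)
  then show ?thesis using False by (simp add: add_char_power)
qed

definition exp_sum :: "nat \<Rightarrow> int \<Rightarrow> complex" where
  "exp_sum p a = (\<Sum>g\<in>unit_roots p. add_char p (a * g))"

lemma exp_sum_cong:
  assumes "p > 0" "[a = b] (mod int p ^ 2)"
  shows "exp_sum p a = exp_sum p b"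
  unfolding exp_sum_def by (intro sum.cong refl add_char_cong[OF assms(1)] cong_mult assms(2) cong_refl)

lemma exp_sum_0: "prime p \<Longrightarrow> exp_sum p 0 = of_nat (p - 1)"
  by (simp add: exp_sum_def card_unit_roots)

lemma norm_exp_sum_uminus: "norm (exp_sum p (- a)) = norm (exp_sum p a)"
proof -
  have "exp_sum p (- a) = cnj (exp_sum p a)" by (simp add: exp_sum_def cnj_add_char)
  then show ?thesis by simp
qed

lemma exp_sum_mult_unit:
  assumes "prime p" "g \<in> unit_roots p"
  shows "exp_sum p (a * g) = exp_sum p a"
proof -
  have p0: "p > 0" using prime_gt_0_nat[OF assms(1)] .
  have "exp_sum p a = (\<Sum>h\<in>unit_roots p. add_char p (a * (g * h mod int p ^ 2)))"
    unfolding exp_sum_def using sum.reindex_bij_betw[OF bij_betw_unit_roots_mult[OF assms]] by (rule sym)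
  also have "\<dots> = (\<Sum>h\<in>unit_roots p. add_char p (a * g * h))"
    by (intro sum.cong refl add_char_cong[OF p0]) (simp add: cong_def mod_mult_right_eq mult.assoc)
  finally show ?thesis by (simp add: exp_sum_def)
qed

text \<open>Orthogonality modulo p^2: two factors and two conjugates multiply to the character at (a
  + b) - (c + d).\<close>

lemma exp_sum_fourth_moment:
  assumes "p > 0"
  shows "(\<Sum>b<p ^ 2. norm (exp_sum p (int b)) ^ 4) = real p ^ 2 * real (card (energy_quads p))"
proof -
  let ?G = "unit_roots p"
  let ?X = "(?G \<times> ?G) \<times> (?G \<times> ?G)"
  define f :: "(int \<times> int) \<times> (int \<times> int) \<Rightarrow> int" where "f = (\<lambda>((a, b), (c, d)). (a + b) - (c + d))"
  have 4: "complex_of_real (norm (exp_sum p b) ^ 4) = (\<Sum>x\<in>?X. add_char p (b * f x))" for b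
  proof -
    have "complex_of_real (norm (exp_sum p b) ^ 4) = complex_of_real (norm (exp_sum p b) ^ 2) ^ 2"
      by (simp flip: power_mult)
    also have "\<dots> = (exp_sum p b * exp_sum p b) * (cnj (exp_sum p b) * cnj (exp_sum p b))"
      unfolding complex_norm_square by (simp add: power2_eq_square ac_simps)
    also have "\<dots> = (\<Sum>(x, y)\<in>?X. (add_char p (b * fst x) * add_char p (b * snd x)) * (add_char p (- (b * fst y)) * add_char p (- (b * snd y))))"
      by (simp add: exp_sum_def cnj_add_char sum_product sum.cartesian_product case_prod_beta)
    also have "\<dots> = (\<Sum>x\<in>?X. add_char p (b * f x))"
      by (intro sum.cong refl) (auto simp: f_def algebra_simps simp flip: add_char_add)
    finally show ?thesis .
  qed
  have "complex_of_real (\<Sum>b<p ^ 2. norm (exp_sum p (int b)) ^ 4) = (\<Sum>b<p ^ 2. \<Sum>x\<in>?X. add_char p (int b * f x))"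
    unfolding of_real_sum by (intro sum.cong refl 4)
  also have "\<dots> = (\<Sum>x\<in>?X. \<Sum>b<p ^ 2. add_char p (int b * f x))" by (rule sum.swap)
  also have "\<dots> = (\<Sum>x\<in>?X. if int p ^ 2 dvd f x then of_nat (p ^ 2) else 0)"
    by (intro sum.cong refl sum_add_char assms)
  also have "\<dots> = of_nat (p ^ 2) * of_nat (card {x \<in> ?X. int p ^ 2 dvd f x})"
    by (simp add: sum.If_cases Int_def mult.commute)
  also have "{x \<in> ?X. int p ^ 2 dvd f x} = energy_quads p"
    by (auto simp: energy_quads_def f_def cong_iff_dvd_diff)
  also have "of_nat (p ^ 2) * of_nat (card (energy_quads p)) = complex_of_real (real p ^ 2 * real (card (energy_quads p)))"
    by simp
  finally show ?thesis using of_real_eq_iff by blast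
qed

section \<open>Averaging exponential sums over cosets with small representatives\<close>

definition same_coset :: "nat \<Rightarrow> nat \<Rightarrow> nat \<Rightarrow> bool" where
  "same_coset p a b \<longleftrightarrow> (\<exists>g\<in>unit_roots p. [int a * g = int b] (mod int p ^ 2))"

lemma same_coset_refl: "prime p \<Longrightarrow> same_coset p a a"
proof -
  assume p: "prime p"
  have "1 mod int p ^ 2 \<in> unit_roots p" by (rule mod_in_unit_roots[OF p]) simp
  then show ?thesis unfolding same_coset_def by (intro bexI[of _ "1 mod int p ^ 2"]) (auto simp: cong_def mod_mult_right_eq)
qed

lemma same_coset_trans:
  assumes p: "prime p" and "same_coset p a b" "same_coset p b c"
  shows "same_coset p a c"
proof -
  from assms obtain g h where g: "g \<in> unit_roots p" "[int a * g = int b] (mod int p ^ 2)"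
    and h: "h \<in> unit_roots p" "[int b * h = int c] (mod int p ^ 2)" by (auto simp: same_coset_def)
  have "[int a * (g * h mod int p ^ 2) = int a * g * h] (mod int p ^ 2)"
    by (simp add: cong_def mod_mult_right_eq mult.assoc)
  also have "[int a * g * h = int b * h] (mod int p ^ 2)" by (intro cong_mult g cong_refl)
  also note h(2)
  finally show ?thesis unfolding same_coset_def
    using mod_in_unit_roots[OF p unit_pow_mult[OF unit_rootsD(1)[OF g(1)] unit_rootsD(1)[OF h(1)]]] by blast
qed

lemma same_coset_sym:
  assumes p: "prime p" and "same_coset p a b"
  shows "same_coset p b a"
proof -
  from assms obtain g where g: "g \<in> unit_roots p" "[int a * g = int b] (mod int p ^ 2)" by (auto simp: same_coset_def)
  have gg: "[g ^ (p - 1) = 1] (mod int p ^ 2)" using unit_rootsD(1)[OF g(1)] .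
  have "[(g ^ (p - 1)) ^ (p - 2) = 1 ^ (p - 2)] (mod int p ^ 2)" by (rule cong_pow[OF gg])
  then have "[(g ^ (p - 2)) ^ (p - 1) = 1] (mod int p ^ 2)" by (simp add: mult.commute flip: power_mult)
  then have mem: "g ^ (p - 2) mod int p ^ 2 \<in> unit_roots p" by (rule mod_in_unit_roots[OF p])
  have pp: "Suc (p - 2) = p - 1" using prime_ge_2_nat[OF p] by simp
  have "[int b * (g ^ (p - 2) mod int p ^ 2) = int b * g ^ (p - 2)] (mod int p ^ 2)"
    by (simp add: cong_def mod_mult_right_eq)
  also have "[int b * g ^ (p - 2) = int a * g * g ^ (p - 2)] (mod int p ^ 2)"
    by (intro cong_mult cong_refl cong_sym[OF g(2)])
  also have "int a * g * g ^ (p - 2) = int a * g ^ (p - 1)" by (simp only: mult.assoc flip: pp power_Suc)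
  also have "[int a * g ^ (p - 1) = int a * 1] (mod int p ^ 2)" by (intro cong_mult cong_refl gg)
  finally show ?thesis unfolding same_coset_def using mem by auto
qed

definition coset_pairs :: "nat \<Rightarrow> nat \<Rightarrow> (nat \<times> nat) set" where
  "coset_pairs p Q = {(a, b). a \<in> {1..<Q} \<and> b \<in> {1..<Q} \<and> same_coset p a b}"

text \<open>The sum is constant on each coset a G, so each a is spread over its p - 1 residues a g.
  A given residue arises from at most one g for each a in its coset (a < p is invertible), hence
  from at most m(a) pairs. The weights 1 / m(a) bring its total weight below 1, and the complete
  fourth moment dominates.\<close>

lemma exp_sum_L4_coset_average:
  assumes p: "prime p" and Q: "Q \<le> p"
  defines "m \<equiv> \<lambda>a. card {b \<in> {1..<Q}. same_coset p a b}"
  shows "real (p - 1) * (\<Sum>a\<in>{1..<Q}. norm (exp_sum p (int a)) ^ 4 / real (m a))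
      \<le> real p ^ 2 * real (card (energy_quads p))"
proof -
  have p0: "p > 0" using prime_gt_0_nat[OF p] .
  define f where "f = (\<lambda>b. norm (exp_sum p (int b)) ^ 4)"
  define X where "X = {1..<Q} \<times> unit_roots p"
  define \<phi> where "\<phi> = (\<lambda>(a :: nat, g). nat (int a * g mod int p ^ 2))"
  have \<phi>: "int (\<phi> (a, g)) = int a * g mod int p ^ 2" for a g
    using p0 by (simp add: \<phi>_def)
  have f\<phi>: "f (\<phi> (a, g)) = f a" if "g \<in> unit_roots p" for a g
  proof -
    have "exp_sum p (int (\<phi> (a, g))) = exp_sum p (int a * g)"
      unfolding \<phi> by (rule exp_sum_cong[OF p0]) (simp add: cong_def)
    then show ?thesis using exp_sum_mult_unit[OF p that] by (simp add: f_def)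
  qed
  have "real (p - 1) * (\<Sum>a\<in>{1..<Q}. f a / real (m a)) = (\<Sum>a\<in>{1..<Q}. \<Sum>g\<in>unit_roots p. f a / real (m a))"
    by (simp add: card_unit_roots[OF p] sum_distrib_left)
  also have "\<dots> = (\<Sum>x\<in>X. f (\<phi> x) / real (m (fst x)))"
    unfolding X_def sum.cartesian_product by (intro sum.cong refl) (auto simp: f\<phi>)
  also have "\<dots> = (\<Sum>b<p ^ 2. \<Sum>x\<in>{x \<in> X. \<phi> x = b}. f (\<phi> x) / real (m (fst x)))"
  proof (rule sum.group[symmetric])
    have "\<phi> (a, g) < p ^ 2" for a g
    proof -
      have "int (\<phi> (a, g)) < int (p ^ 2)" unfolding \<phi> using p0 by simp
      then show ?thesis by linarith
    qed
    then show "\<phi> ` X \<subseteq> {..<p ^ 2}" by auto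
  qed (auto simp: X_def)
  also have "\<dots> \<le> (\<Sum>b<p ^ 2. f b)"
  proof (rule sum_mono)
    fix b assume "b \<in> {..<p ^ 2}"
    define Y where "Y = {x \<in> X. \<phi> x = b}"
    have finY: "finite Y" unfolding Y_def X_def by auto
    have coset: "same_coset p a b" if "(a, g) \<in> Y" for a g
    proof -
      have "int b = int a * g mod int p ^ 2" "g \<in> unit_roots p" using that \<phi>[of a g] by (auto simp: Y_def X_def)
      then show ?thesis by (auto simp: same_coset_def cong_def)
    qed
    have "(\<Sum>x\<in>Y. 1 / real (m (fst x))) \<le> 1"
    proof (cases "Y = {}")
      case False
      then obtain a\<^sub>0 g\<^sub>0 where a0: "(a\<^sub>0, g\<^sub>0) \<in> Y" by auto
      have eqv: "same_coset p a\<^sub>0 a" if "(a, g) \<in> Y" for a g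
        using same_coset_trans[OF p coset[OF a0] same_coset_sym[OF p coset[OF that]]] .
      have m: "m (fst x) = m a\<^sub>0" if "x \<in> Y" for x
      proof -
        obtain a g where x: "x = (a, g)" by fastforce
        have "same_coset p a c \<longleftrightarrow> same_coset p a\<^sub>0 c" for c
          using eqv[of a g] that x same_coset_trans[OF p] same_coset_sym[OF p] by blast
        then show ?thesis by (simp add: m_def x)
      qed
      have "inj_on fst Y"
      proof (rule inj_onI)
        fix x y assume xy: "x \<in> Y" "y \<in> Y" "fst x = fst y"
        obtain a g where x: "x = (a, g)" by fastforce
        obtain h where y: "y = (a, h)" using xy(3) x by (cases y) auto
        have mem: "a \<in> {1..<Q}" "g \<in> unit_roots p" "h \<in> unit_roots p" using xy(1,2) x y by (auto simp: Y_def X_def)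
        have "int a * g mod int p ^ 2 = int a * h mod int p ^ 2"
          using xy(1,2) x y \<phi>[of a g] \<phi>[of a h] by (simp add: Y_def)
        then have "[int a * g = int a * h] (mod int p ^ 2)" by (simp add: cong_def)
        moreover have "\<not> int p dvd int a" using mem(1) Q by (auto simp: int_dvd_int_iff dest: dvd_imp_le)
        then have "coprime (int a) (int p ^ 2)" by (rule not_dvd_coprime_square[OF p])
        ultimately have "[g = h] (mod int p ^ 2)" using cong_mult_lcancel by blast
        then show "x = y" using unit_roots_cong_square_unique mem x y by blast
      qed
      then have "card Y = card (fst ` Y)" by (simp add: card_image)
      also have "\<dots> \<le> card {b \<in> {1..<Q}. same_coset p a\<^sub>0 b}"
        by (rule card_mono) (auto simp: Y_def X_def intro: eqv[unfolded Y_def X_def])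
      finally have "card Y \<le> m a\<^sub>0" by (simp add: m_def)
      moreover have "m a\<^sub>0 > 0" using \<open>card Y \<le> m a\<^sub>0\<close> False finY by (metis card_gt_0_iff less_le_trans)
      moreover have "(\<Sum>x\<in>Y. 1 / real (m (fst x))) = real (card Y) / real (m a\<^sub>0)" using m by simp
      ultimately show ?thesis by simp
    qed simp
    then have "f b * (\<Sum>x\<in>Y. 1 / real (m (fst x))) \<le> f b * 1" by (intro mult_left_mono) (auto simp: f_def)
    then show "(\<Sum>x\<in>{x \<in> X. \<phi> x = b}. f (\<phi> x) / real (m (fst x))) \<le> f b"
      by (simp add: Y_def sum_distrib_left)
  qed
  also have "\<dots> = real p ^ 2 * real (card (energy_quads p))"
    unfolding f_def using exp_sum_fourth_moment[OF p0] by simp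
  finally show ?thesis by (simp add: f_def)
qed

text \<open>
  Two applications of Cauchy--Schwarz, weighting each \<open>a\<close> by the fourth root of the number of
  elements of its coset in the range.
\<close>

lemma exp_sum_average:
  assumes p: "prime p" and Q: "Q \<le> p"
  shows "real (p - 1) * (\<Sum>a\<in>{1..<Q}. norm (exp_sum p (int a))) ^ 4
      \<le> real Q ^ 2 * real (card (coset_pairs p Q)) * (real p ^ 2 * real (card (energy_quads p)))"
proof -
  define I where "I = {1..<Q}"
  define m where "m = (\<lambda>a. card {b \<in> {1..<Q}. same_coset p a b})"
  define s where "s = (\<lambda>a. norm (exp_sum p (int a)))"
  have mpos: "real (m a) > 0" if "a \<in> I" for a
    using same_coset_refl[OF p, of a] that by (auto simp: m_def I_def card_gt_0_iff)
  define w where "w = (\<lambda>a. sqrt (sqrt (real (m a))))"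
  have wpos: "w a > 0" if "a \<in> I" for a using mpos[OF that] by (simp add: w_def)
  have w4: "w a ^ 4 = real (m a)" for a
  proof -
    have "w a ^ 4 = (w a ^ 2) ^ 2" by (simp flip: power_mult)
    then show ?thesis by (simp add: w_def)
  qed
  have cQ: "real (card I) \<le> real Q" by (simp add: I_def)
  have cs: "(\<Sum>a\<in>I. x a) ^ 2 \<le> real Q * (\<Sum>a\<in>I. x a ^ 2)" for x :: "nat \<Rightarrow> real"
  proof -
    have "(\<Sum>a\<in>I. 1 * x a) ^ 2 \<le> (\<Sum>a\<in>I. 1 ^ 2) * (\<Sum>a\<in>I. x a ^ 2)" by (rule Cauchy_Schwarz_ineq_sum)
    also have "\<dots> \<le> real Q * (\<Sum>a\<in>I. x a ^ 2)" using cQ by (intro mult_right_mono sum_nonneg) auto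
    finally show ?thesis by simp
  qed
  have "(\<Sum>a\<in>I. s a) ^ 4 = ((\<Sum>a\<in>I. w a * (s a / w a)) ^ 2) ^ 2"
  proof -
    have "w a * (s a / w a) = s a" if "a \<in> I" for a using wpos[OF that] by simp
    then have "(\<Sum>a\<in>I. s a) = (\<Sum>a\<in>I. w a * (s a / w a))" by simp
    then show ?thesis by (simp flip: power_mult)
  qed
  also have "\<dots> \<le> ((\<Sum>a\<in>I. w a ^ 2) * (\<Sum>a\<in>I. (s a / w a) ^ 2)) ^ 2"
    by (intro power_mono Cauchy_Schwarz_ineq_sum) auto
  also have "\<dots> = (\<Sum>a\<in>I. w a ^ 2) ^ 2 * (\<Sum>a\<in>I. (s a / w a) ^ 2) ^ 2" by (simp add: power_mult_distrib)
  also have "\<dots> \<le> (real Q * (\<Sum>a\<in>I. (w a ^ 2) ^ 2)) * (real Q * (\<Sum>a\<in>I. ((s a / w a) ^ 2) ^ 2))"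
    by (intro mult_mono cs) (auto intro!: mult_nonneg_nonneg sum_nonneg)
  also have "\<dots> = real Q ^ 2 * (\<Sum>a\<in>I. real (m a)) * (\<Sum>a\<in>I. s a ^ 4 / real (m a))"
    by (simp add: power_divide w4 power2_eq_square[of "real Q"] flip: power_mult)
  also have "(\<Sum>a\<in>I. real (m a)) = real (card (coset_pairs p Q))"
  proof -
    have "coset_pairs p Q = (SIGMA a:I. {b \<in> {1..<Q}. same_coset p a b})" by (auto simp: coset_pairs_def I_def)
    then show ?thesis by (simp add: m_def I_def)
  qed
  finally have "real (p - 1) * (\<Sum>a\<in>I. s a) ^ 4
      \<le> real Q ^ 2 * real (card (coset_pairs p Q)) * (real (p - 1) * (\<Sum>a\<in>I. s a ^ 4 / real (m a)))"
    by (simp add: mult_left_mono mult.left_commute)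
  also have "\<dots> \<le> real Q ^ 2 * real (card (coset_pairs p Q)) * (real p ^ 2 * real (card (energy_quads p)))"
    using exp_sum_L4_coset_average[OF p Q] by (intro mult_left_mono) (auto simp: I_def s_def m_def)
  finally show ?thesis by (simp add: I_def s_def)
qed

section \<open>From exponential sums to elements of G in an interval\<close>

definition small_units :: "nat \<Rightarrow> nat \<Rightarrow> nat set" where
  "small_units p H = {n \<in> {1..H}. [int n ^ (p - 1) = 1] (mod int p ^ 2)}"

lemma sum_norm_exp_sum_differences:
  "(\<Sum>a<Q. \<Sum>b<Q. norm (exp_sum p (int a - int b))) \<le> real Q * (norm (exp_sum p 0) + 2 * (\<Sum>d\<in>{1..<Q}. norm (exp_sum p (int d))))"
proof -
  define s where "s = (\<lambda>d. norm (exp_sum p d))"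
  have "(\<Sum>b<Q. s (int a - int b)) \<le> s 0 + 2 * (\<Sum>d\<in>{1..<Q}. s (int d))" if "a < Q" for a
  proof -
    have split: "{..<Q} = {..<a} \<union> {a} \<union> {Suc a..<Q}" using that by auto
    have "(\<Sum>b<Q. s (int a - int b)) = (\<Sum>b<a. s (int a - int b)) + s 0 + (\<Sum>b\<in>{Suc a..<Q}. s (int a - int b))"
    proof -
      have "(\<Sum>b<Q. s (int a - int b)) = (\<Sum>b\<in>{..<a} \<union> {a}. s (int a - int b)) + (\<Sum>b\<in>{Suc a..<Q}. s (int a - int b))"
        unfolding split by (rule sum.union_disjoint) auto
      moreover have "(\<Sum>b\<in>{..<a} \<union> {a}. s (int a - int b)) = (\<Sum>b<a. s (int a - int b)) + (\<Sum>b\<in>{a}. s (int a - int b))"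
        by (rule sum.union_disjoint) auto
      ultimately show ?thesis by simp
    qed
    moreover have "(\<Sum>b<a. s (int a - int b)) \<le> (\<Sum>d\<in>{1..<Q}. s (int d))"
    proof -
      have "(\<Sum>b<a. s (int a - int b)) = (\<Sum>d\<in>(\<lambda>b. a - b) ` {..<a}. s (int d))"
        by (subst sum.reindex) (auto simp: inj_on_def of_nat_diff)
      also have "\<dots> \<le> (\<Sum>d\<in>{1..<Q}. s (int d))" using that by (intro sum_mono2) (auto simp: s_def)
      finally show ?thesis .
    qed
    moreover have "(\<Sum>b\<in>{Suc a..<Q}. s (int a - int b)) \<le> (\<Sum>d\<in>{1..<Q}. s (int d))"
    proof -
      have "(\<Sum>b\<in>{Suc a..<Q}. s (int a - int b)) = (\<Sum>b\<in>{Suc a..<Q}. s (int (b - a)))"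
        using norm_exp_sum_uminus[of p] by (intro sum.cong refl) (metis s_def minus_diff_eq of_nat_diff atLeastLessThan_iff Suc_leD)
      also have "\<dots> = (\<Sum>d\<in>(\<lambda>b. b - a) ` {Suc a..<Q}. s (int d))"
        by (subst sum.reindex) (auto simp: inj_on_def)
      also have "\<dots> \<le> (\<Sum>d\<in>{1..<Q}. s (int d))" by (intro sum_mono2) (auto simp: s_def)
      finally show ?thesis .
    qed
    ultimately show ?thesis by linarith
  qed
  then have "(\<Sum>a<Q. \<Sum>b<Q. s (int a - int b)) \<le> (\<Sum>a<Q. s 0 + 2 * (\<Sum>d\<in>{1..<Q}. s (int d)))" by (intro sum_mono) auto
  then show ?thesis by (simp add: s_def)
qed

text \<open>
  The Fejer kernel \<open>\<bar>\<Sum>a<Q. e(a g / p^2)\<bar>^2\<close> is nonnegative on \<open>G\<close> and at least \<open>Q^2/4\<close> at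
  the elements of \<open>[1, H]\<close>.
\<close>

lemma card_small_units_le:
  assumes p: "prime p" and HQ: "6 * H * Q \<le> p ^ 2" and Q: "Q > 0"
  shows "real Q * real (card (small_units p H)) \<le> 4 * (real p + 2 * (\<Sum>d\<in>{1..<Q}. norm (exp_sum p (int d))))"
proof -
  define D where "D = (\<lambda>g. \<Sum>a<Q. add_char p (int a * g))"
  have p0: "real p > 0" using prime_gt_0_nat[OF p] by simp
  have Hp: "H < p ^ 2"
  proof (cases "H = 0")
    case True then show ?thesis using prime_gt_0_nat[OF p] by simp
  next
    case False
    have "1 * H < (6 * Q) * H" using Q False by (intro mult_strict_right_mono) auto
    also have "\<dots> \<le> p ^ 2" using HQ by (simp add: ac_simps)
    finally show ?thesis by simp
  qed
  have big: "norm (D (int n)) ^ 2 \<ge> real Q ^ 2 / 4" if n: "n \<in> small_units p H" for n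
  proof -
    have "Re (add_char p (int a * int n)) \<ge> 1 / 2" if a: "a < Q" for a
    proof -
      have "6 * (a * n) \<le> p ^ 2"
      proof -
        have "6 * (a * n) \<le> 6 * (Q * H)" using a n by (intro mult_le_mono) (auto simp: small_units_def)
        then show ?thesis using HQ by (simp add: ac_simps)
      qed
      then have "6 * (real a * real n) \<le> real p ^ 2"
        by (metis of_nat_le_iff of_nat_mult of_nat_numeral of_nat_power)
      then have le: "real a * real n / real p ^ 2 \<le> 1 / 6" using p0 by (simp add: field_simps)
      \<comment> \<open>The condition 6 H Q \<le> p^2 keeps every angle in [0, pi/3], where the
        cosine is at least 1/2; this accounts for the factor 4 in the result.\<close>
      define \<theta> where "\<theta> = 2 * pi * (real a * real n / real p ^ 2)"
      have "\<theta> \<le> 2 * pi * (1 / 6)" unfolding \<theta>_def using le by (intro mult_left_mono) auto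
      then have "\<theta> \<le> pi / 3" by simp
      moreover have "\<theta> \<ge> 0" unfolding \<theta>_def by simp
      ultimately have "cos (pi / 3) \<le> cos \<theta>" by (intro cos_monotone_0_pi_le) auto
      then show ?thesis by (simp add: add_char_def \<theta>_def cos_60)
    qed
    then have "(\<Sum>a<Q. 1 / 2) \<le> (\<Sum>a<Q. Re (add_char p (int a * int n)))" by (intro sum_mono) auto
    then have "real Q / 2 \<le> Re (D (int n))" by (simp add: D_def)
    also have "\<dots> \<le> norm (D (int n))" by (rule complex_Re_le_cmod)
    finally have "(real Q / 2) ^ 2 \<le> norm (D (int n)) ^ 2" by (intro power_mono) auto
    then show ?thesis by (simp add: power_divide)
  qed
  have sub: "int ` small_units p H \<subseteq> unit_roots p"
  proof safe
    fix n assume n: "n \<in> small_units p H"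
    then have "n < p ^ 2" using Hp by (auto simp: small_units_def)
    then have "int n < int p ^ 2" by (metis of_nat_less_iff of_nat_power)
    then show "int n \<in> unit_roots p" using n by (simp add: small_units_def unit_roots_def)
  qed
  have "real (card (small_units p H)) * (real Q ^ 2 / 4) = (\<Sum>n\<in>small_units p H. real Q ^ 2 / 4)" by simp
  also have "\<dots> \<le> (\<Sum>n\<in>small_units p H. norm (D (int n)) ^ 2)" by (intro sum_mono big)
  also have "\<dots> = (\<Sum>g\<in>int ` small_units p H. norm (D g) ^ 2)" by (subst sum.reindex) auto
  also have "\<dots> \<le> (\<Sum>g\<in>unit_roots p. norm (D g) ^ 2)" by (intro sum_mono2 sub) auto
  also have "\<dots> \<le> (\<Sum>a<Q. \<Sum>b<Q. norm (exp_sum p (int a - int b)))"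
  proof -
    have "complex_of_real (\<Sum>g\<in>unit_roots p. norm (D g) ^ 2) = (\<Sum>g\<in>unit_roots p. D g * cnj (D g))"
      unfolding of_real_sum complex_norm_square ..
    also have "\<dots> = (\<Sum>g\<in>unit_roots p. \<Sum>a<Q. \<Sum>b<Q. add_char p ((int a - int b) * g))"
    proof -
      have "add_char p ((int a - int b) * g) = add_char p (int a * g) * add_char p (- (int b * g))" for a b g
        by (simp add: left_diff_distrib flip: add_char_add)
      then show ?thesis by (simp add: D_def sum_product cnj_add_char)
    qed
    also have "\<dots> = (\<Sum>a<Q. \<Sum>g\<in>unit_roots p. \<Sum>b<Q. add_char p ((int a - int b) * g))" by (rule sum.swap)
    also have "\<dots> = (\<Sum>a<Q. \<Sum>b<Q. exp_sum p (int a - int b))"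
      unfolding exp_sum_def by (intro sum.cong refl sum.swap)
    finally have "norm (complex_of_real (\<Sum>g\<in>unit_roots p. norm (D g) ^ 2)) = norm (\<Sum>a<Q. \<Sum>b<Q. exp_sum p (int a - int b))"
      by (rule arg_cong)
    then have "(\<Sum>g\<in>unit_roots p. norm (D g) ^ 2) = norm (\<Sum>a<Q. \<Sum>b<Q. exp_sum p (int a - int b))"
      unfolding norm_of_real by (simp add: sum_nonneg)
    also have "\<dots> \<le> (\<Sum>a<Q. \<Sum>b<Q. norm (exp_sum p (int a - int b)))"
      by (intro order_trans[OF norm_sum] sum_mono norm_sum)
    finally show ?thesis .
  qed
  also have "\<dots> \<le> real Q * (norm (exp_sum p 0) + 2 * (\<Sum>d\<in>{1..<Q}. norm (exp_sum p (int d))))"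
    by (rule sum_norm_exp_sum_differences)
  also have "\<dots> \<le> real Q * (real p + 2 * (\<Sum>d\<in>{1..<Q}. norm (exp_sum p (int d))))"
    using exp_sum_0[OF p] by (intro mult_left_mono) auto
  finally have "real Q * (real Q * real (card (small_units p H))) \<le> real Q * (4 * (real p + 2 * (\<Sum>d\<in>{1..<Q}. norm (exp_sum p (int d)))))"
    by (simp add: power2_eq_square algebra_simps)
  then show ?thesis using Q by simp
qed

section \<open>Divisors and reduced fractions\<close>

abbreviation num_divisors :: "nat \<Rightarrow> nat" where
  "num_divisors n \<equiv> card {d. d dvd n}"

lemma num_divisors_prime_power_mult:
  fixes q m :: nat
  assumes "prime q" "m > 0"
  shows "num_divisors (q ^ e * m) \<le> Suc e * num_divisors m"
proof -
  have "{d. d dvd q ^ e * m} \<subseteq> (\<lambda>(i, d). q ^ i * d) ` ({..e} \<times> {d. d dvd m})"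
  proof
    fix d assume "d \<in> {d. d dvd q ^ e * m}"
    then obtain b c where bc: "d = b * c" "b dvd q ^ e" "c dvd m" using division_decomp[of d "q ^ e" m] by auto
    obtain i where "i \<le> e" "b = q ^ i" using bc(2) assms(1) divides_primepow_nat by blast
    then show "d \<in> (\<lambda>(i, d). q ^ i * d) ` ({..e} \<times> {d. d dvd m})" using bc by auto
  qed
  then have "num_divisors (q ^ e * m) \<le> card ((\<lambda>(i, d). q ^ i * d) ` ({..e} \<times> {d. d dvd m}))"
    using assms by (intro card_mono) auto
  also have "\<dots> \<le> card ({..e} \<times> {d. d dvd m})" using assms by (intro card_image_le) auto
  finally show ?thesis by (simp add: card_cartesian_product)
qed

text \<open>One prime power is split off at a time. For q \<ge> 2^(1/\<epsilon>) it costs nothing,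
  as e + 1 \<le> 2^e \<le> q^(e \<epsilon>); each of the finitely many smaller primes costs a factor
  c.\<close>

lemma num_divisors_bound:
  assumes \<epsilon>: "\<epsilon> > 0"
  shows "\<exists>C\<ge>1. \<forall>n>0. real (num_divisors n) \<le> C * real n powr \<epsilon>"
proof -
  define K where "K = nat \<lceil>2 powr (1 / \<epsilon>)\<rceil>"
  \<comment> \<open>Small primes satisfy q^(e \<epsilon>) \<ge> 1 + e \<epsilon> ln 2, so c has to
    dominate both 1 and 1 / (\<epsilon> ln 2).\<close>
  define c where "c = max 1 (1 / (\<epsilon> * ln 2))"
  have c1: "c \<ge> 1" by (simp add: c_def)
  have local_bound: "real (Suc e) \<le> (if q < K then c else 1) * real (q ^ e) powr \<epsilon>" if q: "prime q" for q e :: nat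
  proof (cases "q < K")
    case True
    have q2: "real q \<ge> 2" using prime_ge_2_nat[OF q] by simp
    have "1 + real e * (\<epsilon> * ln 2) \<le> exp (real e * (\<epsilon> * ln 2))" by (rule exp_ge_add_one_self)
    also have "\<dots> \<le> exp (real e * (\<epsilon> * ln (real q)))" using q2 \<epsilon> by (simp add: mult_left_mono)
    also have "\<dots> = real (q ^ e) powr \<epsilon>" using q2 by (simp add: powr_def ln_realpow mult_ac)
    finally have 1: "1 + real e * (\<epsilon> * ln 2) \<le> real (q ^ e) powr \<epsilon>" .
    have "1 / (\<epsilon> * ln 2) \<le> c" by (simp add: c_def)
    then have "1 \<le> c * (\<epsilon> * ln 2)" using \<epsilon> by (simp add: field_simps)
    then have "real e * 1 \<le> real e * (c * (\<epsilon> * ln 2))" by (intro mult_left_mono) auto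
    then have "real (Suc e) \<le> c * (1 + real e * (\<epsilon> * ln 2))" using c1 by (simp add: algebra_simps)
    also have "\<dots> \<le> c * real (q ^ e) powr \<epsilon>" using 1 c1 by (intro mult_left_mono) auto
    finally show ?thesis using True by simp
  next
    case False
    then have "2 powr (1 / \<epsilon>) \<le> real q" unfolding K_def by linarith
    then have "(2 powr (1 / \<epsilon>)) powr \<epsilon> \<le> real q powr \<epsilon>" using \<epsilon> by (intro powr_mono2) auto
    then have "2 \<le> real q powr \<epsilon>" using \<epsilon> by (simp add: powr_powr)
    then have "2 ^ e \<le> (real q powr \<epsilon>) ^ e" by (intro power_mono) auto
    also have "\<dots> = real (q ^ e) powr \<epsilon>" by (induction e) (simp_all add: powr_mult)
    finally have "2 ^ e \<le> real (q ^ e) powr \<epsilon>" .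
    moreover have "real (Suc e) \<le> 2 ^ e"
      by (metis Suc_leI less_exp of_nat_le_iff of_nat_numeral of_nat_power)
    ultimately show ?thesis using False by simp
  qed
  have "real (num_divisors n) \<le> c ^ card (prime_factors n \<inter> {..<K}) * real n powr \<epsilon>" if "n > 0" for n
    using that
  proof (induction n rule: less_induct)
    case (less n)
    show ?case
    proof (cases "n = 1")
      case True
      have "{d. d dvd (1 :: nat)} = {1}" by auto
      then show ?thesis using True by simp
    next
      case False
      then obtain q where q: "prime q" "q dvd n" using prime_factor_nat by blast
      define e where "e = multiplicity q n"
      have "n \<noteq> 0" "\<not> is_unit q" using less.prems q by auto
      then obtain m where m: "n = q ^ e * m" "\<not> q dvd m" unfolding e_def by (rule multiplicity_decompose')
      have m0: "m > 0" using m less.prems by (cases m) auto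
      have e0: "e > 0" using q less.prems unfolding e_def by (metis multiplicity_gt_zero_iff \<open>\<not> is_unit q\<close> not_gr0 less_irrefl)
      have "q ^ e > 1" using e0 prime_gt_1_nat[OF q(1)] by (rule one_less_power[rotated])
      then have "m < n" using m m0 by simp
      have "prime_factors n = prime_factors (q ^ e) \<union> prime_factors m"
        using m m0 prime_gt_0_nat[OF q(1)] by (simp add: prime_factors_product)
      then have pf: "prime_factors n = insert q (prime_factors m)" using e0 q by (simp add: prime_factorization_prime_power)
      have qm: "q \<notin> prime_factors m" using m(2) by auto
      have "real (num_divisors n) \<le> real (Suc e) * real (num_divisors m)"
        unfolding m(1) using num_divisors_prime_power_mult[OF q(1) m0] of_nat_le_iff of_nat_mult by metis
      also have "\<dots> \<le> ((if q < K then c else 1) * real (q ^ e) powr \<epsilon>) * (c ^ card (prime_factors m \<inter> {..<K}) * real m powr \<epsilon>)"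
        using local_bound[OF q(1)] less.IH[OF \<open>m < n\<close> m0] by (intro mult_mono) (use c1 in auto)
      also have "\<dots> = ((if q < K then c else 1) * c ^ card (prime_factors m \<inter> {..<K})) * real n powr \<epsilon>"
        unfolding m(1) by (simp add: powr_mult)
      also have "(if q < K then c else 1) * c ^ card (prime_factors m \<inter> {..<K}) = c ^ card (prime_factors n \<inter> {..<K})"
        unfolding pf using qm by auto
      finally show ?thesis .
    qed
  qed
  moreover have "c ^ card (prime_factors n \<inter> {..<K}) \<le> c ^ K" for n :: nat
  proof -
    have "card (prime_factors n \<inter> {..<K}) \<le> card {..<K}" by (intro card_mono) auto
    then show ?thesis using c1 by (intro power_increasing) auto
  qed
  ultimately have "real (num_divisors n) \<le> c ^ K * real n powr \<epsilon>" if "n > 0" for n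
    using that mult_right_mono[OF _ powr_ge_zero] order_trans by blast
  then show ?thesis using c1 by (intro exI[of _ "c ^ K"]) simp
qed

text \<open>Sets of prime factors correspond to distinct squarefree divisors. In this way the
  divisor bound also controls the loss in \<open>separating_prime_set\<close>.\<close>

lemma two_power_card_prime_factors_le:
  assumes "n > 0"
  shows "2 ^ card (prime_factors n) \<le> num_divisors (n :: nat)"
proof -
  have fin: "finite S" if "S \<subseteq> prime_factors n" for S using that finite_subset by blast
  have pf: "prime_factors (\<Prod>S) = S" if "S \<subseteq> prime_factors n" for S
  proof -
    have primes: "\<And>q. q \<in> S \<Longrightarrow> prime q" using that by (auto dest: in_prime_factors_imp_prime)
    moreover have "0 \<notin> S" using primes not_prime_0 by blast
    ultimately have "prime_factors (\<Prod>S) = (\<Union>q\<in>S. prime_factors q)"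
      using prime_factors_prod[OF fin[OF that], of id] by (auto simp: o_def)
    also have "\<dots> = S" using primes by (simp add: prime_factorization_prime)
    finally show ?thesis .
  qed
  have "inj_on Prod (Pow (prime_factors n))" using pf by (metis PowD inj_onI)
  then have "2 ^ card (prime_factors n) = card (Prod ` Pow (prime_factors n))" by (simp add: card_image card_Pow)
  also have "\<dots> \<le> num_divisors n"
  proof (rule card_mono)
    have "\<Prod>S dvd n" if S: "S \<subseteq> prime_factors n" for S
    proof -
      have "\<Prod>S dvd \<Prod>(prime_factors n)" using S by (intro prod_dvd_prod_subset) auto
      also have "\<dots> dvd (\<Prod>q\<in>prime_factors n. q ^ multiplicity q n)"
        by (intro prod_dvd_prod) (auto simp: prime_factors_multiplicity dvd_power)
      also have "\<dots> = n" using prime_factorization_nat[OF assms] by simp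
      finally show ?thesis .
    qed
    then show "Prod ` Pow (prime_factors n) \<subseteq> {d. d dvd n}" by auto
  qed (use assms in simp)
  finally show ?thesis .
qed

text \<open>The numbers gcd(w, n) are pairwise coprime divisors of n, each at least 2, so their
  product divides n.\<close>

lemma two_power_card_noncoprime_le:
  fixes n :: nat
  assumes "finite B" "n > 0" and "\<And>v w. v \<in> B \<Longrightarrow> w \<in> B \<Longrightarrow> v \<noteq> w \<Longrightarrow> coprime v w"
    and "\<And>w. w \<in> B \<Longrightarrow> \<not> coprime w n"
  shows "2 ^ card B \<le> n"
proof -
  have "(\<Prod>w\<in>B. gcd w n) dvd n"
    using assms(1,3)
  proof (induction B)
    case (insert x B)
    have "coprime (gcd x n) (gcd w n)" if "w \<in> B" for w
    proof (rule coprime_divisors)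
      show "coprime x w" using insert.hyps insert.prems that by auto
    qed auto
    then have "coprime (gcd x n) (\<Prod>w\<in>B. gcd w n)" by (intro prod_coprime_right) auto
    then show ?case using insert by (simp add: divides_mult)
  qed simp
  then have "(\<Prod>w\<in>B. gcd w n) \<le> n" using assms(2) by (rule dvd_imp_le)
  moreover have "(\<Prod>w\<in>B. 2) \<le> (\<Prod>w\<in>B. gcd w n)"
  proof (rule prod_mono)
    fix w assume "w \<in> B"
    then have "gcd w n \<noteq> 1" "gcd w n \<noteq> 0" using assms(2) assms(4)[of w] by (metis coprime_iff_gcd_eq_1, simp)
    then show "0 \<le> (2 :: nat) \<and> 2 \<le> gcd w n" by linarith
  qed
  ultimately show ?thesis by simp
qed

text \<open>Averaging over all sets V of the primes involved: a coprime pair (a, b) is compatible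
  with a proportion 2^(-w) of them, w being the number of primes dividing a b, and this is at least
  1 / M. A good V makes every surviving numerator prime to every surviving denominator, so products
  of the fractions stay reduced.\<close>

lemma separating_prime_set:
  assumes fin: "finite R" and R: "\<And>a b. (a, b) \<in> R \<Longrightarrow> a > 0 \<and> b > 0 \<and> coprime a b"
    and M: "\<And>a b. (a, b) \<in> R \<Longrightarrow> 2 ^ card (prime_factors a \<union> prime_factors (b :: nat)) \<le> M"
  shows "\<exists>V. card R \<le> M * card {(a, b) \<in> R. prime_factors a \<subseteq> V \<and> prime_factors b \<inter> V = {}}"
proof (rule ccontr)
  define PF where "PF = (\<Union>(a, b)\<in>R. prime_factors a \<union> prime_factors b)"
  have fin_PF: "finite PF" unfolding PF_def using fin by auto
  define ok where "ok = (\<lambda>V (a :: nat, b :: nat). prime_factors a \<subseteq> V \<and> prime_factors b \<inter> V = {})"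
  assume "\<not> ?thesis"
  moreover have "{x \<in> R. ok V x} = {(a, b) \<in> R. prime_factors a \<subseteq> V \<and> prime_factors b \<inter> V = {}}" for V
    by (auto simp: ok_def)
  ultimately have less: "M * card {x \<in> R. ok V x} < card R" for V by (metis not_le)
  have "(\<Sum>V\<in>Pow PF. M * card {x \<in> R. ok V x}) < (\<Sum>V\<in>Pow PF. card R)"
    by (rule sum_strict_mono) (use less fin_PF in auto)
  also have "\<dots> = card R * 2 ^ card PF" by (simp add: card_Pow fin_PF)
  finally have "(\<Sum>V\<in>Pow PF. M * card {x \<in> R. ok V x}) < card R * 2 ^ card PF" .
  moreover have "(\<Sum>V\<in>Pow PF. M * card {x \<in> R. ok V x}) = (\<Sum>x\<in>R. M * card {V \<in> Pow PF. ok V x})"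
  proof -
    have "(\<Sum>V\<in>Pow PF. card {x \<in> R. ok V x}) = (\<Sum>V\<in>Pow PF. \<Sum>x\<in>R. if ok V x then 1 else 0)"
      using fin by (intro sum.cong refl) (simp add: sum.If_cases Int_def)
    also have "\<dots> = (\<Sum>x\<in>R. \<Sum>V\<in>Pow PF. if ok V x then 1 else 0)" by (rule sum.swap)
    also have "\<dots> = (\<Sum>x\<in>R. card {V \<in> Pow PF. ok V x})"
      using fin_PF by (intro sum.cong refl) (simp add: sum.If_cases Int_def)
    finally show ?thesis by (simp flip: sum_distrib_left)
  qed
  moreover have "(\<Sum>x\<in>R. M * card {V \<in> Pow PF. ok V x}) \<ge> (\<Sum>x\<in>R. 2 ^ card PF)"
  proof (rule sum_mono)
    fix x assume x: "x \<in> R"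
    obtain a b where ab: "x = (a, b)" by fastforce
    define U where "U = prime_factors a \<union> prime_factors b"
    have U_PF: "U \<subseteq> PF" unfolding U_def PF_def using x ab by auto
    have disj: "prime_factors a \<inter> prime_factors b = {}"
    proof -
      have "q = 1" if "q dvd a" "q dvd b" for q using R[of a b] x ab that coprime_common_divisor_nat by blast
      moreover have "prime q \<and> q dvd a \<and> q dvd b" if "q \<in> prime_factors a \<inter> prime_factors b" for q
        using that by (auto simp: in_prime_factors_iff)
      ultimately show ?thesis using not_prime_1 by blast
    qed
    have "inj_on (\<lambda>W. prime_factors a \<union> W) (Pow (PF - U))"
      by (rule inj_onI) (auto simp: U_def)
    then have "2 ^ card (PF - U) = card ((\<lambda>W. prime_factors a \<union> W) ` Pow (PF - U))"
      using fin_PF by (simp add: card_image card_Pow)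
    also have "\<dots> \<le> card {V \<in> Pow PF. ok V x}"
      by (rule card_mono) (use fin_PF U_PF disj in \<open>auto simp: ok_def ab U_def\<close>)
    finally have "2 ^ card U * 2 ^ card (PF - U) \<le> M * card {V \<in> Pow PF. ok V x}"
      using M[of a b] x ab by (intro mult_le_mono) (auto simp: U_def)
    moreover have "card PF = card U + card (PF - U)"
      using U_PF fin_PF by (metis card_Diff_subset card_mono finite_subset le_add_diff_inverse)
    ultimately show "2 ^ card PF \<le> M * card {V \<in> Pow PF. ok V x}" by (simp add: power_add)
  qed
  ultimately show False by simp
qed

text \<open>Each pair determines the element v / u of G. If two pairs give the same element, then u
  v' = u' v modulo p^2 with both sides below p^2, so the fractions are equal as rationals and, being
  reduced, identical.\<close>

lemma card_reduced_unit_fractions_le: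
  assumes p: "prime p"
    and W: "\<And>u v. (u, v) \<in> W \<Longrightarrow> coprime u v \<and> 0 < u \<and> 0 < v \<and> u < p \<and> v < p \<and> [int u ^ (p - 1) = int v ^ (p - 1)] (mod int p ^ 2)"
  shows "card W \<le> p - 1"
proof -
  have nd: "\<not> int p dvd int u" if "0 < u" "u < p" for u using that by (auto simp: int_dvd_int_iff dest: dvd_imp_le)
  have "\<exists>g\<in>unit_roots p. [int u * g = int v] (mod int p ^ 2)" if uv: "(u, v) \<in> W" for u v
  proof -
    have cop: "coprime (int u) (int p ^ 2)" using W[OF uv] by (intro not_dvd_coprime_square[OF p] nd) auto
    then obtain i where i: "[int u * i = 1] (mod int p ^ 2)" by (metis cong_solve_coprime_int)
    have "[int u * (i * int v) = 1 * int v] (mod int p ^ 2)" 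
      unfolding mult.assoc[symmetric] by (intro cong_mult i cong_refl)
    then have g: "[int u * (i * int v) = int v] (mod int p ^ 2)" by simp
    then have "[int u ^ (p - 1) * (i * int v) ^ (p - 1) = int v ^ (p - 1)] (mod int p ^ 2)"
      using cong_pow[OF g, of "p - 1"] by (simp only: power_mult_distrib)
    then have "[int u ^ (p - 1) * (i * int v) ^ (p - 1) = int u ^ (p - 1) * 1] (mod int p ^ 2)"
      using W[OF uv] by (metis cong_sym cong_trans mult.right_neutral)
    moreover have "coprime (int u ^ (p - 1)) (int p ^ 2)" using cop by (simp only: coprime_power_left_iff simp_thms)
    ultimately have "[(i * int v) ^ (p - 1) = 1] (mod int p ^ 2)" using cong_mult_lcancel by blast
    then have "i * int v mod int p ^ 2 \<in> unit_roots p" by (rule mod_in_unit_roots[OF p])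
    moreover have "[int u * (i * int v mod int p ^ 2) = int v] (mod int p ^ 2)"
      using g by (simp add: cong_def mod_mult_right_eq)
    ultimately show ?thesis by blast
  qed
  then obtain g where g: "\<And>u v. (u, v) \<in> W \<Longrightarrow> g u v \<in> unit_roots p \<and> [int u * g u v = int v] (mod int p ^ 2)" by metis
  have "inj_on (\<lambda>(u, v). g u v) W"
  proof (rule inj_onI)
    fix x y assume xy: "x \<in> W" "y \<in> W" "(case x of (u, v) \<Rightarrow> g u v) = (case y of (u, v) \<Rightarrow> g u v)"
    obtain u v u' v' where x: "x = (u, v)" and y: "y = (u', v')" by fastforce
    have eq: "g u v = g u' v'" using xy x y by simp
    note wu = W[OF xy(1)[unfolded x]] and wu' = W[OF xy(2)[unfolded y]]
    note gu = g[OF xy(1)[unfolded x]] and gu' = g[OF xy(2)[unfolded y]]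
    have "[int u * int v' = int u * (int u' * g u' v')] (mod int p ^ 2)"
      using gu' by (intro cong_mult cong_refl) (auto intro: cong_sym)
    also have "int u * (int u' * g u' v') = int u' * (int u * g u v)" by (simp add: eq)
    also have "[int u' * (int u * g u v) = int u' * int v] (mod int p ^ 2)" using gu by (intro cong_mult cong_refl) auto
    finally have "[int (u * v') = int (u' * v)] (mod int (p ^ 2))" by simp
    then have c: "[u * v' = u' * v] (mod p ^ 2)" unfolding cong_int_iff .
    have "u * v' < p * p" "u' * v < p * p" using wu wu' by (auto intro!: mult_strict_mono)
    then have "u * v' = u' * v" using c by (simp add: cong_def power2_eq_square)
    then have "u = u' \<and> v' = v" using wu wu' by (subst (asm) coprime_crossproduct_nat) (auto simp: coprime_commute)
    then show "x = y" using x y by simp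
  qed
  moreover have "(\<lambda>(u, v). g u v) ` W \<subseteq> unit_roots p" using g by auto
  ultimately have "card W \<le> card (unit_roots p)" by (intro card_inj_on_le) auto
  then show ?thesis by (simp add: card_unit_roots[OF p])
qed

section \<open>Products of reduced fractions with values in G\<close>

definition is_unit_root :: "nat \<Rightarrow> nat \<Rightarrow> bool" where
  "is_unit_root p n \<longleftrightarrow> [int n ^ (p - 1) = 1] (mod int p ^ 2)"

definition reduced_pairs :: "nat \<Rightarrow> nat \<Rightarrow> (nat \<times> nat) set" where
  "reduced_pairs p Y = {(a, b). a \<in> {1..Y} \<and> b \<in> {1..Y} \<and> coprime a b \<and> [int a ^ (p - 1) = int b ^ (p - 1)] (mod int p ^ 2)}"

lemma finite_reduced_pairs [simp]: "finite (reduced_pairs p Y)"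
  by (rule finite_subset[of _ "{1..Y} \<times> {1..Y}"]) (auto simp: reduced_pairs_def)

lemma unit_prod_coset:
  assumes "finite I" "\<And>i. i \<in> I \<Longrightarrow> [int (f i) ^ n = int (g i) ^ n] (mod m)"
  shows "[int (\<Prod>i\<in>I. f i) ^ n = int (\<Prod>i\<in>I. g i) ^ n] (mod m)"
  using cong_prod[of I "\<lambda>i. int (f i) ^ n" "\<lambda>i. int (g i) ^ n" m] assms(2) by (simp add: prod_power_distrib)

lemma is_unit_root_prod:
  assumes "finite S" "\<And>w. w \<in> S \<Longrightarrow> is_unit_root p w"
  shows "is_unit_root p (\<Prod>S)"
  using unit_prod_coset[of S "\<lambda>w. w" "p - 1" "\<lambda>_. 1" "int p ^ 2"] assms by (simp add: is_unit_root_def)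

lemma inj_on_Prod_pairwise_coprime:
  fixes P :: "nat set"
  assumes "finite P" "\<And>v w. v \<in> P \<Longrightarrow> w \<in> P \<Longrightarrow> v \<noteq> w \<Longrightarrow> coprime v w" "\<And>w. w \<in> P \<Longrightarrow> 1 < w"
  shows "inj_on Prod (Pow P)"
proof -
  have sub: "S \<subseteq> T" if S: "S \<subseteq> P" "T \<subseteq> P" "\<Prod>S = \<Prod>T" for S T
  proof
    fix w assume w: "w \<in> S"
    show "w \<in> T"
    proof (rule ccontr)
      assume "w \<notin> T"
      then have "coprime w (\<Prod>T)" using w S assms(2) by (intro prod_coprime_right) auto
      moreover have "w dvd \<Prod>T" using w S(1) assms(1) unfolding S(3)[symmetric] by (intro dvd_prod_eqI[of _ w]) (auto intro: finite_subset)
      ultimately have "w = 1" by (metis coprime_common_divisor_nat dvd_refl)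
      then show False using assms(3) w S(1) by auto
    qed
  qed
  show ?thesis
  proof (rule inj_onI)
    fix S T assume "S \<in> Pow P" "T \<in> Pow P" "\<Prod>S = \<Prod>T"
    then show "S = T" using sub[of S T] sub[of T S] by simp
  qed
qed

lemma prod_le_power:
  fixes f :: "'i \<Rightarrow> nat"
  assumes "\<And>i. i \<in> I \<Longrightarrow> f i \<le> m" shows "(\<Prod>i\<in>I. f i) \<le> m ^ card I"
  using prod_mono[of I f "\<lambda>_. m"] assms by simp

lemma card_le_fibres:
  assumes "finite X" "finite W" "f ` X \<subseteq> W" "\<And>w. w \<in> W \<Longrightarrow> card {x \<in> X. f x = w} \<le> D"
  shows "card X \<le> card W * (D :: nat)"
proof -
  have "card X = (\<Sum>x\<in>X. 1)" by simp
  also have "\<dots> = (\<Sum>w\<in>W. \<Sum>x\<in>{x \<in> X. f x = w}. 1)" by (rule sum.group[symmetric]) (use assms in auto)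
  also have "\<dots> \<le> (\<Sum>w\<in>W. D)" by (rule sum_mono) (use assms(4) in simp)
  finally show ?thesis by simp
qed

text \<open>
  The conditions on \<open>V\<close> and the removal of the elements of \<open>P\<^sub>1\<close> and \<open>P\<^sub>2\<close> that share a factor with the
  chosen pairs (at most \<open>2 L\<close> each) prevent any cancellation, so that the product of the fractions
  determines its factors up to the choice of divisors.
\<close>

lemma amplified_pairs_bound:
  assumes p: "prime p"
    and R: "finite R" "\<And>a b. (a, b) \<in> R \<Longrightarrow> 0 < a \<and> a \<le> Y \<and> 0 < b \<and> b \<le> Y \<and> prime_factors a \<subseteq> V \<and> prime_factors b \<inter> V = {}
        \<and> [int a ^ (p - 1) = int b ^ (p - 1)] (mod int p ^ 2)" and Yp: "Y < p"
    and P: "finite P\<^sub>1" "finite P\<^sub>2" "P\<^sub>1 \<inter> P\<^sub>2 = {}"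
      "\<And>v w. v \<in> P\<^sub>1 \<union> P\<^sub>2 \<Longrightarrow> w \<in> P\<^sub>1 \<union> P\<^sub>2 \<Longrightarrow> v \<noteq> w \<Longrightarrow> coprime v w"
      "\<And>w. w \<in> P\<^sub>1 \<union> P\<^sub>2 \<Longrightarrow> 1 < w \<and> w \<le> X \<and> is_unit_root p w"
    and size: "Y ^ k * X ^ j \<le> p" "0 < X" "0 < Y"
    and D: "\<And>n. 0 < n \<Longrightarrow> n \<le> p \<Longrightarrow> num_divisors n \<le> D"
    and L: "p < 2 ^ L" "h + 2 * L \<le> card P\<^sub>1" "h + 2 * L \<le> card P\<^sub>2"
  shows "card R ^ k * (h choose j) ^ 2 \<le> p * D ^ (2 * k + 2)"
proof -
  define K where "K = {..<k}"
  have Kfin: "finite K" and cK: "card K = k" by (auto simp: K_def)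
  define fa where "fa = (\<lambda>f :: nat \<Rightarrow> nat \<times> nat. \<Prod>i\<in>K. fst (f i))"
  define fb where "fb = (\<lambda>f :: nat \<Rightarrow> nat \<times> nat. \<Prod>i\<in>K. snd (f i))"
  \<comment> \<open>An element of \<open>Fs\<close> is an ordered choice of k pairs, and
    \<open>Sel\<close> takes j family members prime to all of them. \<open>P\<^sub>1\<close> feeds
    the numerator and \<open>P\<^sub>2\<close> the denominator.\<close>
  define Fs where "Fs = K \<rightarrow>\<^sub>E R"
  define Sel where "Sel = (\<lambda>P :: nat set. \<lambda>f. {S. S \<subseteq> {w \<in> P. coprime w (fa f * fb f)} \<and> card S = j})"
  define X' where "X' = (SIGMA f:Fs. Sel P\<^sub>1 f \<times> Sel P\<^sub>2 f)"
  have p0: "p > 0" using prime_gt_0_nat[OF p] .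
  have finFs: "finite Fs" unfolding Fs_def by (intro finite_PiE Kfin R)
  have X1: "1 \<le> X ^ j" and Y1: "1 \<le> Y ^ k" using size by auto
  have Ykp: "Y ^ k \<le> p" using size(1) X1 by (metis le_trans mult.right_neutral mult_le_mono2)
  have fiR: "f i \<in> R" if "f \<in> Fs" "i \<in> K" for f i using that by (auto simp: Fs_def)
  have fRp: "0 < fst (f i) \<and> fst (f i) \<le> Y \<and> 0 < snd (f i) \<and> snd (f i) \<le> Y \<and> prime_factors (fst (f i)) \<subseteq> V
      \<and> prime_factors (snd (f i)) \<inter> V = {} \<and> [int (fst (f i)) ^ (p - 1) = int (snd (f i)) ^ (p - 1)] (mod int p ^ 2)"
    if "f \<in> Fs" "i \<in> K" for f i
    using R(2)[of "fst (f i)" "snd (f i)"] fiR[OF that] by simp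
  have fab: "0 < fa f" "fa f \<le> Y ^ k" "0 < fb f" "fb f \<le> Y ^ k" "coprime (fa f) (fb f)"
    "[int (fa f) ^ (p - 1) = int (fb f) ^ (p - 1)] (mod int p ^ 2)" if f: "f \<in> Fs" for f
  proof -
    show "0 < fa f" "0 < fb f" using fRp[OF f] by (auto simp: fa_def fb_def intro!: prod_pos)
    show "fa f \<le> Y ^ k" "fb f \<le> Y ^ k" unfolding fa_def fb_def cK[symmetric]
      using fRp[OF f] by (intro prod_le_power; blast)+
    show "coprime (fa f) (fb f)"
      unfolding fa_def fb_def
    proof (intro prod_coprime_left prod_coprime_right)
      fix i l assume il: "i \<in> K" "l \<in> K"
      show "coprime (fst (f i)) (snd (f l))"
      proof (rule ccontr)
        assume "\<not> coprime (fst (f i)) (snd (f l))"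
        then have "gcd (fst (f i)) (snd (f l)) \<noteq> 1" by (metis coprime_iff_gcd_eq_1)
        then obtain q where "prime q" "q dvd gcd (fst (f i)) (snd (f l))" using prime_factor_nat by blast
        then have "q \<in> prime_factors (fst (f i))" "q \<in> prime_factors (snd (f l))"
          using fRp[OF f il(1)] fRp[OF f il(2)] by (auto simp: in_prime_factors_iff)
        then show False using fRp[OF f il(1)] fRp[OF f il(2)] by blast
      qed
    qed
    show "[int (fa f) ^ (p - 1) = int (fb f) ^ (p - 1)] (mod int p ^ 2)"
      unfolding fa_def fb_def using fRp[OF f] by (intro unit_prod_coset Kfin) blast
  qed
  have selD: "finite S \<and> S \<subseteq> P \<and> card S = j \<and> coprime (\<Prod>S) (fa f * fb f) \<and> is_unit_root p (\<Prod>S) \<and> 0 < \<Prod>S \<and> \<Prod>S \<le> X ^ j"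
    if "S \<in> Sel P f" "f \<in> Fs" "P \<subseteq> P\<^sub>1 \<union> P\<^sub>2" for P S f
  proof -
    have "S \<subseteq> P\<^sub>1 \<union> P\<^sub>2" using that by (auto simp: Sel_def)
    then have fin: "finite S" using P(1,2) by (rule finite_subset[OF _ finite_UnI])
    have sub: "S \<subseteq> P" "\<And>w. w \<in> S \<Longrightarrow> coprime w (fa f * fb f)" "card S = j" using that(1) by (auto simp: Sel_def)
    have Sw: "1 < w \<and> w \<le> X \<and> is_unit_root p w" if "w \<in> S" for w using that sub(1) \<open>P \<subseteq> _\<close> P(5) by blast
    show ?thesis
    proof (intro conjI fin sub(1) sub(3))
      show "coprime (\<Prod>S) (fa f * fb f)" using sub(2) by (intro prod_coprime_left) auto
      show "is_unit_root p (\<Prod>S)" using Sw fin by (intro is_unit_root_prod) auto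
      show "0 < \<Prod>S" using Sw by (intro prod_pos) force
      show "\<Prod>S \<le> X ^ j" using prod_le_power[of S "\<lambda>w. w" X] Sw sub(3) by simp
    qed
  qed
  have cardSel: "h choose j \<le> card (Sel P f)" if P': "P \<subseteq> P\<^sub>1 \<union> P\<^sub>2" "h + 2 * L \<le> card P" and f: "f \<in> Fs" for P f
  proof -
    have finP: "finite P" using P'(1) P(1,2) finite_subset by blast
    define B where "B = {w \<in> P. \<not> coprime w (fa f * fb f)}"
    have "2 ^ card B \<le> fa f * fb f"
      by (rule two_power_card_noncoprime_le) (use finP P' P(4) fab[OF f] in \<open>auto simp: B_def\<close>)
    also have "\<dots> \<le> p * p" using fab[OF f] Ykp by (intro mult_le_mono) auto
    also have "\<dots> < 2 ^ L * 2 ^ L" using L(1) p0 by (intro mult_strict_mono) auto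
    also have "\<dots> = (2 :: nat) ^ (2 * L)" by (simp add: mult_2 power_add)
    finally have "card B < 2 * L" using power_less_imp_less_exp[of 2 "card B" "2 * L"] by simp
    moreover have "card P = card B + card {w \<in> P. coprime w (fa f * fb f)}"
      unfolding B_def using finP by (subst card_Un_disjoint[symmetric]) (auto intro!: arg_cong[of _ _ card])
    ultimately have "h \<le> card {w \<in> P. coprime w (fa f * fb f)}" using P'(2) by linarith
    then have "h choose j \<le> card {w \<in> P. coprime w (fa f * fb f)} choose j" by (rule binomial_right_mono)
    also have "\<dots> = card (Sel P f)" unfolding Sel_def using finP by (intro n_subsets[symmetric]) auto
    finally show ?thesis .
  qed
  have finSel: "finite (Sel P f)" if "P \<subseteq> P\<^sub>1 \<union> P\<^sub>2" for P f
  proof -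
    have "finite P" using that P(1,2) by (rule finite_subset[OF _ finite_UnI])
    then show ?thesis unfolding Sel_def by (auto intro: finite_subset[of _ "Pow P"])
  qed
  have finX': "finite X'" unfolding X'_def by (intro finite_SigmaI finite_cartesian_product finFs finSel) auto
  have "card R ^ k * (h choose j) ^ 2 \<le> card X'"
  proof -
    have "card R ^ k * (h choose j) ^ 2 = (\<Sum>f\<in>Fs. (h choose j) * (h choose j))"
      using Kfin cK by (simp add: Fs_def card_PiE power2_eq_square)
    also have "\<dots> \<le> (\<Sum>f\<in>Fs. card (Sel P\<^sub>1 f) * card (Sel P\<^sub>2 f))"
      using cardSel L by (intro sum_mono mult_le_mono) auto
    also have "\<dots> = card X'" unfolding X'_def
      using finFs finSel by (subst card_SigmaI) (auto simp: card_cartesian_product)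
    finally show ?thesis .
  qed
  also define \<Psi> where "\<Psi> = (\<lambda>(f, S, T). (fa f * \<Prod>S, fb f * \<Prod>T))"
  define W where "W = \<Psi> ` X'"
  have finW: "finite W" unfolding W_def using finX' by simp
  have Wprop: "coprime u v \<and> 0 < u \<and> 0 < v \<and> u < p \<and> v < p \<and> [int u ^ (p - 1) = int v ^ (p - 1)] (mod int p ^ 2)"
    if uvW: "(u, v) \<in> W" for u v
  proof -
    obtain f S T where fST: "f \<in> Fs" "S \<in> Sel P\<^sub>1 f" "T \<in> Sel P\<^sub>2 f" and u: "u = fa f * \<Prod>S" and v: "v = fb f * \<Prod>T"
      using uvW by (auto simp: W_def X'_def \<Psi>_def)
    note S = selD[OF fST(2,1)] and T = selD[OF fST(3,1)]
    note ab = fab[OF fST(1)]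
    have "coprime (\<Prod>S) (\<Prod>T)"
    proof (intro prod_coprime_left prod_coprime_right)
      fix w w' assume "w \<in> S" "w' \<in> T"
      then show "coprime w w'" using S T P(3) by (intro P(4)) auto
    qed
    moreover have "coprime (\<Prod>S) (fb f)" "coprime (fa f) (\<Prod>T)"
      using S T by (simp_all only: coprime_mult_right_iff coprime_commute[of "fa f"] Un_upper1 Un_upper2 simp_thms)
    ultimately have cop: "coprime u v" using ab(5) unfolding u v by (simp only: coprime_mult_left_iff coprime_mult_right_iff simp_thms)
    have cong: "[int u ^ (p - 1) = int v ^ (p - 1)] (mod int p ^ 2)"
    proof -
      have "[int (fa f) ^ (p - 1) * int (\<Prod>S) ^ (p - 1) = int (fb f) ^ (p - 1) * int (\<Prod>T) ^ (p - 1)] (mod int p ^ 2)"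
      proof (intro cong_mult ab)
        show "[int (\<Prod>S) ^ (p - 1) = int (\<Prod>T) ^ (p - 1)] (mod int p ^ 2)"
          using S T unfolding is_unit_root_def by (metis Un_upper1 Un_upper2 cong_sym cong_trans)
      qed
      then show ?thesis unfolding u v by (simp add: power_mult_distrib)
    qed
    have le: "u \<le> p" "v \<le> p"
      using S T ab size(1) unfolding u v by (meson Un_upper1 Un_upper2 le_trans mult_le_mono)+
    have pos: "0 < u" "0 < v" using S T ab unfolding u v by auto
    \<comment> \<open>The size condition yields only u, v \<le> p, while reduced fractions are
      separated modulo p^2 strictly below p. Equality fails because u and v are products of positive
      numbers less than p and of roots of unity, all prime to p.\<close>
    have "n \<noteq> p" if "n = fc * \<Prod>U" and fc: "fc = (\<Prod>i\<in>K. c i)" and ci: "\<And>i. i \<in> K \<Longrightarrow> 0 < c i \<and> c i < p" and U: "is_unit_root p (\<Prod>U)" for n fc c U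
    proof
      assume "n = p"
      then have "p dvd fc * \<Prod>U" using \<open>n = fc * \<Prod>U\<close> by simp
      moreover have "\<not> p dvd \<Prod>U" using unit_not_dvd[OF p U[unfolded is_unit_root_def]] by (simp only: int_dvd_int_iff simp_thms)
      ultimately have "p dvd fc" using p prime_dvd_mult_iff by blast
      then obtain i where "i \<in> K" "p dvd c i" using p Kfin unfolding fc by (meson prime_dvd_prod_iff)
      then show False using ci by (meson dvd_imp_le not_le)
    qed
    note np = this
    have "u \<noteq> p"
      by (rule np[OF u fa_def[THEN fun_cong]]) (use fRp[OF fST(1)] Yp S in \<open>auto intro: le_less_trans\<close>)
    moreover have "v \<noteq> p"
      by (rule np[OF v fb_def[THEN fun_cong]]) (use fRp[OF fST(1)] Yp T in \<open>auto intro: le_less_trans\<close>)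
    ultimately show ?thesis using cop cong le pos by auto
  qed
  have "card X' \<le> card W * D ^ (2 * k + 2)"
  proof (rule card_le_fibres[OF finX' finW])
    show "\<Psi> ` X' \<subseteq> W" by (simp add: W_def)
    fix w assume w: "w \<in> W"
    obtain u v where uv: "w = (u, v)" by fastforce
    have uvp: "0 < u" "0 < v" "u \<le> p" "v \<le> p" using Wprop[of u v] w uv by auto
    define du where "du = {d. d dvd u}"
    define dv where "dv = {d. d dvd v}"
    have cd: "card du \<le> D" "card dv \<le> D" "finite du" "finite dv" using D uvp by (auto simp: du_def dv_def)
    \<comment> \<open>Each chosen a and the product over \<open>S\<close> divide u, each chosen b
      and the product over \<open>T\<close> divide v. This leaves at most D values for each of 2 k +
      2 quantities.\<close>
    define Z where "Z = (K \<rightarrow>\<^sub>E du) \<times> (K \<rightarrow>\<^sub>E dv) \<times> du \<times> dv"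
    define \<iota> :: "(nat \<Rightarrow> nat \<times> nat) \<times> nat set \<times> nat set \<Rightarrow> (nat \<Rightarrow> nat) \<times> (nat \<Rightarrow> nat) \<times> nat \<times> nat"
      where "\<iota> = (\<lambda>(f, S, T). (restrict (\<lambda>i. fst (f i)) K, restrict (\<lambda>i. snd (f i)) K, \<Prod>S, \<Prod>T))"
    have "inj_on \<iota> {x \<in> X'. \<Psi> x = w}"
    proof (rule inj_onI)
      fix x y assume xy: "x \<in> {x \<in> X'. \<Psi> x = w}" "y \<in> {x \<in> X'. \<Psi> x = w}" "\<iota> x = \<iota> y"
      obtain f S T f' S' T' where x: "x = (f, S, T)" and y: "y = (f', S', T')" by (metis prod.collapse)
      have x': "f \<in> Fs" "S \<in> Sel P\<^sub>1 f" "T \<in> Sel P\<^sub>2 f" and y': "f' \<in> Fs" "S' \<in> Sel P\<^sub>1 f'" "T' \<in> Sel P\<^sub>2 f'"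
        using xy(1,2) x y by (auto simp: X'_def)
      have e: "restrict (\<lambda>i. fst (f i)) K = restrict (\<lambda>i. fst (f' i)) K" "restrict (\<lambda>i. snd (f i)) K = restrict (\<lambda>i. snd (f' i)) K"
        "\<Prod>S = \<Prod>S'" "\<Prod>T = \<Prod>T'" using xy(3) x y by (auto simp: \<iota>_def)
      have "f = f'"
      proof (rule PiE_ext)
        show "f \<in> K \<rightarrow>\<^sub>E R" "f' \<in> K \<rightarrow>\<^sub>E R" using x' y' by (auto simp: Fs_def)
        fix i assume "i \<in> K"
        then have "fst (f i) = fst (f' i)" "snd (f i) = snd (f' i)"
          using fun_cong[OF e(1), of i] fun_cong[OF e(2), of i] by auto
        then show "f i = f' i" by (rule prod_eqI)
      qed
      moreover have "S = S'"
      proof (rule inj_onD[OF inj_on_Prod_pairwise_coprime[of P\<^sub>1] e(3)])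
        show "S \<in> Pow P\<^sub>1" "S' \<in> Pow P\<^sub>1" using selD[OF x'(2,1)] selD[OF y'(2,1)] by auto
      qed (use P in auto)
      moreover have "T = T'"
      proof (rule inj_onD[OF inj_on_Prod_pairwise_coprime[of P\<^sub>2] e(4)])
        show "T \<in> Pow P\<^sub>2" "T' \<in> Pow P\<^sub>2" using selD[OF x'(3,1)] selD[OF y'(3,1)] by auto
      qed (use P in auto)
      ultimately show "x = y" using x y by simp
    qed
    moreover have "\<iota> ` {x \<in> X'. \<Psi> x = w} \<subseteq> Z"
    proof
      fix z assume "z \<in> \<iota> ` {x \<in> X'. \<Psi> x = w}"
      then obtain f S T where x: "f \<in> Fs" "u = fa f * \<Prod>S" "v = fb f * \<Prod>T" and z: "z = \<iota> (f, S, T)"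
        by (auto simp: X'_def \<Psi>_def uv)
      have "fst (f i) dvd u" "snd (f i) dvd v" if "i \<in> K" for i
        unfolding x(2,3) fa_def fb_def using that Kfin by (intro dvd_mult2 dvd_prodI; simp)+
      then show "z \<in> Z" unfolding z \<iota>_def Z_def using x by (auto simp: du_def dv_def)
    qed
    moreover have "finite Z" unfolding Z_def using cd Kfin by (intro finite_cartesian_product finite_PiE) auto
    ultimately have "card {x \<in> X'. \<Psi> x = w} \<le> card Z" by (intro card_inj_on_le)
    also have "card Z = card du ^ k * (card dv ^ k * (card du * card dv))"
      unfolding Z_def using Kfin cK by (simp add: card_cartesian_product card_PiE)
    also have "\<dots> \<le> D ^ k * (D ^ k * (D * D))" using cd by (intro mult_le_mono power_mono) auto
    also have "\<dots> = D ^ (2 * k + 2)" by (simp add: mult_2 power_add)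
    finally show "card {x \<in> X'. \<Psi> x = w} \<le> D ^ (2 * k + 2)" .
  qed
  also have "card W \<le> p"
  proof -
    have "card W \<le> p - 1" by (rule card_reduced_unit_fractions_le[OF p]) (use Wprop in blast)
    then show ?thesis by simp
  qed
  finally show ?thesis by simp
qed

section \<open>Large families of small roots of unity\<close>

definition unit_root_family :: "nat \<Rightarrow> nat \<Rightarrow> nat set \<Rightarrow> bool" where
  "unit_root_family p X P \<longleftrightarrow> finite P \<and> (\<forall>w\<in>P. 1 < w \<and> w \<le> X \<and> is_unit_root p w)
     \<and> (\<forall>v\<in>P. \<forall>w\<in>P. v \<noteq> w \<longrightarrow> coprime v w)"

lemma ln_binomial_ge:
  assumes "z \<ge> 1" "real j * z \<le> real h"
  shows "real j * ln z \<le> ln (real (h choose j))"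
proof (cases "j = 0")
  case False
  then have "real j * 1 \<le> real j * z" using assms by (intro mult_left_mono) auto
  then have jh: "j \<le> h" using assms by simp
  have "z \<le> real h / real j" using assms False by (simp add: field_simps)
  then have "z ^ j \<le> (real h / real j) ^ j" using assms by (intro power_mono) auto
  also have "\<dots> \<le> real (h choose j)" using jh by (rule binomial_ge_n_over_k_pow_k)
  finally have "ln (z ^ j) \<le> ln (real (h choose j))" using assms by (intro ln_mono) auto
  then show ?thesis using assms by (simp add: ln_realpow)
qed simp

text \<open>Let k be largest with Y^k \<le> p, and fill the gap p / Y^k with j family members on
  each side. Each side offers at least X^(\<beta> j) choices with \<beta> = 211/463, so a gap of
  logarithmic size g costs (1 - 2 \<beta>) g = (41/463) g instead of g. Since g < ln Y \<le> (ln p)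
  / 6 and k \<ge> 6, this loss and the rounding of j cost each pair at most (27/10000) ln p; the
  divisor terms bring the total below (1/250) ln p.\<close>

lemma ln_card_reduced_pairs_le:
  assumes p: "prime p" and C: "C \<ge> 1" "\<And>n. n > 0 \<Longrightarrow> real (num_divisors n) \<le> C * real n powr (1 / 5000)"
    and l: "ln (real p) \<ge> 10" and X: "2 \<le> X" "1000 * ln (real X) \<le> ln (real p)"
    and P: "unit_root_family p X P"
    and card_P: "30 * (ln (real p) / ln (real X)) * real X powr (211 / 463) \<le> real (card P)"
    and Y: "1 \<le> Y" "6 * ln (real Y) \<le> ln (real p)"
  shows "ln (real (card (reduced_pairs p Y))) \<le> ln (real Y) + ln (real p) / 250 + 5 * ln C"
proof (cases "Y = 1")
  case True
  have "reduced_pairs p 1 \<subseteq> {(1, 1)}" by (auto simp: reduced_pairs_def)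
  then have "card (reduced_pairs p 1) \<le> 1" by (metis card.empty card.insert card_mono empty_iff finite.emptyI finite_insert One_nat_def)
  then have "ln (real (card (reduced_pairs p 1))) \<le> 0" 
    using ln_le_zero_iff[of "real (card (reduced_pairs p 1))"] by (cases "real (card (reduced_pairs p 1)) > 0") (simp_all only: of_nat_le_1_iff, simp)
  then show ?thesis using True l C by (simp add: add_nonneg_nonneg order_trans)
next
  case False
  define \<beta> :: real where "\<beta> = 211 / 463"
  define \<l> where "\<l> = ln (real p)"
  define x where "x = ln (real X)"
  define y where "y = ln (real Y)"
  have p1: "real p > 1" using prime_gt_1_nat[OF p] by simp
  have y0: "y > 0" using False Y by (simp add: y_def)
  have x0: "x > 0" using X by (simp add: x_def)
  have l0: "\<l> \<ge> 10" using l by (simp add: \<l>_def)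
  have xl: "1000 * x \<le> \<l>" using X by (simp add: x_def \<l>_def)
  have yl: "6 * y \<le> \<l>" using Y by (simp add: y_def \<l>_def)
  \<comment> \<open>The family has at least 30 B members and ln p \<le> 3 B. Each half therefore
    holds 15 B up to rounding, of which 2 L \<le> 4 ln p \<le> 12 B are reserved for members sharing
    a factor with the pairs; at least B remain as \<open>h\<close>.\<close>
  define B where "B = (\<l> / x) * real X powr \<beta>"
  have AB: "30 * B \<le> real (card P)" using card_P by (simp add: B_def \<l>_def x_def \<beta>_def)
  have Xb: "real X powr \<beta> = exp (\<beta> * x)" using X by (simp add: powr_def x_def)
  have Bl: "\<l> \<le> 3 * B"
  proof -
    have "\<beta> * x \<le> exp (\<beta> * x)" using exp_ge_add_one_self[of "\<beta> * x"] by linarith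
    then have "\<l> / x * (\<beta> * x) \<le> B" unfolding B_def Xb using l0 x0 by (intro mult_left_mono) auto
    then have "\<l> * \<beta> \<le> B" using x0 by simp
    moreover have "\<l> * (1 / 3) \<le> \<l> * \<beta>" using l0 by (intro mult_left_mono) (auto simp: \<beta>_def)
    ultimately show ?thesis by linarith
  qed
  define L where "L = nat \<lfloor>log 2 (real p)\<rfloor> + 1"
  have log0: "log 2 (real p) \<ge> 0" using p1 by simp
  have L1: "real L \<le> 2 * \<l>"
  proof -
    have "log 2 (real p) = \<l> / ln 2" by (simp add: log_def \<l>_def)
    also have "\<dots> \<le> \<l> / (2 / 3)" using l0 ln2_ge_two_thirds by (intro divide_left_mono) auto
    finally have "log 2 (real p) \<le> 3 / 2 * \<l>" by simp
    moreover have "real L \<le> log 2 (real p) + 1" using log0 unfolding L_def by simp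
    ultimately show ?thesis using l0 by linarith
  qed
  have L2: "p < 2 ^ L"
  proof -
    have "log 2 (real p) < real L" using log0 unfolding L_def by linarith
    then have "real p < 2 powr real L" using p1 by (simp add: log_less_iff)
    then have "real p < 2 ^ L" by (simp add: powr_realpow)
    then show ?thesis by (metis of_nat_less_iff of_nat_numeral of_nat_power)
  qed
  have finP: "finite P" using P by (simp add: unit_root_family_def)
  obtain P\<^sub>1 where P1: "P\<^sub>1 \<subseteq> P" "card P\<^sub>1 = card P div 2" by (meson div_le_dividend obtain_subset_with_card_n)
  define P\<^sub>2 where "P\<^sub>2 = P - P\<^sub>1"
  define h where "h = card P div 2 - 2 * L"
  have finP1: "finite P\<^sub>1" using P1 finP finite_subset by blast
  have cP2: "card P\<^sub>2 = card P - card P div 2" unfolding P\<^sub>2_def using P1 finP1 by (simp add: card_Diff_subset)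
  have AL: "2 * L \<le> card P div 2"
  proof -
    have "real (card P) / 2 - 1 \<le> real (card P div 2)" by linarith
    then have "real (2 * L) \<le> real (card P div 2)" using AB Bl L1 l0 by simp
    then show ?thesis by linarith
  qed
  have hB: "B \<le> real h"
  proof -
    have "real h = real (card P div 2) - 2 * real L" using AL by (simp add: h_def of_nat_diff)
    moreover have "real (card P) / 2 - 1 \<le> real (card P div 2)" by linarith
    ultimately show ?thesis using AB Bl L1 l0 by linarith
  qed
  define k where "k = nat \<lfloor>\<l> / y\<rfloor>"
  have ly: "6 \<le> \<l> / y" using yl y0 by (simp add: field_simps)
  have k: "6 \<le> k" "real k * y \<le> \<l>" "\<l> < (real k + 1) * y"
  proof -
    show "6 \<le> k" unfolding k_def using ly by linarith
    have "real k \<le> \<l> / y" "\<l> / y < real k + 1" unfolding k_def using ly by linarith+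
    then show "real k * y \<le> \<l>" "\<l> < (real k + 1) * y" using y0 by (simp_all add: field_simps)
  qed
  define j where "j = nat \<lfloor>(\<l> - real k * y) / x\<rfloor>"
  have j: "real j * x \<le> \<l> - real k * y" "\<l> - real k * y < (real j + 1) * x"
  proof -
    have "0 \<le> (\<l> - real k * y) / x" using k x0 by simp
    then have "real j \<le> (\<l> - real k * y) / x" "(\<l> - real k * y) / x < real j + 1" unfolding j_def by linarith+
    then show "real j * x \<le> \<l> - real k * y" "\<l> - real k * y < (real j + 1) * x" using x0 by (simp_all add: field_simps)
  qed
  have ln_prod: "ln (real (Y ^ k * X ^ j)) = real k * y + real j * x"
    using Y X by (simp add: ln_mult ln_realpow y_def x_def)
  have size: "Y ^ k * X ^ j \<le> p"
  proof -
    have "ln (real (Y ^ k * X ^ j)) \<le> ln (real p)" unfolding ln_prod using j by (simp add: \<l>_def)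
    moreover have "real (Y ^ k * X ^ j) > 0" using Y X by simp
    ultimately have "real (Y ^ k * X ^ j) \<le> real p" using p1 by (subst (asm) ln_le_cancel_iff) auto
    then show ?thesis by linarith
  qed
  define D where "D = nat \<lfloor>C * real p powr (1 / 5000)\<rfloor>"
  define d where "d = ln (real D)"
  have Cp: "C * real p powr (1 / 5000) \<ge> 1" using C p1 by (simp add: mult_ge1_I ge_one_powr_ge_zero)
  have D1: "D \<ge> 1" "real D \<le> C * real p powr (1 / 5000)" unfolding D_def using Cp by linarith+
  have divD: "num_divisors n \<le> D" if "0 < n" "n \<le> p" for n
  proof -
    have "real (num_divisors n) \<le> C * real n powr (1 / 5000)" using C that by simp
    also have "\<dots> \<le> C * real p powr (1 / 5000)" using C that by (intro mult_left_mono powr_mono2) auto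
    finally show ?thesis unfolding D_def by linarith
  qed
  have d: "0 \<le> d" "d \<le> ln C + \<l> / 5000"
  proof -
    show "0 \<le> d" using D1 by (simp add: d_def)
    have "d \<le> ln (C * real p powr (1 / 5000))" unfolding d_def using D1 by (intro ln_mono) auto
    also have "\<dots> = ln C + \<l> / 5000" using C p1 by (simp add: ln_mult ln_powr \<l>_def)
    finally show "d \<le> ln C + \<l> / 5000" .
  qed
  have Yp: "Y < p"
  proof -
    have "y < \<l>" using yl y0 by linarith
    then have "real Y < real p" using Y p1 by (simp add: y_def \<l>_def)
    then show ?thesis by simp
  qed
  define R where "R = reduced_pairs p Y"
  have RD: "0 < a \<and> a \<le> Y \<and> 0 < b \<and> b \<le> Y \<and> coprime a b \<and> [int a ^ (p - 1) = int b ^ (p - 1)] (mod int p ^ 2)"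
    if "(a, b) \<in> R" for a b using that by (auto simp: R_def reduced_pairs_def)
  have finR: "finite R" by (simp add: R_def)
  have "2 ^ card (prime_factors a \<union> prime_factors b) \<le> D ^ 2" if "(a, b) \<in> R" for a b
  proof -
    have om: "2 ^ card (prime_factors n) \<le> D" if "0 < n" "n \<le> Y" for n
      using two_power_card_prime_factors_le[OF that(1)] divD[of n] that Yp by linarith
    have "(2 :: nat) ^ card (prime_factors a \<union> prime_factors b) \<le> 2 ^ (card (prime_factors a) + card (prime_factors b))"
      by (intro power_increasing card_Un_le) auto
    also have "\<dots> \<le> D * D" unfolding power_add using om RD[OF that] by (intro mult_le_mono) auto
    finally show ?thesis by (simp add: power2_eq_square)
  qed
  then obtain V where V: "card R \<le> D ^ 2 * card {(a, b) \<in> R. prime_factors a \<subseteq> V \<and> prime_factors b \<inter> V = {}}"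
    using separating_prime_set[OF finR, of "D ^ 2"] RD by blast
  define R' where "R' = {(a, b) \<in> R. prime_factors a \<subseteq> V \<and> prime_factors b \<inter> V = {}}"
  have finR': "finite R'" unfolding R'_def by (rule finite_subset[OF _ finR]) auto
  have main: "card R' ^ k * (h choose j) ^ 2 \<le> p * D ^ (2 * k + 2)"
  proof (rule amplified_pairs_bound[OF p finR' _ Yp finP1 _ _ _ _ size _ _ divD L2])
    show "finite P\<^sub>2" "P\<^sub>1 \<inter> P\<^sub>2 = {}" using finP by (auto simp: P\<^sub>2_def)
    have "P\<^sub>1 \<union> P\<^sub>2 = P" using P1 by (auto simp: P\<^sub>2_def)
    then show "\<And>v w. v \<in> P\<^sub>1 \<union> P\<^sub>2 \<Longrightarrow> w \<in> P\<^sub>1 \<union> P\<^sub>2 \<Longrightarrow> v \<noteq> w \<Longrightarrow> coprime v w"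
      "\<And>w. w \<in> P\<^sub>1 \<union> P\<^sub>2 \<Longrightarrow> 1 < w \<and> w \<le> X \<and> is_unit_root p w"
      using P unfolding unit_root_family_def by blast+
    show "0 < X" "0 < Y" using X Y by auto
    show "h + 2 * L \<le> card P\<^sub>1" using AL P1 by (simp add: h_def)
    show "h + 2 * L \<le> card P\<^sub>2" using AL by (simp add: h_def cP2)
    fix a b assume "(a, b) \<in> R'"
    then show "0 < a \<and> a \<le> Y \<and> 0 < b \<and> b \<le> Y \<and> prime_factors a \<subseteq> V \<and> prime_factors b \<inter> V = {}
        \<and> [int a ^ (p - 1) = int b ^ (p - 1)] (mod int p ^ 2)"
      using RD by (auto simp: R'_def)
  qed auto
  have "(1, 1) \<in> R" using Y by (auto simp: R_def reduced_pairs_def)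
  then have cR: "card R > 0" using finR by (auto simp: card_gt_0_iff)
  then have cR': "card R' > 0" using V unfolding R'_def[symmetric] by (cases "card R'") auto
  define r where "r = ln (real (card R'))"
  have jB: "real j * real X powr \<beta> \<le> real h"
  proof -
    have "real j \<le> \<l> / x" using j k y0 x0 by (simp add: field_simps) (smt (verit) mult_nonneg_nonneg of_nat_0_le_iff)
    then have "real j * real X powr \<beta> \<le> B" unfolding B_def by (intro mult_right_mono) auto
    then show ?thesis using hB by linarith
  qed
  have "real j * ln (real X powr \<beta>) \<le> ln (real (h choose j))"
    using jB X by (intro ln_binomial_ge) (auto simp: ge_one_powr_ge_zero \<beta>_def)
  then have bin: "\<beta> * (real j * x) \<le> ln (real (h choose j))"
    using X by (simp add: ln_powr x_def mult.left_commute mult.commute)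
  have jh: "j \<le> h"
  proof -
    have "real j * 1 \<le> real j * real X powr \<beta>" using X by (intro mult_left_mono) (auto simp: ge_one_powr_ge_zero \<beta>_def)
    then show ?thesis using jB by simp
  qed
  have "real (card R' ^ k * (h choose j) ^ 2) \<le> real (p * D ^ (2 * k + 2))" using main of_nat_le_iff by blast
  then have "real (card R') ^ k * real (h choose j) ^ 2 \<le> real p * real D ^ (2 * k + 2)" by simp
  moreover have hj: "real (h choose j) > 0" using jh by (simp add: zero_less_binomial)
  moreover have "real (card R') ^ k * real (h choose j) ^ 2 > 0" using cR' hj by simp
  ultimately have "ln (real (card R') ^ k * real (h choose j) ^ 2) \<le> ln (real p * real D ^ (2 * k + 2))"
    by (intro ln_mono) auto
  moreover have "ln (real (card R') ^ k * real (h choose j) ^ 2) = real k * r + 2 * ln (real (h choose j))"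
  proof -
    have "ln (real (card R') ^ k * real (h choose j) ^ 2) = ln (real (card R') ^ k) + ln (real (h choose j) ^ 2)"
      using cR' hj by (intro ln_mult_pos) auto
    then show ?thesis using cR' hj by (simp add: ln_realpow r_def)
  qed
  moreover have "ln (real p * real D ^ (2 * k + 2)) = \<l> + real (2 * k + 2) * d"
  proof -
    have "ln (real p * real D ^ (2 * k + 2)) = ln (real p) + ln (real D ^ (2 * k + 2))"
      using p1 D1 by (intro ln_mult_pos) auto
    moreover have "ln (real D ^ (2 * k + 2)) = real (2 * k + 2) * d" using D1 ln_realpow[of "real D" "2 * k + 2"] by (simp only: d_def)
    ultimately show ?thesis by (simp add: \<l>_def)
  qed
  ultimately have "real k * r + 2 * (\<beta> * (real j * x)) \<le> \<l> + real (2 * k + 2) * d" using bin by linarith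
  moreover have "real j * x > \<l> - real k * y - x" using j(2) by (simp add: distrib_right)
  then have "2 * \<beta> * (real j * x) \<ge> 2 * \<beta> * (\<l> - real k * y - x)" by (intro mult_left_mono) (auto simp: \<beta>_def)
  ultimately have 1: "real k * r \<le> \<l> + real (2 * k + 2) * d - 2 * \<beta> * (\<l> - real k * y - x)" by simp
  have k6: "6 * \<l> \<le> real k * \<l>" "6 * d \<le> real k * d" using k(1) l0 d(1) by (intro mult_right_mono; simp)+
  have "\<l> < real k * y + y" using k(3) by (simp add: distrib_right)
  have "real (2 * k + 2) * d = 2 * (real k * d) + 2 * d" by (simp add: algebra_simps)
  then have "real k * r \<le> real k * y + 27 / 10000 * (real k * \<l>) + 3 * (real k * d)"
  proof -
    \<comment> \<open>Writing 422/463 = 1 - 41/463 and using ln p < (k + 1) y turns the right-hand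
      side into k y plus small terms.\<close>
    have "2 * \<beta> * (\<l> - real k * y - x) = 422 / 463 * \<l> - 422 / 463 * (real k * y) - 422 / 463 * x"
      by (simp add: \<beta>_def field_simps)
    then have "real k * r \<le> 41 / 463 * \<l> + 2 * (real k * d) + 2 * d + 422 / 463 * (real k * y) + 422 / 463 * x"
      using 1 \<open>real (2 * k + 2) * d = _\<close> by linarith
    moreover have "41 / 463 * \<l> \<le> 41 / 463 * (real k * y) + 41 / 463 * y"
      using \<open>\<l> < real k * y + y\<close> by linarith
    moreover have "41 / 463 * y + 422 / 463 * x \<le> 27 / 10000 * (6 * \<l>)" using xl yl l0 by linarith
    moreover have "27 / 10000 * (6 * \<l>) \<le> 27 / 10000 * (real k * \<l>)" using k6 by (intro mult_left_mono) auto
    moreover have "2 * d \<le> real k * d" using k6 d(1) by linarith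
    ultimately show ?thesis by linarith
  qed
  then have "real k * r \<le> real k * (y + \<l> * (27 / 10000) + 3 * d)" by (simp add: algebra_simps)
  then have r: "r \<le> y + \<l> * (27 / 10000) + 3 * d" using k(1) by simp
  have "real (card R) \<le> real D ^ 2 * real (card R')"
    using V unfolding R'_def[symmetric] by (metis of_nat_le_iff of_nat_mult of_nat_power)
  then have "ln (real (card R)) \<le> ln (real D ^ 2 * real (card R'))" using cR by (intro ln_mono) auto
  also have "\<dots> = 2 * d + r" using D1 cR' by (simp add: ln_mult ln_realpow d_def r_def)
  finally have "ln (real (card R)) \<le> y + \<l> / 250 + 5 * ln C" using r d l0 by linarith
  then show ?thesis by (simp add: R_def y_def \<l>_def)
qed

section \<open>Counting pairs in a common coset\<close>

lemma same_coset_imp_pow_cong: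
  assumes "prime p" "same_coset p a b"
  shows "[int a ^ (p - 1) = int b ^ (p - 1)] (mod int p ^ 2)"
proof -
  obtain g where g: "g \<in> unit_roots p" "[int a * g = int b] (mod int p ^ 2)" using assms by (auto simp: same_coset_def)
  have "[int a ^ (p - 1) * g ^ (p - 1) = int b ^ (p - 1)] (mod int p ^ 2)"
    using cong_pow[OF g(2), of "p - 1"] by (simp only: power_mult_distrib)
  moreover have "[int a ^ (p - 1) * g ^ (p - 1) = int a ^ (p - 1) * 1] (mod int p ^ 2)"
    by (intro cong_mult cong_refl unit_rootsD(1)[OF g(1)])
  ultimately show ?thesis by (metis cong_sym cong_trans mult.right_neutral)
qed

text \<open>Division by the gcd g leaves a reduced pair of height at most (Q - 1) / g, and g, being
  less than p, cancels from the congruence of powers.\<close>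

lemma card_coset_pairs_le:
  assumes p: "prime p" and Q: "Q \<le> p"
  shows "card (coset_pairs p Q) \<le> (\<Sum>g\<in>{1..<Q}. card (reduced_pairs p ((Q - 1) div g)))"
proof -
  define \<phi> where "\<phi> = (\<lambda>(a :: nat, b). (gcd a b, (a div gcd a b, b div gcd a b)))"
  have "inj_on \<phi> (coset_pairs p Q)"
  proof (rule inj_onI)
    fix x y assume "\<phi> x = \<phi> y"
    moreover obtain a b c d where "x = (a, b)" "y = (c, d)" by fastforce
    ultimately show "x = y" unfolding \<phi>_def by (simp; metis dvd_mult_div_cancel gcd_dvd1 gcd_dvd2)
  qed
  moreover have "\<phi> ` coset_pairs p Q \<subseteq> (SIGMA g:{1..<Q}. reduced_pairs p ((Q - 1) div g))"
  proof
    fix z assume "z \<in> \<phi> ` coset_pairs p Q"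
    then obtain a b where z: "z = \<phi> (a, b)" and ab: "a \<in> {1..<Q}" "b \<in> {1..<Q}" "same_coset p a b"
      by (auto simp: coset_pairs_def)
    define g where "g = gcd a b"
    have g0: "g > 0" "g \<le> a" using ab(1) by (auto simp: g_def intro: gcd_le1_nat)
    obtain a' b' where a: "a = g * a'" and b: "b = g * b'" unfolding g_def by (meson dvdE gcd_dvd1 gcd_dvd2)
    have "a' = a div g" "b' = b div g" using g0 a b by simp_all
    moreover have "coprime (a div g) (b div g)" unfolding g_def using ab(1) by (intro div_gcd_coprime) auto
    ultimately have cop: "coprime a' b'" by simp
    have "a div g \<le> (Q - 1) div g" "b div g \<le> (Q - 1) div g" using ab by (auto intro!: div_le_mono)
    then have le: "a' \<le> (Q - 1) div g" "b' \<le> (Q - 1) div g" using \<open>a' = a div g\<close> \<open>b' = b div g\<close> by simp_all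
    have pos: "a' > 0" "b' > 0" using ab a b by (auto intro: gr0I)
    have "\<not> int p dvd int g" using g0 ab(1) Q by (auto simp: int_dvd_int_iff dest: dvd_imp_le)
    then have cg: "coprime (int g ^ (p - 1)) (int p ^ 2)" using not_dvd_coprime_square[OF p] coprime_power_left_iff by blast
    have "[int g ^ (p - 1) * int a' ^ (p - 1) = int g ^ (p - 1) * int b' ^ (p - 1)] (mod int p ^ 2)"
      using same_coset_imp_pow_cong[OF p ab(3)] unfolding a b by (simp add: power_mult_distrib)
    then have "[int a' ^ (p - 1) = int b' ^ (p - 1)] (mod int p ^ 2)" using cg cong_mult_lcancel by blast
    then have "(a', b') \<in> reduced_pairs p ((Q - 1) div g)" using cop le pos by (auto simp: reduced_pairs_def)
    moreover have "z = (g, (a', b'))" using z \<open>a' = a div g\<close> \<open>b' = b div g\<close> by (simp add: \<phi>_def g_def)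
    ultimately show "z \<in> (SIGMA g:{1..<Q}. reduced_pairs p ((Q - 1) div g))" using g0 ab(1) by auto
  qed
  ultimately have "card (coset_pairs p Q) \<le> card (SIGMA g:{1..<Q}. reduced_pairs p ((Q - 1) div g))"
    by (intro card_inj_on_le) auto
  also have "\<dots> = (\<Sum>g\<in>{1..<Q}. card (reduced_pairs p ((Q - 1) div g)))" by (rule card_SigmaI) auto
  finally show ?thesis .
qed

lemma sum_inverse_le_ln: "n \<ge> 1 \<Longrightarrow> (\<Sum>g\<in>{1..n}. 1 / real g) \<le> 1 + ln (real n)"
proof (induction n rule: dec_induct)
  case (step n)
  have n0: "real n > 0" using step.hyps by simp
  have "ln (real n / real (Suc n)) \<le> real n / real (Suc n) - 1" using n0 by (intro ln_le_minus_one) auto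
  then have "1 / real (Suc n) \<le> ln (real (Suc n)) - ln (real n)" using n0 by (simp add: ln_div field_simps)
  then show ?case using step.IH by simp
qed simp

text \<open>Summing the bound for heights Q / g over g costs one logarithm. The diagonal already
  supplies Q - 1 pairs, so only the small power of p and the logarithm are lost.\<close>

lemma card_coset_pairs_bound:
  assumes p: "prime p" and C: "C \<ge> 1" "\<And>n. n > 0 \<Longrightarrow> real (num_divisors n) \<le> C * real n powr (1 / 5000)"
    and l: "ln (real p) \<ge> 10" and X: "2 \<le> X" "1000 * ln (real X) \<le> ln (real p)"
    and P: "unit_root_family p X P"
    and card_P: "30 * (ln (real p) / ln (real X)) * real X powr (211 / 463) \<le> real (card P)"
    and Q: "2 \<le> Q" "6 * ln (real Q) \<le> ln (real p)"
  shows "real (card (coset_pairs p Q)) \<le> C ^ 5 * real p powr (1 / 250) * real Q * (1 + ln (real p))"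
proof -
  have p1: "real p > 1" using prime_gt_1_nat[OF p] by simp
  have lQ: "0 \<le> ln (real Q)" using Q by simp
  have "ln (real Q) \<le> ln (real p)" using Q(2) lQ by linarith
  then have Qp: "Q \<le> p" using Q p1 by simp
  define c where "c = C ^ 5 * real p powr (1 / 250)"
  have c0: "c > 0" using C p1 by (simp add: c_def)
  have red: "real (card (reduced_pairs p ((Q - 1) div g))) \<le> c * (real Q * (1 / real g))" if g: "g \<in> {1..Q - 1}" for g
  proof -
    define Y where "Y = (Q - 1) div g"
    have Y1: "1 \<le> Y" using g by (simp add: Y_def div_greater_zero_iff Suc_le_eq)
    have YQ: "real Y \<le> real Q * (1 / real g)"
    proof -
      have "Y * g \<le> Q" unfolding Y_def using div_times_less_eq_dividend[of "Q - 1" g] by linarith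
      then have "real Y * real g \<le> real Q" by (metis of_nat_le_iff of_nat_mult)
      then show ?thesis using g by (simp add: field_simps)
    qed
    have "Y \<le> Q" unfolding Y_def using div_le_dividend[of "Q - 1" g] by linarith
    then have "ln (real Y) \<le> ln (real Q)" using Y1 by (intro ln_mono) auto
    then have "6 * ln (real Y) \<le> ln (real p)" using Q(2) by linarith
    from ln_card_reduced_pairs_le[OF p C l X P card_P Y1 this]
    have le: "ln (real (card (reduced_pairs p Y))) \<le> ln (real Y) + ln (real p) / 250 + 5 * ln C" .
    have eq: "ln (real Y) + ln (real p) / 250 + 5 * ln C = ln (c * real Y)"
    proof -
      have "ln (c * real Y) = ln c + ln (real Y)" using c0 Y1 by (simp add: ln_mult_pos)
      moreover have "ln c = ln (C ^ 5) + ln (real p powr (1 / 250))" unfolding c_def using C p1 by (intro ln_mult_pos) auto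
      ultimately show ?thesis using C p1 by (simp add: ln_realpow ln_powr)
    qed
    have "real (card (reduced_pairs p Y)) \<le> c * real Y"
    proof (cases "card (reduced_pairs p Y) = 0")
      case True then show ?thesis using c0 by simp
    next
      case False
      then have "real (card (reduced_pairs p Y)) > 0" by (metis of_nat_0_less_iff gr0I)
      moreover have "c * real Y > 0" using c0 Y1 by simp
      ultimately show ?thesis using le unfolding eq by (simp only: ln_le_cancel_iff)
    qed
    also have "\<dots> \<le> c * (real Q * (1 / real g))" using YQ c0 by (intro mult_left_mono) auto
    finally show ?thesis by (simp add: Y_def)
  qed
  have int: "{1..<Q} = {1..Q - 1}" by auto
  have "real (card (coset_pairs p Q)) \<le> real (\<Sum>g\<in>{1..<Q}. card (reduced_pairs p ((Q - 1) div g)))"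
    using card_coset_pairs_le[OF p Qp] of_nat_le_iff by blast
  also have "\<dots> \<le> (\<Sum>g\<in>{1..Q - 1}. c * (real Q * (1 / real g)))"
    unfolding of_nat_sum int by (intro sum_mono red)
  also have "\<dots> = c * real Q * (\<Sum>g\<in>{1..Q - 1}. 1 / real g)" unfolding sum_distrib_left by (simp only: mult.assoc)
  also have "\<dots> \<le> c * real Q * (1 + ln (real p))"
  proof (intro mult_left_mono)
    have "(\<Sum>g\<in>{1..Q - 1}. 1 / real g) \<le> 1 + ln (real (Q - 1))" using Q by (intro sum_inverse_le_ln) simp
    also have "ln (real (Q - 1)) \<le> ln (real p)" using Q Qp by (intro ln_mono) auto
    finally show "(\<Sum>g\<in>{1..Q - 1}. 1 / real g) \<le> 1 + ln (real p)" by simp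
  qed (use c0 in simp)
  finally show ?thesis by (simp add: c_def)
qed

lemma binomial_card_family_le:
  assumes P: "unit_root_family p X P" and XH: "X ^ j \<le> H"
  shows "card P choose j \<le> card (small_units p H)"
proof -
  have fin: "finite P" using P by (simp add: unit_root_family_def)
  define Sel where "Sel = {S. S \<subseteq> P \<and> card S = j}"
  have "inj_on Prod Sel"
    using P inj_on_subset[OF inj_on_Prod_pairwise_coprime[OF fin]]
    unfolding Sel_def unit_root_family_def by (metis (no_types, lifting) Collect_mono Pow_def)
  moreover have "Prod ` Sel \<subseteq> small_units p H"
  proof safe
    fix S assume "S \<in> Sel"
    then have S: "finite S" "card S = j" "\<And>w. w \<in> S \<Longrightarrow> 1 < w \<and> w \<le> X \<and> is_unit_root p w"
      using P fin by (auto simp: Sel_def unit_root_family_def intro: finite_subset)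
    have "0 < \<Prod>S" using S by (intro prod_pos) force
    moreover have "\<Prod>S \<le> X ^ j" using prod_le_power[of S "\<lambda>w. w" X] S by simp
    moreover have "is_unit_root p (\<Prod>S)" using S by (intro is_unit_root_prod) auto
    ultimately show "\<Prod>S \<in> small_units p H"
      using XH unfolding small_units_def is_unit_root_def mem_Collect_eq atLeastAtMost_iff by (intro conjI) linarith+
  qed
  moreover have "finite (small_units p H)" by (rule finite_subset[of _ "{1..H}"]) (auto simp: small_units_def)
  ultimately have "card Sel \<le> card (small_units p H)" by (rule card_inj_on_le)
  then show ?thesis unfolding Sel_def using n_subsets[OF fin] by simp
qed

text \<open>For Q near p^(1/6) the fourth power of the total of the sums is at most Q^2 (Q
  p^(1/250)) p p^(5/2), which is p^(4 + 1/250), up to constants and logarithms. Its fourth root p^(1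
  + 1/1000), divided by Q, gives the exponent 5/6 + 1/1000. The upper bound on ln Q serves the first
  step and the lower bound the division.\<close>

lemma ln_card_small_units_le:
  assumes p: "prime p" and C: "C \<ge> 1" "\<And>n. n > 0 \<Longrightarrow> real (num_divisors n) \<le> C * real n powr (1 / 5000)"
    and l: "ln (real p) \<ge> 10" and X: "2 \<le> X" "1000 * ln (real X) \<le> ln (real p)"
    and P: "unit_root_family p X P"
    and card_P: "30 * (ln (real p) / ln (real X)) * real X powr (211 / 463) \<le> real (card P)"
    and p512: "512 \<le> p"
    and Q: "2 \<le> Q" "6 * ln (real Q) \<le> ln (real p)" "ln (real p) / 6 \<le> ln (2 * real Q)"
    and H: "6 * H * Q \<le> p ^ 2" and N: "card (small_units p H) > 0"
  shows "ln (real (card (small_units p H))) \<le> (5 / 6 + 1 / 1000) * ln (real p) + ln (1 + ln (real p)) + 12 + 2 * ln C"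
proof -
  define \<l> where "\<l> = ln (real p)"
  have p1: "real p > 1" using prime_gt_1_nat[OF p] by simp
  have l0: "\<l> \<ge> 10" using l by (simp add: \<l>_def)
  have odd: "odd p" using p p512 prime_odd_nat[of p] by simp
  have lQ: "0 \<le> ln (real Q)" using Q by simp
  have "ln (real Q) \<le> ln (real p)" using Q(2) lQ by linarith
  then have Qp: "Q \<le> p" using Q(1) p1 by simp
  define s where "s = (\<Sum>a\<in>{1..<Q}. norm (exp_sum p (int a)))"
  define T where "T = real (card (coset_pairs p Q))"
  define E where "E = real (card (energy_quads p))"
  \<comment> \<open>Passing to the maximum lets one logarithmic bound cover p + 2 s \<le> 3 M,
    including the case where s is small or 0.\<close>
  define M where "M = max (real p) s"
  have s0: "s \<ge> 0" by (simp add: s_def sum_nonneg)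
  have sM: "ln M \<le> \<l> + \<l> / 1000 + ln (1 + \<l>) + 5 / 4 * ln C + 6"
  proof (cases "s \<le> real p")
    case True
    then have "ln M = \<l>" by (simp add: M_def \<l>_def)
    moreover have "ln (1 + \<l>) \<ge> 0" "ln C \<ge> 0" using l0 C by auto
    ultimately show ?thesis using l0 by linarith
  next
    case False
    then have Ms: "M = s" "s > 0" using p1 by (auto simp: M_def)
    have main: "real (p - 1) * s ^ 4 \<le> real Q ^ 2 * T * (real p ^ 2 * E)"
      using exp_sum_average[OF p Qp] by (simp add: s_def T_def E_def)
    have T: "T \<le> C ^ 5 * real p powr (1 / 250) * real Q * (1 + \<l>)"
      using card_coset_pairs_bound[OF p C l X P card_P Q(1,2)] by (simp add: T_def \<l>_def)
    have E: "E \<le> 2401 * real p ^ 2 * sqrt (real p)" using energy_bound[OF p odd p512] by (simp add: E_def)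
    have p2: "real p / 2 \<le> real (p - 1)" using p512 by simp
    have "real p / 2 * s ^ 4 \<le> real (p - 1) * s ^ 4" using p2 by (intro mult_right_mono) auto
    also note main
    also have "real Q ^ 2 * T * (real p ^ 2 * E)
        \<le> real Q ^ 2 * (C ^ 5 * real p powr (1 / 250) * real Q * (1 + \<l>)) * (real p ^ 2 * (2401 * real p ^ 2 * sqrt (real p)))"
      using T E l0 C by (intro mult_mono) (auto simp: T_def E_def)
    finally have le: "real p / 2 * s ^ 4
        \<le> real Q ^ 2 * (C ^ 5 * real p powr (1 / 250) * real Q * (1 + \<l>)) * (real p ^ 2 * (2401 * real p ^ 2 * sqrt (real p)))" .
    have "ln (real p / 2 * s ^ 4)
        \<le> ln (real Q ^ 2 * (C ^ 5 * real p powr (1 / 250) * real Q * (1 + \<l>)) * (real p ^ 2 * (2401 * real p ^ 2 * sqrt (real p))))"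
      using le p1 Ms by (intro ln_mono) auto
    moreover have "ln (real p / 2 * s ^ 4) = \<l> - ln 2 + 4 * ln s"
      using p1 Ms by (simp add: ln_mult_pos ln_div ln_realpow \<l>_def)
    moreover have "ln (real Q ^ 2 * (C ^ 5 * real p powr (1 / 250) * real Q * (1 + \<l>)) * (real p ^ 2 * (2401 * real p ^ 2 * sqrt (real p))))
       = 2 * ln (real Q) + (5 * ln C + \<l> / 250 + ln (real Q) + ln (1 + \<l>)) + (2 * \<l> + (ln 2401 + 2 * \<l> + \<l> / 2))"
      using p1 Q(1) C l0 by (simp add: ln_mult_pos ln_realpow ln_powr ln_sqrt \<l>_def)
    ultimately have "4 * ln s \<le> 4 * \<l> + \<l> / 250 + ln (1 + \<l>) + 5 * ln C + ln 2401 + ln 2"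
      using Q(2) by (simp add: \<l>_def)
    moreover have "ln 2401 + ln 2 \<le> (24 :: real)"
    proof -
      have "ln (2401 :: real) \<le> ln (2 ^ 12)" by (intro ln_mono) auto
      also have "\<dots> = 12 * ln 2" by (subst ln_realpow) auto
      finally show ?thesis using ln_2_less_1 by linarith
    qed
    moreover have "ln (1 + \<l>) \<ge> 0" using l0 by simp
    ultimately show ?thesis unfolding Ms(1) by linarith
  qed
  have "real Q * real (card (small_units p H)) \<le> 4 * (real p + 2 * s)"
    using card_small_units_le[OF p H] Q(1) by (simp add: s_def)
  also have "\<dots> \<le> 12 * M" by (simp add: M_def)
  finally have "ln (real Q * real (card (small_units p H))) \<le> ln (12 * M)"
    using Q(1) N by (intro ln_mono) auto
  moreover have "ln (real Q * real (card (small_units p H))) = ln (real Q) + ln (real (card (small_units p H)))"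
    using Q(1) N by (intro ln_mult_pos) auto
  moreover have "ln (12 * M) = ln 12 + ln M" using p1 by (intro ln_mult_pos) (auto simp: M_def)
  moreover have "ln (2 * real Q) = ln 2 + ln (real Q)" using Q(1) by (intro ln_mult_pos) auto
  moreover have "ln 12 + ln 2 \<le> (5 :: real)"
  proof -
    have "ln (12 :: real) \<le> ln (2 ^ 4)" by (intro ln_mono) auto
    also have "\<dots> = 4 * ln 2" by (subst ln_realpow) auto
    finally show ?thesis using ln_2_less_1 by linarith
  qed
  moreover have "ln C \<ge> 0" using C by simp
  ultimately show ?thesis using sM Q(3) unfolding \<l>_def by (simp add: algebra_simps)
qed

text \<open>\<open>K\<close> will collect all additive constants, including ln C from the divisor
  bound; the allowance t / 10000 is part of the margin between 5/11 and 211/463.\<close>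

lemma eventually_ln_dominates:
  "\<exists>t\<^sub>0\<ge>10. \<forall>t\<ge>t\<^sub>0. ln (1 + t) + K < t / 10000" for K :: real
proof -
  have "eventually (\<lambda>t::real. ln (1 + t) + K < t / 10000) at_top" by real_asymp
  then obtain t where t: "\<And>s. s \<ge> t \<Longrightarrow> ln (1 + s) + K < s / 10000" by (auto simp: eventually_at_top_linorder)
  have "ln (1 + s) + K < s / 10000" if "s \<ge> max 10 t" for s by (rule t) (use that in simp)
  then show ?thesis by (intro exI[of _ "max 10 t"]) simp
qed

text \<open>A family exceeding the bound is used twice: it supplies the extra fractions for the
  coset count, and the products of j members give at least X^(211 j / 463) elements of G up to H. As
  X^j is within a factor X \<le> p^(1/1000) of H, the contradiction rests on (211/463) (11/6 -
  1/1000) > 5/6 + 1/1000 + 1/10000.\<close>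

lemma unit_root_family_small_bound:
  "\<exists>t\<^sub>0\<ge>10. \<forall>p X P. prime p \<longrightarrow> t\<^sub>0 \<le> ln (real p) \<longrightarrow> 2 \<le> X \<longrightarrow> 1000 * ln (real X) \<le> ln (real p) \<longrightarrow> unit_root_family p X P
     \<longrightarrow> real (card P) \<le> 30 * (ln (real p) / ln (real X)) * real X powr (211 / 463)"
proof -
  obtain C where C: "C \<ge> 1" "\<And>n. n > 0 \<Longrightarrow> real (num_divisors n) \<le> C * real n powr (1 / 5000)"
    using num_divisors_bound[of "1 / 5000"] by auto
  obtain t\<^sub>0 where t0: "t\<^sub>0 \<ge> 10" "\<And>t. t \<ge> t\<^sub>0 \<Longrightarrow> ln (1 + t) + (20 + 2 * ln C) < t / 10000"
    using eventually_ln_dominates by blast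
  show ?thesis
  proof (intro exI[of _ t\<^sub>0] conjI t0 allI impI)
    fix p X P assume p: "prime p" and tp: "t\<^sub>0 \<le> ln (real p)" and X: "2 \<le> X" "1000 * ln (real X) \<le> ln (real p)"
      and P: "unit_root_family p X P"
    define \<l> where "\<l> = ln (real p)"
    define x where "x = ln (real X)"
    have l0: "\<l> \<ge> 10" using tp t0 by (simp add: \<l>_def)
    have p1: "real p > 1" using prime_gt_1_nat[OF p] by simp
    have x0: "x > 0" "1000 * x \<le> \<l>" using X by (simp_all add: x_def \<l>_def)
    show "real (card P) \<le> 30 * (ln (real p) / ln (real X)) * real X powr (211 / 463)"
    proof (rule ccontr)
      assume "\<not> ?thesis"
      then have card_P: "30 * (ln (real p) / ln (real X)) * real X powr (211 / 463) \<le> real (card P)" by simp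
      have lC: "ln C \<ge> 0" using C by simp
      have big: "\<l> > 10000 * 20"
      proof -
        have "ln (1 + \<l>) + (20 + 2 * ln C) < \<l> / 10000" using t0(2) tp by (simp add: \<l>_def)
        moreover have "ln (1 + \<l>) \<ge> 0" using l0 by simp
        ultimately show ?thesis using lC by linarith
      qed
      define w where "w = exp (\<l> / 6)"
      have w: "w \<ge> 2" using exp_ge_add_one_self[of "\<l> / 6"] big unfolding w_def by linarith
      have w6: "w ^ 6 = real p"
      proof -
        have "w ^ 6 = exp (6 * (\<l> / 6))" unfolding w_def by (subst exp_of_nat_mult[symmetric]) simp
        then show ?thesis using p1 by (simp add: \<l>_def)
      qed
      define Q where "Q = nat \<lfloor>w\<rfloor>"
      have Q: "real Q \<le> w" "w \<le> 2 * real Q" "2 \<le> Q"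
      proof -
        have "\<lfloor>w\<rfloor> \<ge> 2" using w by linarith
        then have "real Q = real_of_int \<lfloor>w\<rfloor>" "real_of_int \<lfloor>w\<rfloor> \<ge> 2" by (simp_all add: Q_def)
        then show "real Q \<le> w" "w \<le> 2 * real Q" "2 \<le> Q" using w by linarith+
      qed
      have lnQ: "6 * ln (real Q) \<le> ln (real p)"
      proof -
        have "ln (real Q) \<le> ln w" using Q by (intro ln_mono) auto
        then show ?thesis by (simp add: w_def \<l>_def)
      qed
      have lnQ2: "ln (real p) / 6 \<le> ln (2 * real Q)"
      proof -
        have "ln w \<le> ln (2 * real Q)" using Q w by (intro ln_mono) auto
        then show ?thesis by (simp add: w_def \<l>_def)
      qed
      have w_le: "12 * w \<le> real p ^ 2"
      proof -
        have "w ^ 5 \<ge> 2 ^ 5" using w by (intro power_mono) auto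
        then have "12 * w \<le> w ^ 5 * w" using w by (intro mult_right_mono) auto
        also have "w ^ 5 * w = real p" by (simp flip: w6 power_Suc2)
        also have "\<dots> \<le> real p ^ 2" using p1 by (simp add: self_le_power)
        finally show ?thesis .
      qed
      \<comment> \<open>The largest length compatible with 6 H Q \<le> p^2, so ln H is (11/6) ln p
        up to a bounded amount.\<close>
      define H where "H = p ^ 2 div (6 * Q)"
      have H: "6 * H * Q \<le> p ^ 2"
        unfolding H_def using div_times_less_eq_dividend[of "p ^ 2" "6 * Q"] by (simp add: ac_simps)
      have H1: "H \<ge> 1" "real p ^ 2 \<le> 12 * w * real H"
      proof -
        have lt: "p ^ 2 < 6 * Q * (H + 1)" unfolding H_def using dividend_less_times_div[of "6 * Q" "p ^ 2"] Q by simp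
        have "6 * Q \<le> p ^ 2"
        proof -
          have "real (6 * Q) \<le> real (p ^ 2)" using w_le Q w by simp
          then show ?thesis by linarith
        qed
        then show "H \<ge> 1" unfolding H_def using Q by (simp add: div_greater_zero_iff Suc_le_eq)
        then have "H + 1 \<le> 2 * H" by simp
        then have "6 * Q * (H + 1) \<le> 6 * Q * (2 * H)" by (rule mult_le_mono2)
        then have "p ^ 2 \<le> 6 * Q * (2 * H)" using lt by linarith
        then have "real (p ^ 2) \<le> real (6 * Q * (2 * H))" using of_nat_le_iff by blast
        then have "real p ^ 2 \<le> 12 * real Q * real H" by simp
        also have "\<dots> \<le> 12 * w * real H" using Q by (intro mult_right_mono) auto
        finally show "real p ^ 2 \<le> 12 * w * real H" .
      qed
      have lnH: "11 / 6 * \<l> - 3 \<le> ln (real H)" "ln (real H) \<le> 2 * \<l>"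
      proof -
        have "ln (real p ^ 2) \<le> ln (12 * w * real H)" using H1 p1 by (intro ln_mono) auto
        also have "ln (12 * w * real H) = ln 12 + \<l> / 6 + ln (real H)" using w H1 by (simp add: ln_mult_pos) (simp add: w_def)
        also have "ln (real p ^ 2) = 2 * \<l>" using p1 by (simp add: ln_realpow \<l>_def)
        finally have "2 * \<l> \<le> ln 12 + \<l> / 6 + ln (real H)" .
        moreover have "ln 12 \<le> (3 :: real)"
        proof -
          have "(12 :: real) \<le> (1 + 3 / 2 + (3 / 2) ^ 2 / 2) ^ 2" by (simp add: power2_eq_square)
          also have "\<dots> \<le> exp (3 / 2) ^ 2" by (intro power_mono exp_lower_Taylor_quadratic) auto
          also have "\<dots> = exp 3" by (simp add: power2_eq_square flip: exp_add)
          finally have "ln 12 \<le> ln (exp (3 :: real))" by (intro ln_mono) auto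
          then show ?thesis by simp
        qed
        ultimately show "11 / 6 * \<l> - 3 \<le> ln (real H)" by linarith
        have "H \<le> p ^ 2" unfolding H_def by (rule div_le_dividend)
        then have "real H \<le> real p ^ 2" by (metis of_nat_le_iff of_nat_power)
        then have "ln (real H) \<le> ln (real p ^ 2)" using H1 by (intro ln_mono) auto
        then show "ln (real H) \<le> 2 * \<l>" using p1 by (simp add: ln_realpow \<l>_def)
      qed
      have p512: "512 \<le> p"
      proof -
        have "\<l> + 1 \<le> real p" using exp_ge_add_one_self[of \<l>] p1 by (simp add: \<l>_def)
        then have "512 \<le> real p" using big by linarith
        then show ?thesis by simp
      qed
      define j where "j = nat \<lfloor>ln (real H) / x\<rfloor>"
      have j: "real j * x \<le> ln (real H)" "ln (real H) < (real j + 1) * x"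
      proof -
        have "0 \<le> ln (real H) / x" using H1 x0 by simp
        then have "real j \<le> ln (real H) / x" "ln (real H) / x < real j + 1" unfolding j_def by linarith+
        then show "real j * x \<le> ln (real H)" "ln (real H) < (real j + 1) * x" using x0 by (simp_all add: field_simps)
      qed
      have XH: "X ^ j \<le> H"
      proof -
        have "ln (real X ^ j) \<le> ln (real H)" using j X by (simp add: ln_realpow x_def)
        then have "real X ^ j \<le> real H" using X H1 by (subst (asm) ln_le_cancel_iff) auto
        then show ?thesis by (metis of_nat_le_iff of_nat_power)
      qed
      have Xb: "real X powr (211 / 463) \<ge> 1" using X by (simp add: ge_one_powr_ge_zero)
      have jA: "real j * real X powr (211 / 463) \<le> real (card P)"
      proof -
        have "real j \<le> ln (real H) / x" using j x0 by (simp add: field_simps)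
        also have "\<dots> \<le> 30 * (\<l> / x)" using lnH l0 x0 by (simp add: field_simps)
        finally have "real j * real X powr (211 / 463) \<le> 30 * (\<l> / x) * real X powr (211 / 463)"
          using Xb by (intro mult_right_mono) auto
        then show ?thesis using card_P by (simp add: \<l>_def x_def)
      qed
      have jP: "j \<le> card P"
      proof -
        have "real j * 1 \<le> real j * real X powr (211 / 463)" using Xb by (intro mult_left_mono) auto
        then show ?thesis using jA by simp
      qed
      have le: "card P choose j \<le> card (small_units p H)" by (rule binomial_card_family_le[OF P XH])
      have bpos: "card P choose j > 0" using jP by (simp add: zero_less_binomial)
      then have N: "card (small_units p H) > 0" using le by linarith
      have "real j * (211 / 463 * x) \<le> ln (real (card P choose j))"
        using ln_binomial_ge[OF Xb jA] X by (simp add: ln_powr x_def)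
      also have "\<dots> \<le> ln (real (card (small_units p H)))" using le bpos by (intro ln_mono) auto
      also have "\<dots> \<le> (5 / 6 + 1 / 1000) * \<l> + ln (1 + \<l>) + 12 + 2 * ln C"
        using ln_card_small_units_le[OF p C _ X P card_P p512 Q(3) lnQ lnQ2 H N] l0 by (simp add: \<l>_def)
      finally have "211 / 463 * (real j * x) \<le> (5 / 6 + 1 / 1000) * \<l> + ln (1 + \<l>) + 12 + 2 * ln C" by simp
      moreover have "real j * x > 11 / 6 * \<l> - 3 - \<l> / 1000" using j(2) lnH(1) x0 by (simp add: distrib_right)
      then have "211 / 463 * (real j * x) > 211 / 463 * (11 / 6 * \<l> - 3 - \<l> / 1000)" by simp
      \<comment> \<open>The subtracted 2 covers the rounding term 3 * 211/463; together with the 12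
        of the count it fits into the 20 used in the choice of \<open>t\<^sub>0\<close>.\<close>
      moreover have "211 / 463 * (11 / 6 * \<l> - 3 - \<l> / 1000) \<ge> (5 / 6 + 1 / 1000) * \<l> + \<l> / 10000 - 2"
        using l0 by (simp add: field_simps)
      moreover have "ln (1 + \<l>) + (20 + 2 * ln C) < \<l> / 10000" using t0(2) tp by (simp add: \<l>_def)
      ultimately show False by linarith
    qed
  qed
qed

text \<open>Here card G = p - 1 is compared with products up to p^2. For the largest k with X^k
  \<le> p^2 rounding may lose a factor X, but X \<le> p gives k \<ge> 2 and so X^k > p^(4/3). This
  yields the exponent 3/4 where exact division would give 1/2.\<close>

lemma unit_root_family_trivial_bound:
  assumes p: "prime p" and X: "2 \<le> X" "X \<le> p" and P: "unit_root_family p X P"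
  shows "real (card P) \<le> 2 * (ln (real p) / ln (real X)) * real X powr (3 / 4)"
proof -
  define \<l> where "\<l> = ln (real p)"
  define x where "x = ln (real X)"
  have p1: "real p > 1" using prime_gt_1_nat[OF p] by simp
  have x0: "x > 0" using X by (simp add: x_def)
  have xl: "x \<le> \<l>" using X by (simp add: x_def \<l>_def)
  define k where "k = nat \<lfloor>2 * \<l> / x\<rfloor>"
  have lx: "2 \<le> 2 * \<l> / x" using x0 xl by (simp add: field_simps)
  have k: "2 \<le> k" "real k * x \<le> 2 * \<l>" "2 * \<l> < (real k + 1) * x"
  proof -
    show "2 \<le> k" unfolding k_def using lx by linarith
    have "real k \<le> 2 * \<l> / x" "2 * \<l> / x < real k + 1" unfolding k_def using lx by linarith+
    then show "real k * x \<le> 2 * \<l>" "2 * \<l> < (real k + 1) * x" using x0 by (simp_all add: field_simps)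
  qed
  have kb: "real k \<le> 2 * (\<l> / x)" using k x0 by (simp add: field_simps)
  have Xb: "real X powr (3 / 4) \<ge> 1" using X by (simp add: ge_one_powr_ge_zero)
  have "real (card P) \<le> real k * real X powr (3 / 4)"
  proof (rule ccontr)
    assume neg: "\<not> ?thesis"
    define z where "z = real (card P) / real k"
    have z: "z > real X powr (3 / 4)" using neg k(1) by (simp add: z_def field_simps)
    have zk: "real k * z \<le> real (card P)" using k(1) by (simp add: z_def)
    have XH: "X ^ k \<le> p ^ 2"
    proof -
      have "ln (real X ^ k) \<le> ln (real p ^ 2)" using k X p1 by (simp add: ln_realpow x_def \<l>_def)
      then have "real X ^ k \<le> real p ^ 2" using X p1 by (subst (asm) ln_le_cancel_iff) auto
      then show ?thesis by (metis of_nat_le_iff of_nat_power)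
    qed
    have "card (small_units p (p ^ 2)) \<le> card (unit_roots p)"
    proof (rule card_inj_on_le[of int])
      show "int ` small_units p (p ^ 2) \<subseteq> unit_roots p"
      proof safe
        fix n assume n: "n \<in> small_units p (p ^ 2)"
        then have c: "[int n ^ (p - 1) = 1] (mod int p ^ 2)" "n \<le> p ^ 2" by (auto simp: small_units_def)
        have "\<not> int p dvd int n" by (rule unit_not_dvd[OF p c(1)])
        then have "n \<noteq> p ^ 2" by auto
        then have "n < p ^ 2" using c(2) by simp
        then have "int n < int p ^ 2" by (metis of_nat_less_iff of_nat_power)
        then show "int n \<in> unit_roots p" using c by (simp add: unit_roots_def)
      qed
    qed auto
    then have "card P choose k \<le> p"
      using binomial_card_family_le[OF P XH] card_unit_roots[OF p] by linarith
    moreover have kP: "k \<le> card P"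
    proof -
      have "real k * 1 \<le> real k * z" using z Xb by (intro mult_left_mono) auto
      then show ?thesis using zk by simp
    qed
    then have "card P choose k > 0" by (simp add: zero_less_binomial)
    ultimately have "ln (real (card P choose k)) \<le> \<l>" unfolding \<l>_def by (intro ln_mono) auto
    moreover have "real k * ln z \<le> ln (real (card P choose k))" using z Xb zk by (intro ln_binomial_ge) auto
    moreover have "ln z > 3 / 4 * x"
    proof -
      have "ln (real X powr (3 / 4)) < ln z"
        using z Xb ln_less_cancel_iff[of "real X powr (3 / 4)" z] by linarith
      then show ?thesis using X by (simp add: ln_powr x_def)
    qed
    then have "real k * ln z > real k * (3 / 4 * x)" using k(1) by simp
    ultimately have "3 / 4 * (real k * x) < \<l>" by simp
    moreover have "2 * x \<le> real k * x" using k(1) x0 by (intro mult_right_mono) auto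
    moreover have "2 * \<l> < real k * x + x" using k(3) by (simp add: distrib_right)
    ultimately show False by linarith
  qed
  also have "\<dots> \<le> 2 * (\<l> / x) * real X powr (3 / 4)" using kb Xb by (intro mult_right_mono) auto
  finally show ?thesis by (simp add: \<l>_def x_def)
qed

section \<open>The Ihara sum\<close>

text \<open>The bound n < p secures coprimality to p. It has to be strict: the quotient of p is 0 by
  convention, although p is not a root of unity.\<close>

lemma vanishing_imp_unit_root:
  assumes p: "prime p" and n: "0 < n" "n < p" "fermat_quotient p (int n) = 0"
  shows "is_unit_root p n"
proof -
  have "\<not> p dvd n" using n by (auto dest: dvd_imp_le)
  then have cop: "coprime (int n) (int p)" using p by (metis coprime_commute coprime_int_iff prime_imp_coprime)
  have "((int n ^ (p - 1) - 1) div int p) mod int p = 0" using fermat_quotient_eq_mod[OF p cop] n(3) by simp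
  then have "int p dvd (int n ^ (p - 1) - 1) div int p" by (simp add: dvd_eq_mod_eq_0)
  then have "int p * int p dvd int p * ((int n ^ (p - 1) - 1) div int p)" by (rule mult_dvd_mono[OF dvd_refl])
  also have "int p * ((int n ^ (p - 1) - 1) div int p) = int n ^ (p - 1) - 1"
    by (rule dvd_mult_div_cancel[OF fermat_quotient_exact[OF p cop]])
  finally show ?thesis by (simp add: is_unit_root_def cong_iff_dvd_diff power2_eq_square)
qed

text \<open>Two different powers of one prime differ by a factor of at least 2, so they cannot share
  the interval (X/2, X]; the underlying primes are therefore different.\<close>

lemma primepow_coprime_dyadic:
  fixes v w X :: nat
  assumes "primepow v" "primepow w" "X div 2 < v" "v \<le> X" "X div 2 < w" "w \<le> X" "v \<noteq> w"
  shows "coprime v w"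
proof -
  obtain q a where v: "prime q" "v = q ^ a" using assms(1) by (auto simp: primepow_def)
  obtain r b where w: "prime r" "w = r ^ b" using assms(2) by (auto simp: primepow_def)
  have impossible: False if "prime s" "s ^ m \<le> X" "X div 2 < s ^ l" "l < m" for s m l :: nat
  proof -
    have "2 * s ^ l \<le> s * s ^ l" using prime_ge_2_nat[OF that(1)] by (rule mult_le_mono1)
    also have "\<dots> \<le> s ^ m" unfolding power_Suc[symmetric] using that prime_gt_0_nat[OF that(1)] by (intro power_increasing) auto
    finally show False using that(2,3) by linarith
  qed
  have "q \<noteq> r"
  proof
    assume qr: "q = r"
    then have "a \<noteq> b" using assms(7) v w by auto
    then consider "a < b" | "b < a" by linarith
    then show False using impossible[of q b a] impossible[of q a b] assms v w qr by cases auto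
  qed
  then have "coprime q r" using v(1) w(1) by (rule primes_coprime[rotated 2])
  then show ?thesis unfolding v(2) w(2) by simp
qed

text \<open>
  The factors 13 and 12 come from \<open>13/12 \<le> 2^(1/8)\<close>, which makes the bound telescope.
\<close>

lemma dyadic_sum_bound:
  fixes f :: "nat \<Rightarrow> real"
  assumes ab: "a \<ge> 0" "b \<ge> 0" and s: "s \<ge> 1 / 8" "r \<ge> 1 / 8" and N: "N \<ge> 1"
    and step: "\<And>X. real X \<ge> N \<Longrightarrow> X \<le> M \<Longrightarrow> (\<Sum>n\<in>{X div 2<..X}. f n) \<le> a * real X powr (- s) + b * real X powr (- r)"
    and f: "\<And>n. f n \<ge> 0"
  shows "real X \<ge> N \<Longrightarrow> X \<le> M \<Longrightarrow> (\<Sum>n | N < real n \<and> n \<le> X. f n)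
    \<le> a * (13 * N powr (- s) - 12 * real X powr (- s)) + b * (13 * N powr (- r) - 12 * real X powr (- r))"
proof (induction X rule: less_induct)
  case (less X)
  have X1: "real X \<ge> 1" using less.prems N by linarith
  have mono: "real X powr (- u) \<le> N powr (- u)" if "u \<ge> 1 / 8" for u
    using less.prems N that by (intro powr_mono2') auto
  have half: "13 * real X powr (- u) \<le> 12 * real (X div 2) powr (- u)" if u: "u \<ge> 1 / 8" and h: "X div 2 \<ge> 1" for u
  proof -
    have "ln 2 * (1 / 8) \<le> ln 2 * u" using u by (intro mult_left_mono) auto
    moreover have "2 / 3 * (1 / 8) \<le> ln 2 * (1 / 8 :: real)" using ln2_ge_two_thirds by (intro mult_right_mono) auto
    moreover have "1 + ln 2 * u \<le> exp (ln 2 * u)" by (rule exp_ge_add_one_self)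
    ultimately have "13 / 12 \<le> exp (ln 2 * u)" by linarith
    then have 2: "13 / 12 \<le> 2 powr u" by (simp add: powr_def mult.commute)
    have "2 * real (X div 2) \<le> real X" by linarith
    then have "real X powr (- u) \<le> (2 * real (X div 2)) powr (- u)" using h u by (intro powr_mono2') auto
    also have "\<dots> = real (X div 2) powr (- u) / 2 powr u" by (simp add: powr_mult powr_minus_divide)
    finally have "2 powr u * real X powr (- u) \<le> real (X div 2) powr (- u)" by (simp add: field_simps)
    moreover have "13 / 12 * real X powr (- u) \<le> 2 powr u * real X powr (- u)" using 2 by (intro mult_right_mono) auto
    ultimately show ?thesis by linarith
  qed
  have fin: "finite {n. N < real n \<and> n \<le> Y}" for Y by (rule finite_subset[of _ "{..Y}"]) auto
  have "(\<Sum>n | N < real n \<and> n \<le> X. f n) \<le> (\<Sum>n\<in>{n. N < real n \<and> n \<le> X div 2} \<union> {X div 2<..X}. f n)"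
    using fin f by (intro sum_mono2) auto
  also have "\<dots> = (\<Sum>n | N < real n \<and> n \<le> X div 2. f n) + (\<Sum>n\<in>{X div 2<..X}. f n)"
    using fin by (intro sum.union_disjoint) auto
  finally have 1: "(\<Sum>n | N < real n \<and> n \<le> X. f n)
      \<le> (\<Sum>n | N < real n \<and> n \<le> X div 2. f n) + (a * real X powr (- s) + b * real X powr (- r))"
    using step[OF less.prems] by linarith
  show ?case
  \<comment> \<open>If X/2 is still at least N, the negative terms of the induction hypothesis pay
    for the new block by \<open>half\<close>; otherwise the block is the whole range, and the
    surplus 13 - 12 covers it.\<close>
  proof (cases "real (X div 2) \<ge> N")
    case True
    then have h: "X div 2 \<ge> 1" using N by linarith
    have "(\<Sum>n | N < real n \<and> n \<le> X div 2. f n)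
      \<le> a * (13 * N powr (- s) - 12 * real (X div 2) powr (- s)) + b * (13 * N powr (- r) - 12 * real (X div 2) powr (- r))"
      using True h less.prems by (intro less.IH) auto
    moreover have "a * (13 * real X powr (- s)) \<le> a * (12 * real (X div 2) powr (- s))"
      "b * (13 * real X powr (- r)) \<le> b * (12 * real (X div 2) powr (- r))"
      using half h s ab by (intro mult_left_mono; simp)+
    ultimately show ?thesis using 1 by (simp add: algebra_simps)
  next
    case False
    then have empty: "{n. N < real n \<and> n \<le> X div 2} = {}" by auto
    have "a * real X powr (- s) \<le> a * N powr (- s)" "b * real X powr (- r) \<le> b * N powr (- r)"
      using mono s ab by (intro mult_left_mono; simp)+
    then show ?thesis using 1 unfolding empty by (simp add: algebra_simps)
  qed
qed

lemma mangoldt_le_ln: "n > 0 \<Longrightarrow> (mangoldt n :: real) \<le> ln (real n)"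
proof (cases "primepow n")
  case True
  assume n: "n > 0"
  have "aprimedivisor n dvd n" using primepow_gt_Suc_0[OF True] by (intro aprimedivisor_nat(2)) auto
  then have "aprimedivisor n \<le> n" using n by (rule dvd_imp_le)
  moreover have "aprimedivisor n > 0" using primepow_gt_Suc_0[OF True] by (intro aprimedivisor_pos_nat) auto
  ultimately show ?thesis using True by (simp add: mangoldt_def)
qed (simp add: mangoldt_def)

lemma mangoldt_nonneg_real: "(mangoldt n :: real) \<ge> 0"
proof (cases "primepow n")
  case True
  have "aprimedivisor n > 0" using primepow_gt_Suc_0[OF True] by (intro aprimedivisor_pos_nat) auto
  then show ?thesis by (simp add: mangoldt_def)
qed (simp add: mangoldt_def)

text \<open>A block (X/2, X] contributes at most 2 ln X / X per family member. For X \<le>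
  p^(1/1000) this is 60 ln p X^(-252/463), as ln X cancels and 1 - 211/463 = 252/463; for larger X
  the trivial bound gives 4 ln p X^(-1/4). Summation over blocks multiplies by 13, whence 780 and
  52. The term 1 / p comes from n = p.\<close>

lemma ihara_tail_bound:
  "\<exists>t\<^sub>0\<ge>10. \<forall>p M. prime p \<longrightarrow> t\<^sub>0 \<le> ln (real p) \<longrightarrow> 1 \<le> M \<longrightarrow> M \<le> real p \<longrightarrow>
     0 \<le> ihara_sum p - ihara_partial_sum p M \<and>
     ihara_sum p - ihara_partial_sum p M
       \<le> ln (real p) * (1 / real p + 780 * M powr (- 252 / 463) + 52 * real p powr (- 1 / 8000))"
proof -
  obtain t\<^sub>0 where t0: "t\<^sub>0 \<ge> 10" and small: "\<And>p X P. prime p \<Longrightarrow> t\<^sub>0 \<le> ln (real p) \<Longrightarrow> 2 \<le> X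
      \<Longrightarrow> 1000 * ln (real X) \<le> ln (real p) \<Longrightarrow> unit_root_family p X P
      \<Longrightarrow> real (card P) \<le> 30 * (ln (real p) / ln (real X)) * real X powr (211 / 463)"
    using unit_root_family_small_bound by blast
  show ?thesis
  proof (intro exI[of _ t\<^sub>0] conjI[OF t0] allI impI)
    fix p M assume p: "prime p" and tp: "t\<^sub>0 \<le> ln (real p)" and M: "1 \<le> M" "M \<le> real p"
    define \<l> where "\<l> = ln (real p)"
    have l0: "\<l> \<ge> 10" using tp t0 by (simp add: \<l>_def)
    have p1: "real p > 1" using prime_gt_1_nat[OF p] by simp
    define V where "V = vanishing_fermat_quotients p (real p)"
    have finV: "finite V" unfolding V_def vanishing_fermat_quotients_def by (rule finite_subset[of _ "{..p}"]) auto
    define f :: "nat \<Rightarrow> real" where "f = (\<lambda>n. if n \<in> V \<and> n \<noteq> p then mangoldt n / real n else 0)"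
    have f0: "f n \<ge> 0" for n by (simp add: f_def mangoldt_nonneg_real)
    define T where "T = {n \<in> V. M < real n}"
    have sub: "vanishing_fermat_quotients p M = {n \<in> V. real n \<le> M}"
      using M by (auto simp: V_def vanishing_fermat_quotients_def)
    have diff: "ihara_sum p - ihara_partial_sum p M = (\<Sum>n\<in>T. mangoldt n / real n)"
    proof -
      have "V = {n \<in> V. real n \<le> M} \<union> T" by (auto simp: T_def)
      then have "(\<Sum>n\<in>V. mangoldt n / real n) = (\<Sum>n | n \<in> V \<and> real n \<le> M. mangoldt n / real n) + (\<Sum>n\<in>T. (mangoldt n :: real) / real n)"
        using finV by (subst sum.union_disjoint[symmetric]) (auto simp: T_def)
      then show ?thesis by (simp add: ihara_sum_def ihara_partial_sum_def sub V_def)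
    qed
    have "(\<Sum>n\<in>T. (mangoldt n :: real) / real n) \<le> mangoldt p / real p + (\<Sum>n\<in>T. f n)"
    proof -
      have "(\<Sum>n\<in>T. (mangoldt n :: real) / real n) \<le> (\<Sum>n\<in>T. (if n = p then mangoldt p / real p else 0) + f n)"
        by (intro sum_mono) (auto simp: f_def T_def)
      also have "\<dots> = (\<Sum>n\<in>T. if n = p then mangoldt p / real p else 0) + (\<Sum>n\<in>T. f n)" by (rule sum.distrib)
      also have "(\<Sum>n\<in>T. if n = p then mangoldt p / real p else 0) \<le> (mangoldt p :: real) / real p"
        using finV by (simp add: T_def sum.delta mangoldt_nonneg_real)
      finally show ?thesis by simp
    qed
    moreover have "mangoldt p / real p \<le> \<l> * (1 / real p)"
      using mangoldt_le_ln[of p] p1 by (simp add: \<l>_def divide_right_mono)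
    moreover have "(\<Sum>n\<in>T. f n) \<le> (\<Sum>n | M < real n \<and> n \<le> p. f n)"
    proof (rule sum_mono2)
      show "finite {n. M < real n \<and> n \<le> p}" by (rule finite_subset[of _ "{..p}"]) auto
      show "T \<subseteq> {n. M < real n \<and> n \<le> p}" by (auto simp: T_def V_def vanishing_fermat_quotients_def)
    qed (use f0 in auto)
    moreover have "(\<Sum>n | M < real n \<and> n \<le> p. f n)
        \<le> (60 * \<l>) * (13 * M powr (- (252 / 463)) - 12 * real p powr (- (252 / 463)))
          + (4 * \<l> * real p powr (- 1 / 8000)) * (13 * M powr (- (1 / 8)) - 12 * real p powr (- (1 / 8)))"
    proof (rule dyadic_sum_bound[where M = p])
      fix X assume X: "M \<le> real X" "X \<le> p"
      show "(\<Sum>n\<in>{X div 2<..X}. f n)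
        \<le> 60 * \<l> * real X powr (- (252 / 463)) + 4 * \<l> * real p powr (- 1 / 8000) * real X powr (- (1 / 8))"
      proof (cases "X = 1")
        case True
        have "{X div 2<..X} = {1}" using True by auto
        then show ?thesis using l0 True by (simp add: f_def)
      next
        case False
        then have X2: "X \<ge> 2" using X M by linarith
        define x where "x = ln (real X)"
        have x0: "x > 0" using X2 by (simp add: x_def)
        define P where "P = {n \<in> {X div 2<..X}. primepow n \<and> is_unit_root p n}"
        have fam: "unit_root_family p X P"
          unfolding unit_root_family_def
        proof (intro conjI ballI impI)
          show "finite P" by (simp add: P_def)
          fix w assume "w \<in> P"
          then show "1 < w" "w \<le> X" "is_unit_root p w" using primepow_gt_Suc_0[of w] by (auto simp: P_def)
        next
          fix v w assume "v \<in> P" "w \<in> P" "v \<noteq> w"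
          then show "coprime v w" by (intro primepow_coprime_dyadic[of v w X]) (auto simp: P_def)
        qed
        have fn: "f n \<le> (if n \<in> P then 2 * x / real X else 0)" if n: "n \<in> {X div 2<..X}" for n
        proof (cases "n \<in> V \<and> n \<noteq> p \<and> primepow n")
          case True
          then have "is_unit_root p n"
            using p by (intro vanishing_imp_unit_root) (auto simp: V_def vanishing_fermat_quotients_def)
          then have nP: "n \<in> P" using n True by (simp add: P_def)
          have n0: "n > 0" "real X \<le> 2 * real n" "real n \<le> real X" using n by auto
          have "mangoldt n \<le> x" using mangoldt_le_ln[OF n0(1)] n0 unfolding x_def
            by (meson ln_mono of_nat_0_less_iff order_trans)
          then have "mangoldt n / real n \<le> x / (real X / 2)"
            using n0 x0 X2 by (intro frac_le) (auto simp: mangoldt_nonneg_real)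
          then show ?thesis using nP True by (simp add: f_def mult.commute)
        next
          case False
          then have "f n = 0" by (auto simp: f_def mangoldt_def)
          then show ?thesis using x0 by simp
        qed
        have "(\<Sum>n\<in>{X div 2<..X}. f n) \<le> (\<Sum>n\<in>{X div 2<..X}. if n \<in> P then 2 * x / real X else 0)"
          by (intro sum_mono fn)
        also have "\<dots> = real (card P) * (2 * x / real X)"
        proof -
          have "{X div 2<..X} \<inter> P = P" by (auto simp: P_def)
          then show ?thesis by (simp add: sum.If_cases Int_def[symmetric])
        qed
        finally have le: "(\<Sum>n\<in>{X div 2<..X}. f n) \<le> real (card P) * (2 * x / real X)" .
        have pw: "real X powr u * (1 / real X) = real X powr (u - 1)" for u
          using X2 by (simp add: powr_diff)
        show ?thesis
        proof (cases "1000 * x \<le> \<l>")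
          case True
          have "real (card P) * (2 * x / real X) \<le> 30 * (\<l> / x) * real X powr (211 / 463) * (2 * x / real X)"
            using small[OF p tp X2 _ fam] True x0 by (intro mult_right_mono) (auto simp: \<l>_def x_def)
          also have "\<dots> = 60 * \<l> * (real X powr (211 / 463) * (1 / real X))" using x0 by simp
          also have "\<dots> = 60 * \<l> * real X powr (- (252 / 463))" unfolding pw by simp
          finally show ?thesis using le l0 by (smt (verit) mult_nonneg_nonneg powr_ge_zero)
        next
          case False
          have "real (card P) * (2 * x / real X) \<le> 2 * (\<l> / x) * real X powr (3 / 4) * (2 * x / real X)"
            using unit_root_family_trivial_bound[OF p X2 X(2) fam] x0 by (intro mult_right_mono) (auto simp: \<l>_def x_def)
          also have "\<dots> = 4 * \<l> * (real X powr (3 / 4) * (1 / real X))" using x0 by simp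
          \<comment> \<open>One half of X^(-1/4) is traded for p^(-1/8000) by X > p^(1/1000); the
            other half keeps the blocks summable.\<close>
          also have "\<dots> = 4 * \<l> * (real X powr (- (1 / 8)) * real X powr (- (1 / 8)))"
            unfolding pw by (simp flip: powr_add)
          also have "\<dots> \<le> 4 * \<l> * (real p powr (- 1 / 8000) * real X powr (- (1 / 8)))"
          proof (intro mult_left_mono mult_right_mono)
            have "real X powr (- (1 / 8)) = exp (- (1 / 8) * x)" using X2 by (simp add: powr_def x_def)
            also have "\<dots> \<le> exp (- (1 / 8000) * \<l>)" using False by simp
            also have "\<dots> = real p powr (- 1 / 8000)" using p1 by (simp add: powr_def \<l>_def)
            finally show "real X powr (- (1 / 8)) \<le> real p powr (- 1 / 8000)" .
          qed (use l0 in auto)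
          finally show ?thesis using le l0 by (smt (verit) mult.assoc mult_nonneg_nonneg powr_ge_zero)
        qed
      qed
    qed (use l0 M f0 in auto)
    moreover have "(60 * \<l>) * (13 * M powr (- (252 / 463)) - 12 * real p powr (- (252 / 463))) \<le> \<l> * (780 * M powr (- 252 / 463))"
      using l0 by (simp add: algebra_simps)
    moreover have "(4 * \<l> * real p powr (- 1 / 8000)) * (13 * M powr (- (1 / 8)) - 12 * real p powr (- (1 / 8)))
        \<le> \<l> * (52 * real p powr (- 1 / 8000))"
    proof -
      have "M powr (- (1 / 8)) \<le> M powr 0" using M by (intro powr_mono) auto
      then have "M powr (- (1 / 8)) \<le> 1" using M by simp
      moreover have "real p powr (- (1 / 8)) \<ge> 0" by simp
      ultimately have "13 * M powr (- (1 / 8)) - 12 * real p powr (- (1 / 8)) \<le> 13" by linarith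
      then have "(4 * \<l> * real p powr (- 1 / 8000)) * (13 * M powr (- (1 / 8)) - 12 * real p powr (- (1 / 8)))
          \<le> (4 * \<l> * real p powr (- 1 / 8000)) * 13" using l0 by (intro mult_left_mono) auto
      then show ?thesis by simp
    qed
    ultimately have "ihara_sum p - ihara_partial_sum p M
        \<le> \<l> * (1 / real p) + \<l> * (780 * M powr (- 252 / 463)) + \<l> * (52 * real p powr (- 1 / 8000))"
      unfolding diff by linarith
    moreover have "0 \<le> ihara_sum p - ihara_partial_sum p M"
      unfolding diff by (intro sum_nonneg divide_nonneg_nonneg mangoldt_nonneg_real) auto
    ultimately show "0 \<le> ihara_sum p - ihara_partial_sum p M \<and> ihara_sum p - ihara_partial_sum p M
       \<le> ln (real p) * (1 / real p + 780 * M powr (- 252 / 463) + 52 * real p powr (- 1 / 8000))"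
      by (simp add: \<l>_def distrib_left)
  qed
qed

theorem theorem9:
  fixes N :: "nat \<Rightarrow> real"
  assumes N_ge_1: "\<And>p. prime p \<Longrightarrow> N p \<ge> 1"
    and N_subpoly: "\<exists>\<delta>. (\<delta> \<longlongrightarrow> 0) primes_at_top \<and>
      (\<forall>\<^sub>F p in primes_at_top. N p = real p powr \<delta> p)"
  shows "\<exists>\<epsilon>. (\<epsilon> \<longlongrightarrow> 0) primes_at_top \<and>
    (\<lambda>p. ihara_sum p - ihara_partial_sum p (N p))
      \<in> O[primes_at_top](\<lambda>p. N p powr (- 252 / 463 + \<epsilon> p) * ln (real p))"
proof (intro exI[of _ "\<lambda>_. 0"] conjI tendsto_const)
  \<comment> \<open>The witness \<epsilon> = 0 is possible because 252/463 is strictly less than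
    6/11, the value that the method approaches.\<close>
  obtain \<delta> where \<delta>: "(\<delta> \<longlongrightarrow> 0) primes_at_top" and N: "\<forall>\<^sub>F p in primes_at_top. N p = real p powr \<delta> p"
    using N_subpoly by blast
  obtain t\<^sub>0 where t0: "t\<^sub>0 \<ge> 10" and tail: "\<And>p M. prime p \<Longrightarrow> t\<^sub>0 \<le> ln (real p) \<Longrightarrow> 1 \<le> M \<Longrightarrow> M \<le> real p \<Longrightarrow>
     0 \<le> ihara_sum p - ihara_partial_sum p M \<and>
     ihara_sum p - ihara_partial_sum p M
       \<le> ln (real p) * (1 / real p + 780 * M powr (- 252 / 463) + 52 * real p powr (- 1 / 8000))"
    using ihara_tail_bound by blast
  have "\<forall>\<^sub>F p in primes_at_top. prime p"
    by (simp add: primes_at_top_def eventually_inf_principal)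
  moreover have "\<forall>\<^sub>F p in primes_at_top. t\<^sub>0 \<le> ln (real p)"
  proof -
    have "\<forall>\<^sub>F p :: nat in at_top. t\<^sub>0 \<le> ln (real p)" by real_asymp
    then show ?thesis unfolding primes_at_top_def eventually_inf_principal by (rule eventually_mono) simp
  qed
  moreover have "\<forall>\<^sub>F p in primes_at_top. \<bar>\<delta> p\<bar> < 1 / 8000"
    using tendstoD[OF \<delta>, of "1 / 8000"] by (simp add: dist_real_def)
  \<comment> \<open>833 = 1 + 780 + 52, once each of the three terms of the tail bound is at most a
    multiple of the main one.\<close>
  ultimately have "\<forall>\<^sub>F p in primes_at_top. norm (ihara_sum p - ihara_partial_sum p (N p))
      \<le> 833 * norm (N p powr (- 252 / 463 + 0) * ln (real p))"
    using N
  proof eventually_elim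
    case (elim p)
    have p1: "real p > 1" using prime_gt_1_nat[OF elim(1)] by simp
    have l0: "ln (real p) \<ge> 0" using p1 by simp
    have "real p powr \<delta> p \<le> real p powr 1" using p1 elim(3) by (intro powr_mono) auto
    then have Np: "N p \<le> real p" using p1 elim(4) by simp
    have Npow: "N p powr (- 252 / 463) = real p powr (\<delta> p * (- 252 / 463))" unfolding elim(4) by (rule powr_powr)
    \<comment> \<open>This turns the smallness of \<delta> into N^(252/463) \<le> p^(1/8000), so
      that both power savings in p are absorbed by the main term.\<close>
    have exps: "- 1 / 8000 \<le> \<delta> p * (- 252 / 463)"
    proof -
      have "\<bar>\<delta> p * (252 / 463)\<bar> \<le> \<bar>\<delta> p\<bar>" by (simp add: abs_mult)
      then show ?thesis using elim(3) by linarith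
    qed
    have 1: "real p powr (- 1 / 8000) \<le> N p powr (- 252 / 463)"
      unfolding Npow using p1 exps by (intro powr_mono) auto
    have "real p powr (- 1) \<le> N p powr (- 252 / 463)"
      unfolding Npow using p1 exps by (intro powr_mono) auto
    then have 2: "1 / real p \<le> N p powr (- 252 / 463)" using p1 by (simp add: powr_minus_divide)
    have "1 / real p + 780 * N p powr (- 252 / 463) + 52 * real p powr (- 1 / 8000) \<le> 833 * N p powr (- 252 / 463)"
      using 1 2 by linarith
    then have "ln (real p) * (1 / real p + 780 * N p powr (- 252 / 463) + 52 * real p powr (- 1 / 8000))
        \<le> ln (real p) * (833 * N p powr (- 252 / 463))" using l0 by (rule mult_left_mono)
    moreover note tail[OF elim(1,2) N_ge_1[OF elim(1)] Np]
    ultimately have "0 \<le> ihara_sum p - ihara_partial_sum p (N p) \<and>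
        ihara_sum p - ihara_partial_sum p (N p) \<le> ln (real p) * (833 * N p powr (- 252 / 463))" by linarith
    then show ?case using l0 by (simp add: abs_mult mult.commute)
  qed
  then show "(\<lambda>p. ihara_sum p - ihara_partial_sum p (N p))
      \<in> O[primes_at_top](\<lambda>p. N p powr (- 252 / 463 + 0) * ln (real p))"
    by (rule bigoI)
qed

end
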